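(* Let $A > 0$ be arbitrary but fixed, and for each large prime $q$ set $H = H(q) = q/\log^{A} q$. Let $\chi = \left(\frac{\cdot}{q}\right)$ be the Legendre symbol modulo $q$ (the unique quadratic character modulo $q$), and let $X$ be uniformly distributed on $\{0,1,\dots,q-1\}$. Then, as $q$ tends to infinity through all large primes, the random variables $$ \frac{S_{\chi,H}(X)}{\sqrt{H}} $$ do not converge in distribution to the standard Gaussian $N(0,1)$.
   Context: For a Dirichlet character $\chi$ modulo a prime $q$, a real number $H$ with $1 \le H \le q$, and $x \in \{0,1,\dots,q-1\}$, define $S_{\chi,H}(x) := \sum_{x < n \leq x+H} \chi(n)$ (sum over integers $n$). Here $\log^{A} q = (\log q)^{A}$. *)

theory Defs
  imports "HOL-Probability.Probability" "HOL-Number_Theory.Number_Theory"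
begin

definition short_char_sum :: "(int \<Rightarrow> 'a::comm_monoid_add) \<Rightarrow> real \<Rightarrow> int \<Rightarrow> 'a" where
  "short_char_sum f H x = (\<Sum>n | x < n \<and> real_of_int n \<le> real_of_int x + H. f n)"

definition legendre_char :: "nat \<Rightarrow> int \<Rightarrow> real" where
  "legendre_char q n = real_of_int (Legendre n (int q))"

(* The k-th prime, counting from k = 0 and including 2. Convergence along this sequence
   is convergence as q tends to infinity through all primes, and finitely many
   small primes are irrelevant to it. *)
definition nth_prime :: "nat \<Rightarrow> nat" where
  "nth_prime k = enumerate {q. prime q} k"

definition uniform_residues :: "nat \<Rightarrow> int measure" where
  "uniform_residues q = measure_pmf (pmf_of_set {0..<int q})"

end

theory Submission
  imports Defs "HOL-Real_Asymp.Real_Asymp"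
begin

text \<open>
  By completing the sum with Gauss sums, the mean of \<open>S(x)\<^sup>2 / H\<close> over \<open>x\<close> close to \<open>0\<close> becomes a Fejer
  type average of \<open>\<chi>\<close>, essentially \<open>(\<Sum>k. \<chi>(k) (sin (\<pi> k / K) / (\<pi> k / K))\<^sup>2)\<close> with
  \<open>K = q / H = log\<^sup>A q\<close>. The variables have second moment at most that of the Gaussian, so
  convergence in distribution makes their squares uniformly integrable; since the \<open>x\<close> close to \<open>0\<close>
  form a set of vanishing proportion, the Fejer average must be \<open>o(K)\<close>.

  On the other hand there are arbitrarily large primes \<open>q\<close> for which the Fejer average is at least \<open>c K\<close>,
  namely primes \<open>q \<equiv> 1 (mod 8)\<close> modulo which every prime \<open>p \<le> y\<close> is a quadratic residue, where \<open>y\<close> is a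
  small power of \<open>log q\<close>: for them \<open>\<chi>(k) = 1\<close> on the \<open>y\<close>-smooth numbers, which have positive
  density up to \<open>K\<close>, and on average over \<open>q\<close> the other \<open>k\<close> do no harm. Such \<open>q\<close> are detected by
  a product of characters with the weight \<open>\<Lambda>(q) (log q)^m q^(-1-e)\<close>, that is, through high
  derivatives of \<open>L' / L\<close> to the right of \<open>1\<close>. This needs a lower bound for \<open>L(1 + e, \<chi>)\<close> for all
  characters involved, which holds on infinitely many scales \<open>y\<close> because small values of real
  \<open>L\<close>-functions repel each other.
\<close>

section \<open>Dirichlet series of periodic functions\<close>

text \<open>With \<open>s = 1 + e\<close> and \<open>e = y^(-12)\<close>, the pole of \<zeta> makes
  the Taylor coefficient of order \<open>m\<close> of \<open>- L' / L\<close> about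
  \<open>e^(-(m+1))\<close> for the trivial character, up to sign. For a character of modulus at
  most \<open>exp (y^2)\<close>, a lower bound of order \<open>y^(-8)\<close> for
  \<open>L(1 + e, \<chi>)\<close> lets the constant Taylor coefficient of \<open>L\<close> dominate
  in a disc of radius \<open>8 e\<close>, and the coefficient of \<open>- L' / L\<close> is then at
  most \<open>(2 e)^(-(m+1))\<close>. For \<open>m = y^2\<close> the saving \<open>2^(-m)\<close>
  beats the \<open>2^y\<close> characters into which the weight selecting \<open>q\<close> expands;
  a fixed derivative would not. The weight concentrates on \<open>ln q\<close> near
  \<open>m / e = y^14\<close>, so \<open>K\<close> is about \<open>y^(14 A)\<close>, a fixed power
  of \<open>y\<close>, which is why smooth numbers have positive density up to \<open>K\<close>.

  The obstacle is an exceptional character whose \<open>L\<close>-value near \<open>1\<close> is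
  tiny. At each large scale there is at most one, and it may spoil that scale altogether; but
  infinitely many \<open>q\<close> suffice, and one fixed character cannot spoil every large
  scale.\<close>

lemma pow_fact_le_exp:
  fixes u a :: real
  assumes "u \<ge> 0" "a > 0"
  shows "u ^ j / fact j \<le> exp (a * u) / a ^ j"
proof -
  have "(a * u) ^ j / fact j = (\<Sum>n\<in>{j}. (a*u) ^ n /\<^sub>R fact n)"
    by (simp add: field_simps)
  also have "\<dots> \<le> (\<Sum>n. (a*u) ^ n /\<^sub>R fact n)"
    using assms by (intro sum_le_suminf summable_exp_generic) auto
  also have "\<dots> = exp (a * u)" by (simp add: exp_def)
  finally show ?thesis using assms by (simp add: field_simps power_mult_distrib)
qed

text \<open>Abel summation where a majorant \<open>G\<close> takes the place of monotonicity. It is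
  meant mainly for \<open>h n = ln n ^ j * n powr (-s)\<close>, which rises before it falls, so that
  only its variation can be controlled.\<close>

lemma abel_bound:
  fixes c h G :: "nat \<Rightarrow> real"
  assumes partial: "\<And>n. M \<le> n \<Longrightarrow> \<bar>\<Sum>k=M..n. c k\<bar> \<le> B"
    and var: "\<And>n. M \<le> n \<Longrightarrow> \<bar>h n - h (Suc n)\<bar> \<le> G n - G (Suc n)"
    and bd: "\<And>n. M \<le> n \<Longrightarrow> \<bar>h n\<bar> \<le> G n"
    and "M \<le> N"
  shows "\<bar>\<Sum>k=M..N. c k * h k\<bar> \<le> B * G M"
proof -
  have B: "B \<ge> 0" using partial[of M] by simp
  \<comment> \<open>The boundary term of the summation by parts is subtracted, since in this form
    the bound telescopes in \<open>N\<close>.\<close>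
  have "\<bar>(\<Sum>k=M..N. c k * h k) - (\<Sum>k=M..N. c k) * h N\<bar> \<le> B * (G M - G N)"
    using \<open>M \<le> N\<close>
  proof (induction N rule: dec_induct)
    case base
    then show ?case by simp
  next
    case (step n)
    have "(\<Sum>k=M..Suc n. c k * h k) - (\<Sum>k=M..Suc n. c k) * h (Suc n)
      = ((\<Sum>k=M..n. c k * h k) - (\<Sum>k=M..n. c k) * h n) + (\<Sum>k=M..n. c k) * (h n - h (Suc n))"
      using step by (simp add: algebra_simps)
    moreover have "\<bar>(\<Sum>k=M..n. c k) * (h n - h (Suc n))\<bar> \<le> B * (G n - G (Suc n))"
      unfolding abs_mult using partial[of n] var[of n] step B by (intro mult_mono) auto
    ultimately have "\<bar>(\<Sum>k=M..Suc n. c k * h k) - (\<Sum>k=M..Suc n. c k) * h (Suc n)\<bar>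
       \<le> B * (G M - G n) + B * (G n - G (Suc n))"
      using step by linarith
    then show ?case by (simp add: algebra_simps)
  qed
  moreover have "\<bar>(\<Sum>k=M..N. c k) * h N\<bar> \<le> B * G N"
    unfolding abs_mult using partial[of N] bd[of N] assms B by (intro mult_mono) auto
  ultimately show ?thesis by (simp add: algebra_simps)
qed

text \<open>The Taylor coefficient of order \<open>j\<close>, up to sign, of
  \<open>x powr (-s)\<close> in \<open>s\<close>; the factor \<open>1 / fact j\<close> turns
  products of series into plain convolutions of coefficients. As \<open>0 powr a = 0\<close>, the
  index \<open>0\<close> drops out of every series.\<close>

definition lnpow :: "nat \<Rightarrow> real \<Rightarrow> real \<Rightarrow> real" where
  "lnpow j s x = ln x ^ j / fact j * x powr (-s)"

lemma lnpow_0 [simp]: "lnpow j s 0 = 0"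
  by (simp add: lnpow_def)

lemma lnpow_nonneg: "x \<ge> 1 \<Longrightarrow> lnpow j s x \<ge> 0"
  by (simp add: lnpow_def)

lemma lnpow_nonneg_nat [simp]: "lnpow j s (real n) \<ge> 0"
  by (cases "n = 0") (auto simp: lnpow_nonneg)

lemma ln_pow_fact_le:
  fixes x a :: real
  assumes "x \<ge> 1" "a > 0"
  shows "ln x ^ j / fact j \<le> (1/a) ^ j * x powr a"
  using pow_fact_le_exp[of "ln x" a j] assms by (simp add: powr_def power_divide)

lemma lnpow_le:
  assumes "x \<ge> 1" "a > 0"
  shows "lnpow j s x \<le> (1/a) ^ j * x powr (a - s)"
proof -
  have "lnpow j s x \<le> ((1/a) ^ j * x powr a) * x powr (-s)"
    unfolding lnpow_def by (intro mult_right_mono ln_pow_fact_le assms) auto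
  also have "\<dots> = (1/a) ^ j * (x powr a * x powr (-s))" by (rule mult.assoc)
  also have "x powr a * x powr (-s) = x powr (a - s)" by (simp flip: powr_add)
  finally show ?thesis .
qed

text \<open>Dominates both \<open>lnpow j s\<close> and its variation beyond \<open>x\<close>,
  uniformly in \<open>1 \<le> s \<le> 2\<close>: half a power of \<open>x\<close> absorbs the
  logarithms at the cost of \<open>2 ^ j\<close>.\<close>

definition variation_bound :: "nat \<Rightarrow> real \<Rightarrow> real" where
  "variation_bound j x = 6 * 2 ^ j * x powr (-1/2)"

lemma lnpow_deriv:
  assumes "x > 0"
  shows "(lnpow j s has_real_derivative
    ((if j = 0 then 0 else lnpow (j-1) (s+1) x) - s * lnpow j (s+1) x)) (at x)"
proof (cases j)
  case 0
  have "((\<lambda>x. x powr (-s)) has_real_derivative (-s * x powr (-s - 1))) (at x)"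
    using assms by (rule has_real_derivative_powr)
  then show ?thesis using 0 by (simp add: lnpow_def[abs_def])
next
  case (Suc i)
  have f: "fact (Suc i) = (1 + real i) * fact i" by simp
  have d: "((\<lambda>x. ln x ^ Suc i / fact (Suc i) * x powr (-s)) has_real_derivative
     ((real (Suc i) * ln x ^ i * (1/x)) / fact (Suc i) * x powr (-s)
       + ln x ^ Suc i / fact (Suc i) * (-s * x powr (-s - 1)))) (at x)"
    by (rule derivative_eq_intros refl has_real_derivative_powr DERIV_ln_divide assms | simp add: assms)+
  have e1: "(real (Suc i) * ln x ^ i * (1/x)) / fact (Suc i) * x powr (-s) = ln x ^ i / fact i * x powr (-s-1)"
    unfolding f using assms by (simp add: divide_simps powr_diff)
  have e2: "ln x ^ Suc i / fact (Suc i) * (-s * x powr (-s - 1)) = - (s * (ln x ^ Suc i / fact (Suc i) * x powr (-s - 1)))"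
    by (simp del: fact_Suc power_Suc)
  have "((\<lambda>x. ln x ^ Suc i / fact (Suc i) * x powr (-s)) has_real_derivative
     (ln x ^ i / fact i * x powr (-s - 1) - s * (ln x ^ Suc i / fact (Suc i) * x powr (-s - 1)))) (at x)"
    using d unfolding e1 e2 by (simp only: add_uminus_conv_diff)
  then show ?thesis using Suc by (simp add: lnpow_def[abs_def] del: fact_Suc power_Suc)
qed

lemma variation_bound_deriv:
  assumes "x > 0"
  shows "(variation_bound j has_real_derivative (- 3 * 2 ^ j * x powr (-3/2))) (at x)"
proof -
  have "((\<lambda>x. 6 * 2 ^ j * x powr (-1/2)) has_real_derivative (6 * 2 ^ j * ((-1/2) * x powr (-1/2 - 1)))) (at x)"
    using assms by (intro DERIV_cmult has_real_derivative_powr)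
  then show ?thesis by (simp add: variation_bound_def[abs_def] mult.assoc)
qed

text \<open>The constant is \<open>3 = 1 + 2\<close>: each term is at most
  \<open>2 ^ j * x powr (-3/2)\<close> apart from the factor \<open>s \<le> 2\<close>. The right
  side is minus the derivative of \<open>variation_bound j\<close>.\<close>

lemma lnpow_deriv_bound:
  assumes "x \<ge> 1" "1 \<le> s" "s \<le> 2"
  shows "\<bar>(if j = 0 then 0 else lnpow (j-1) (s+1) x) - s * lnpow j (s+1) x\<bar> \<le> 3 * 2 ^ j * x powr (-3/2)"
proof -
  have le: "lnpow i (s+1) x \<le> 2 ^ i * x powr (-3/2)" for i
  proof -
    have "lnpow i (s+1) x \<le> 2 ^ i * x powr (1/2 - (s+1))"
      using lnpow_le[of x "1/2" i "s+1"] assms by simp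
    also have "x powr (1/2 - (s+1)) \<le> x powr (-3/2)"
      using assms by (intro powr_mono) auto
    finally show ?thesis by simp
  qed
  define P where "P = x powr (-3/2)"
  have P: "P \<ge> 0" by (simp add: P_def)
  have 1: "0 \<le> s * lnpow j (s+1) x" "s * lnpow j (s+1) x \<le> 2 * (2 ^ j * P)"
    using assms le[of j] lnpow_nonneg[of x j "s+1"] unfolding P_def
    by (auto intro!: mult_mono)
  have 2: "0 \<le> (if j = 0 then 0 else lnpow (j-1) (s+1) x)"
     "(if j = 0 then 0 else lnpow (j-1) (s+1) x) \<le> 2 ^ j * P"
  proof -
    have "2 ^ (j-1) * P \<le> 2 ^ j * P" using P by (intro mult_right_mono power_increasing) auto
    then show "(if j = 0 then 0 else lnpow (j-1) (s+1) x) \<le> 2 ^ j * P"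
      using le[of "j-1"] P unfolding P_def by auto
  qed (use assms lnpow_nonneg in auto)
  have "2 ^ j * P \<ge> 0" using P by simp
  then show ?thesis using 1 2 unfolding P_def[symmetric] by linarith
qed

text \<open>Both \<open>variation_bound j - lnpow j s\<close> and
  \<open>variation_bound j + lnpow j s\<close> are nonincreasing, because the derivative of
  \<open>lnpow j s\<close> is bounded by minus that of \<open>variation_bound j\<close>.\<close>

lemma lnpow_variation:
  assumes "1 \<le> x" "x \<le> y" "1 \<le> s" "s \<le> 2"
  shows "\<bar>lnpow j s x - lnpow j s y\<bar> \<le> variation_bound j x - variation_bound j y"
proof -
  define d where "d = (\<lambda>x. (if j = 0 then 0 else lnpow (j-1) (s+1) x) - s * lnpow j (s+1) x)"
  have d: "\<bar>d z\<bar> \<le> 3 * 2 ^ j * z powr (-3/2)" if "z \<ge> 1" for z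
    unfolding d_def using that assms by (intro lnpow_deriv_bound) auto
  have "variation_bound j y - lnpow j s y \<le> variation_bound j x - lnpow j s x"
  proof (rule DERIV_nonpos_imp_nonincreasing[OF assms(2)], goal_cases)
    case (1 z)
    have "((\<lambda>z. variation_bound j z - lnpow j s z) has_real_derivative (- 3 * 2 ^ j * z powr (-3/2) - d z)) (at z)"
      unfolding d_def using 1 assms by (intro DERIV_diff variation_bound_deriv lnpow_deriv) auto
    then show ?case using d[of z] 1 assms by (auto intro!: exI)
  qed
  moreover have "variation_bound j y + lnpow j s y \<le> variation_bound j x + lnpow j s x"
  proof (rule DERIV_nonpos_imp_nonincreasing[OF assms(2)], goal_cases)
    case (1 z)
    have "((\<lambda>z. variation_bound j z + lnpow j s z) has_real_derivative (- 3 * 2 ^ j * z powr (-3/2) + d z)) (at z)"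
      unfolding d_def using 1 assms by (intro DERIV_add variation_bound_deriv lnpow_deriv) auto
    then show ?case using d[of z] 1 assms by (auto intro!: exI)
  qed
  ultimately show ?thesis by linarith
qed

lemma lnpow_le_variation_bound:
  assumes "1 \<le> x" "1 \<le> s"
  shows "\<bar>lnpow j s x\<bar> \<le> variation_bound j x"
proof -
  have "lnpow j s x \<le> 2 ^ j * x powr (1/2 - s)"
    using lnpow_le[of x "1/2" j s] assms by simp
  also have "\<dots> \<le> 6 * 2 ^ j * x powr (-1/2)"
    using assms by (intro mult_mono powr_mono) auto
  finally show ?thesis using lnpow_nonneg[of x j s] assms by (simp add: variation_bound_def)
qed

definition zero_mean :: "nat \<Rightarrow> (nat \<Rightarrow> real) \<Rightarrow> bool" where
  "zero_mean D f \<longleftrightarrow> D > 0 \<and> (\<forall>n. f (n + D) = f n) \<and> (\<Sum>n<D. f n) = 0"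

lemma zero_mean_block:
  assumes "zero_mean D f"
  shows "(\<Sum>n=M..<M+D. f n) = 0"
proof (induction M)
  case 0
  then show ?case using assms by (simp add: zero_mean_def atLeast0LessThan)
next
  case (Suc M)
  have "D > 0" "f (M + D) = f M" using assms by (auto simp: zero_mean_def)
  then have "(\<Sum>n=M..<M+D. f n) = f M + (\<Sum>n=Suc M..<M+D. f n)"
    by (subst sum.atLeast_Suc_lessThan) auto
  moreover have "(\<Sum>n=Suc M..<Suc M+D. f n) = (\<Sum>n=Suc M..<M+D. f n) + f (M + D)"
    using \<open>D > 0\<close> by simp
  ultimately show ?case using Suc \<open>f (M+D) = f M\<close> by simp
qed

text \<open>Whole periods cancel, and fewer than \<open>D\<close> terms are left.\<close>

lemma zero_mean_partial:
  assumes "zero_mean D f" and bd: "\<And>n. \<bar>f n\<bar> \<le> 1"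
  shows "\<bar>\<Sum>n=M..<M+L. f n\<bar> \<le> D"
proof (induction L arbitrary: M rule: less_induct)
  case (less L)
  show ?case
  proof (cases "L < D")
    case True
    have "\<bar>\<Sum>n=M..<M+L. f n\<bar> \<le> (\<Sum>n=M..<M+L. 1)"
      by (rule order_trans[OF sum_abs]) (use bd in \<open>intro sum_mono\<close>)
    then show ?thesis using True by simp
  next
    case False
    have "D > 0" using assms by (simp add: zero_mean_def)
    have "(\<Sum>n=M..<M+L. f n) = (\<Sum>n=M..<M+D. f n) + (\<Sum>n=M+D..<M+L. f n)"
      using False by (subst sum.atLeastLessThan_concat) auto
    also have "\<dots> = (\<Sum>n=M+D..<(M+D)+(L-D). f n)"
      using zero_mean_block[OF assms(1)] False by simp
    finally show ?thesis using less[of "L - D" "M + D"] False \<open>D > 0\<close> by simp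
  qed
qed

lemma zero_mean_partial':
  assumes "zero_mean D f" and bd: "\<And>n. \<bar>f n\<bar> \<le> 1" and "M \<le> N"
  shows "\<bar>\<Sum>n=M..N. f n\<bar> \<le> D"
proof -
  have "{M..N} = {M..<M + (Suc N - M)}" using assms by auto
  then show ?thesis using zero_mean_partial[OF assms(1,2), of M "Suc N - M"] by simp
qed

text \<open>\<open>dser f j s\<close> is \<open>(-1)^j / j!\<close> times the \<open>j\<close>-th derivative of \<open>L(s, f) = (\<Sum>n. f n n^(-s))\<close>;
  \<open>mser f j s\<close> below is the same for \<open>- L' / L\<close>.\<close>

definition dser :: "(nat \<Rightarrow> real) \<Rightarrow> nat \<Rightarrow> real \<Rightarrow> real" where
  "dser f j s = (\<Sum>n. f n * lnpow j s (real n))"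

lemma summable_lnpow:
  assumes "s > 1"
  shows "summable (\<lambda>n. lnpow j s (real n))"
proof -
  define a where "a = (s - 1) / 2"
  have a: "a > 0" "a - s < -1" using assms by (auto simp: a_def field_simps)
  have "summable (\<lambda>n. (1/a) ^ j * real n powr (a - s))"
    using a summable_real_powr_iff[of "a - s"] by (intro summable_mult) auto
  moreover have "norm (lnpow j s (real n)) \<le> (1/a) ^ j * real n powr (a - s)" for n
    using lnpow_le[of "real n" a j s] a by (cases "n = 0") auto
  ultimately show ?thesis by (rule summable_comparison_test'[where N = 0]) 
qed

lemma summable_dser_abs:
  assumes "s > 1" and bd: "\<And>n. \<bar>f n\<bar> \<le> 1"
  shows "summable (\<lambda>n. \<bar>f n * lnpow j s (real n)\<bar>)"
proof (rule summable_comparison_test'[OF summable_lnpow[OF assms(1), of j], where N = 0])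
  fix n
  have "\<bar>f n\<bar> * lnpow j s (real n) \<le> 1 * lnpow j s (real n)"
    by (intro mult_right_mono bd lnpow_nonneg_nat)
  then show "norm \<bar>f n * lnpow j s (real n)\<bar> \<le> lnpow j s (real n)"
    by (simp add: abs_mult)
qed

lemma summable_dser:
  assumes "s > 1" and bd: "\<And>n. \<bar>f n\<bar> \<le> 1"
  shows "summable (\<lambda>n. f n * lnpow j s (real n))"
  using summable_dser_abs[OF assms] by (rule summable_rabs_cancel)

lemma zero_mean_tail:
  assumes "zero_mean D f" and bd: "\<And>n. \<bar>f n\<bar> \<le> 1" and "1 \<le> M" "1 \<le> s" "s \<le> 2"
  shows "\<bar>\<Sum>n=M..<N. f n * lnpow j s (real n)\<bar> \<le> D * variation_bound j (real M)"
proof (cases "M < N")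
  case True
  have "\<bar>\<Sum>n=M..N-1. f n * lnpow j s (real n)\<bar> \<le> D * variation_bound j (real M)"
    by (rule abel_bound[where h = "\<lambda>n. lnpow j s (real n)" and G = "\<lambda>n. variation_bound j (real n)"])
       (use assms True lnpow_le_variation_bound[of "real _" s j] in \<open>auto intro!: zero_mean_partial' lnpow_variation\<close>)
  moreover have "{M..N-1} = {M..<N}" using True by auto
  ultimately show ?thesis by simp
next
  case False
  then show ?thesis by (simp add: variation_bound_def)
qed

lemma harm_square_le:
  assumes "D \<ge> 1"
  shows "(\<Sum>n=1..D^2. 1 / real n) \<le> 1 + 2 * ln (real D)"
proof -
  have "(\<Sum>n=1..D^2. 1 / real n) = harm (D^2)"
    by (simp add: harm_def divide_inverse)
  also have "\<dots> \<le> 1 + ln (real (D^2))"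
  proof -
    have "harm (Suc (D^2 - 1)) - ln (real (Suc (D^2 - 1))) \<le> (harm (Suc 0) :: real) - ln (real (Suc 0))"
      using decseq_harm_diff_ln by (rule decseqD) simp
    moreover have "harm (Suc 0) = (1::real)" by (simp add: harm_def)
    moreover have "Suc (D^2 - 1) = D^2" using assms by simp
    ultimately show ?thesis by simp
  qed
  also have "\<dots> = 1 + 2 * ln (real D)" using assms by (simp add: ln_realpow)
  finally show ?thesis .
qed

text \<open>The series is cut at \<open>D^2\<close>. Up to there \<open>ln n \<le> 2 * ln D\<close>,
  and absolute values lose only a factor of order \<open>ln D\<close>; beyond, Abel summation costs
  \<open>D\<close> times \<open>variation_bound j (D^2)\<close>, where the \<open>D\<close> cancels.
  \<open>D \<ge> 3\<close> gives \<open>ln D \<ge> 1\<close>, which merges the two parts into one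
  power of the logarithm.\<close>

lemma dser_zero_mean_bound:
  assumes zm: "zero_mean D f" and bd: "\<And>n. \<bar>f n\<bar> \<le> 1" and "3 \<le> D" "1 < s" "s \<le> 2"
  shows "\<bar>dser f j s\<bar> \<le> 5 * (2 * ln (real D)) ^ Suc j"
proof -
  define l where "l = ln (real D)"
  have "exp (1::real) \<le> 3" using exp_le by simp
  then have l: "l \<ge> 1" using assms(3) unfolding l_def
    by (subst ln_ge_iff) auto
  have first: "\<bar>\<Sum>n=1..D^2. f n * lnpow j s (real n)\<bar> \<le> (2 * l) ^ j * (1 + 2 * l)"
  proof -
    have "\<bar>\<Sum>n=1..D^2. f n * lnpow j s (real n)\<bar> \<le> (\<Sum>n=1..D^2. (2 * l) ^ j * (1 / real n))"
    proof (rule order_trans[OF sum_abs], rule sum_mono)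
      fix n assume n: "n \<in> {1..D^2}"
      then have "ln (real n) \<le> ln (real (D^2))" by (subst ln_le_cancel_iff) (use assms(3) in \<open>auto simp del: of_nat_power\<close>)
      also have "\<dots> = 2 * l" using assms(3) by (simp add: ln_realpow l_def)
      finally have "ln (real n) ^ j \<le> (2 * l) ^ j" using n by (intro power_mono) auto
      then have "ln (real n) ^ j / fact j \<le> (2 * l) ^ j / 1"
        using l by (intro frac_le) (auto simp: fact_ge_1)
      moreover have "real n powr (-s) \<le> real n powr (-1)"
        using n assms by (intro powr_mono) auto
      ultimately have "lnpow j s (real n) \<le> (2 * l) ^ j * (1 / real n)"
        unfolding lnpow_def using n l by (intro mult_mono) (auto simp: powr_minus_divide)
      then have "\<bar>f n\<bar> * lnpow j s (real n) \<le> 1 * ((2 * l) ^ j * (1 / real n))"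
        using bd[of n] by (intro mult_mono) auto
      then show "\<bar>f n * lnpow j s (real n)\<bar> \<le> (2 * l) ^ j * (1 / real n)"
        by (simp add: abs_mult)
    qed
    also have "\<dots> = (2 * l) ^ j * (\<Sum>n=1..D^2. 1 / real n)"
      by (simp add: sum_distrib_left)
    also have "\<dots> \<le> (2 * l) ^ j * (1 + 2 * l)"
      using harm_square_le[of D] assms(3) l unfolding l_def by (intro mult_left_mono) auto
    finally show ?thesis .
  qed
  have tail: "\<bar>\<Sum>n=D^2+1..<N. f n * lnpow j s (real n)\<bar> \<le> 6 * (2 * l) ^ j" for N
  proof -
    have "\<bar>\<Sum>n=D^2+1..<N. f n * lnpow j s (real n)\<bar> \<le> D * variation_bound j (real (D^2+1))"
      using assms by (intro zero_mean_tail) auto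
    also have "\<dots> \<le> D * (6 * 2 ^ j * (1 / D))"
    proof -
      have "real (D^2+1) powr (-1/2) \<le> (real (D^2)) powr (-1/2)"
        using assms(3) by (intro powr_mono2') auto
      also have "\<dots> = 1 / D"
      proof -
        have "real (D^2) powr (1/2) = D" by (simp add: powr_half_sqrt)
        then show ?thesis using powr_minus_divide[of "real (D^2)" "1/2"] by (simp only: minus_divide_left)
      qed
      finally have "variation_bound j (real (D^2+1)) \<le> 6 * 2 ^ j * (1 / D)"
        unfolding variation_bound_def by (rule mult_left_mono) simp
      then show ?thesis by (rule mult_left_mono) simp
    qed
    also have "\<dots> = 6 * 2 ^ j" using assms(3) by simp
    also have "\<dots> \<le> 6 * (2 * l) ^ j" using l by (intro mult_left_mono power_mono) auto
    finally show ?thesis .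
  qed
  have part: "\<bar>\<Sum>n<N. f n * lnpow j s (real n)\<bar> \<le> 5 * (2 * l) ^ Suc j" if "N \<ge> D^2+1" for N
  proof -
    have eq: "{..<N} = insert 0 ({1..D^2} \<union> {D^2+1..<N})" using that by auto
    have "(\<Sum>n<N. f n * lnpow j s (real n)) = (\<Sum>n=1..D^2. f n * lnpow j s (real n)) + (\<Sum>n=D^2+1..<N. f n * lnpow j s (real n))"
      unfolding eq by (subst sum.insert, simp, simp, subst sum.union_disjoint) auto
    then have "\<bar>\<Sum>n<N. f n * lnpow j s (real n)\<bar> \<le> (2 * l) ^ j * (1 + 2 * l) + 6 * (2 * l) ^ j"
      using first tail[of N] by linarith
    also have "\<dots> = (2 * l) ^ j * (7 + 2 * l)" by (simp add: algebra_simps)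
    also have "\<dots> \<le> (2 * l) ^ j * (10 * l)" using l by (intro mult_left_mono) auto
    finally show ?thesis by (simp add: algebra_simps)
  qed
  have "(\<lambda>N. \<Sum>n<N. f n * lnpow j s (real n)) \<longlonglongrightarrow> dser f j s"
    unfolding dser_def using assms by (intro summable_LIMSEQ summable_dser)
  then have "(\<lambda>N. \<bar>\<Sum>n<N. f n * lnpow j s (real n)\<bar>) \<longlonglongrightarrow> \<bar>dser f j s\<bar>"
    by (rule tendsto_rabs)
  then show ?thesis unfolding l_def[symmetric]
    by (rule LIMSEQ_le_const2) (use part in blast)
qed

section \<open>Products of real characters\<close>

definition rmult :: "(nat \<Rightarrow> real) \<Rightarrow> bool" where
  "rmult f \<longleftrightarrow> f 1 = 1 \<and> (\<forall>m n. f (m * n) = f m * f n) \<and> (\<forall>n. f n \<in> {-1, 0, 1})"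

lemma rmult_abs: "rmult f \<Longrightarrow> \<bar>f n\<bar> \<le> 1"
  unfolding rmult_def by (drule conjunct2, drule conjunct2, drule spec[of _ n]) auto

lemma rmult_one: "rmult (\<lambda>_. 1)"
  by (simp add: rmult_def)

lemma rmult_mult:
  assumes "rmult f" "rmult g"
  shows "rmult (\<lambda>n. f n * g n)"
proof -
  have "f n * g n \<in> {-1, 0, 1}" for n
  proof -
    have "f n \<in> {-1, 0, 1}" "g n \<in> {-1, 0, 1}" using assms unfolding rmult_def by blast+
    then show ?thesis by auto
  qed
  then show ?thesis using assms by (simp add: rmult_def mult_ac)
qed

text \<open>Multiplication by \<open>a\<close> permutes the residues and changes the sign of the sum
  over a period.\<close>

lemma zero_meanI:
  assumes f: "rmult f" and "D > 0" and per: "\<And>n. f (n + D) = f n"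
    and a: "coprime a D" "f a = -1"
  shows "zero_mean D f"
proof -
  have fmod: "f (n mod D) = f n" for n
  proof -
    have "f (r + k * D) = f r" for r k
      by (induction k) (use per[of "r + _ * D"] in \<open>auto simp: algebra_simps\<close>)
    from this[of "n mod D" "n div D"] show ?thesis by simp
  qed
  have "bij_betw (\<lambda>n. (a * n) mod D) {..<D} {..<D}"
  proof -
    have inj: "inj_on (\<lambda>n. (a * n) mod D) {..<D}"
    proof (rule inj_onI)
      fix x y assume xy: "x \<in> {..<D}" "y \<in> {..<D}" "(a * x) mod D = (a * y) mod D"
      then have "[a * x = a * y] (mod D)" by (simp add: cong_def)
      then have "[x = y] (mod D)" using a(1) cong_mult_lcancel_nat by blast
      then show "x = y" using xy by (simp add: cong_def)
    qed
    have "(\<lambda>n. (a * n) mod D) ` {..<D} \<subseteq> {..<D}" using \<open>D > 0\<close> by auto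
    with inj show ?thesis
      by (simp add: bij_betw_def card_image card_subset_eq)
  qed
  then have "(\<Sum>n<D. f n) = (\<Sum>n<D. f ((a * n) mod D))"
    by (rule sum.reindex_bij_betw[symmetric])
  also have "\<dots> = (\<Sum>n<D. - f n)"
    using f a by (simp add: fmod rmult_def)
  finally have "(\<Sum>n<D. f n) = 0" by (simp add: sum_negf)
  then show ?thesis using assms by (simp add: zero_mean_def)
qed

section \<open>Legendre symbols, the characters modulo 4 and 8, and their products\<close>

lemma Legendre_cases: "Legendre a p \<in> {-1, 0, 1}"
  by (auto simp: Legendre_def)

lemma Legendre_cong: "[a = b] (mod p) \<Longrightarrow> Legendre a p = Legendre b p"
proof -
  assume c: "[a = b] (mod p)"
  then have "[y = a] (mod p) \<longleftrightarrow> [y = b] (mod p)" "[a = y] (mod p) \<longleftrightarrow> [b = y] (mod p)" for y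
    by (auto simp: cong_def)
  then show ?thesis by (simp add: Legendre_def QuadRes_def)
qed

text \<open>By Euler's criterion both sides agree modulo \<open>p\<close>, and numbers of absolute
  value at most \<open>1\<close> that agree modulo \<open>p > 2\<close> are equal.\<close>

lemma Legendre_mult:
  assumes "prime p" "2 < p"
  shows "Legendre (a * b) (int p) = Legendre a (int p) * Legendre b (int p)"
proof -
  have "[Legendre (a * b) p = (a * b) ^ ((p - 1) div 2)] (mod p)"
    using assms by (rule euler_criterion)
  also have "(a * b) ^ ((p - 1) div 2) = a ^ ((p - 1) div 2) * b ^ ((p - 1) div 2)"
    by (rule power_mult_distrib)
  also have "[a ^ ((p - 1) div 2) * b ^ ((p - 1) div 2) = Legendre a p * Legendre b p] (mod p)"
    by (intro cong_mult cong_sym[OF euler_criterion[OF assms]])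
  finally have c: "[Legendre (a * b) p = Legendre a p * Legendre b p] (mod p)" .
  have "Legendre a p * Legendre b p \<in> {-1,0,1}"
    using Legendre_cases[of a p] Legendre_cases[of b p] by auto
  then have "\<bar>Legendre (a * b) p - Legendre a p * Legendre b p\<bar> < p"
    using Legendre_cases[of "a * b" p] assms by auto
  moreover have "int p dvd Legendre (a * b) p - Legendre a p * Legendre b p"
    using c by (simp add: cong_iff_dvd_diff)
  ultimately have "Legendre (a * b) p - Legendre a p * Legendre b p = 0"
    using dvd_imp_le_int[of "Legendre (a * b) p - Legendre a p * Legendre b p" "int p"] by linarith
  then show ?thesis by simp
qed

lemma Legendre_1: "p > 1 \<Longrightarrow> Legendre 1 (int p) = 1"
proof -
  assume "p > 1"
  then have "\<not> [1 = 0] (mod int p)" by (simp add: cong_def)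
  moreover have "QuadRes (int p) 1" unfolding QuadRes_def by (rule exI[of _ 1]) simp
  ultimately show ?thesis by (simp add: Legendre_def)
qed

definition chi4 :: "nat \<Rightarrow> real" where
  "chi4 n = (if n mod 4 = 1 then 1 else if n mod 4 = 3 then -1 else 0)"

definition chi8 :: "nat \<Rightarrow> real" where
  "chi8 n = (if n mod 8 \<in> {1, 7} then 1 else if n mod 8 \<in> {3, 5} then -1 else 0)"

lemma less_8_cases: "(r::nat) < 8 \<Longrightarrow> r \<in> {0,1,2,3,4,5,6,7}" by auto

lemma rmult_chi4: "rmult chi4"
proof -
  have "chi4 (m * n) = chi4 m * chi4 n" for m n
  proof -
    have "m mod 4 \<in> {0,1,2,3}" "n mod 4 \<in> {0,1,2,3}" by auto
    then show ?thesis unfolding chi4_def mod_mult_eq[of m 4 n, symmetric] by auto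
  qed
  then show ?thesis by (auto simp: rmult_def chi4_def)
qed

lemma rmult_chi8: "rmult chi8"
proof -
  define c :: "nat \<Rightarrow> real" where "c = (\<lambda>r. if r \<in> {1, 7} then 1 else if r \<in> {3, 5} then -1 else 0)"
  have c: "\<forall>r\<in>{0,1,2,3,4,5,6,7}. \<forall>s\<in>{0,1,2,3,4,5,6,7}. c (r * s mod 8) = c r * c s"
    by (simp add: c_def)
  have "chi8 (m * n) = chi8 m * chi8 n" for m n
  proof -
    have "c ((m mod 8) * (n mod 8) mod 8) = c (m mod 8) * c (n mod 8)"
      by (rule c[rule_format]; rule less_8_cases; simp)
    then show ?thesis by (simp add: chi8_def c_def mod_mult_eq)
  qed
  then show ?thesis by (auto simp: rmult_def chi8_def)
qed

text \<open>The index \<open>1\<close> stands for the character modulo \<open>4\<close>; a prime index \<open>p\<close> stands for the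
  character that sends a prime \<open>q \<equiv> 1 (mod 8)\<close> to the Legendre symbol of \<open>p\<close> modulo \<open>q\<close>.\<close>

definition qchar :: "nat \<Rightarrow> nat \<Rightarrow> real" where
  "qchar p n = (if p = 1 then chi4 n else if p = 2 then chi8 n else real_of_int (Legendre (int n) (int p)))"

definition qindex :: "nat \<Rightarrow> bool" where "qindex p \<longleftrightarrow> p = 1 \<or> prime p"

definition qprod :: "nat set \<Rightarrow> nat \<Rightarrow> real" where "qprod S n = (\<Prod>p\<in>S. qchar p n)"

text \<open>A period of \<open>qprod S\<close>, not its conductor: the factor \<open>8\<close> is
  always present and takes care of the indices \<open>1\<close> and \<open>2\<close>.\<close>

definition qmod :: "nat set \<Rightarrow> nat" where "qmod S = 8 * \<Prod>S"

lemma qindex_odd: "qindex p \<Longrightarrow> p \<noteq> 1 \<Longrightarrow> p \<noteq> 2 \<Longrightarrow> prime p \<and> 2 < p"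
  using prime_ge_2_nat[of p] by (auto simp: qindex_def)

lemma rmult_qchar:
  assumes "qindex p" shows "rmult (qchar p)"
proof (cases "p = 1 \<or> p = 2")
  case True
  then show ?thesis using rmult_chi4 rmult_chi8 by (auto simp: qchar_def[abs_def])
next
  case False
  then have p: "prime p" "2 < p" using qindex_odd assms by auto
  have eq: "qchar p = (\<lambda>n. real_of_int (Legendre (int n) (int p)))" using False by (simp add: qchar_def[abs_def])
  have "real_of_int (Legendre (int n) p) \<in> {-1,0,1}" for n using Legendre_cases[of n p] by auto
  then show ?thesis unfolding eq rmult_def using p
    by (simp add: Legendre_mult Legendre_1)
qed

lemma rmult_prod:
  assumes "finite S" "\<And>p. p \<in> S \<Longrightarrow> rmult (f p)"
  shows "rmult (\<lambda>n. \<Prod>p\<in>S. f p n)"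
  using assms by (induction S) (auto simp: rmult_one intro: rmult_mult)

lemma rmult_qprod:
  assumes "finite S" "\<forall>p\<in>S. qindex p" shows "rmult (qprod S)"
  unfolding qprod_def[abs_def] using assms rmult_qchar by (intro rmult_prod) auto

lemma qchar_cong8:
  assumes "p \<in> {1, 2}" and c: "[m = n] (mod 8)"
  shows "qchar p m = qchar p n"
proof -
  have 8: "m mod 8 = n mod 8" using c by (simp add: cong_def)
  have "m mod 8 mod 4 = m mod 4" "n mod 8 mod 4 = n mod 4" by (simp_all add: mod_mod_cancel)
  then have "m mod 4 = n mod 4" using 8 by metis
  then have "chi4 m = chi4 n" "chi8 m = chi8 n" using 8 by (simp_all only: chi4_def chi8_def)
  then show ?thesis using assms(1) by (auto simp: qchar_def)
qed

lemma qchar_cong: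
  assumes "p \<noteq> 1" "p \<noteq> 2" "[m = n] (mod p)"
  shows "qchar p m = qchar p n"
proof -
  have "Legendre (int m) (int p) = Legendre (int n) (int p)"
    using assms(3) by (intro Legendre_cong) (simp only: cong_int_iff)
  then show ?thesis using assms(1,2) by (simp only: qchar_def if_False)
qed

lemma qprod_period:
  assumes "finite S" "qmod S dvd D"
  shows "qprod S (n + D) = qprod S n"
  unfolding qprod_def
proof (rule prod.cong[OF refl])
  fix p assume "p \<in> S"
  then have "p dvd \<Prod>S" using assms by (intro dvd_prodI[of S p id, simplified])
  then have "p dvd D" "8 dvd D" using assms unfolding qmod_def by (auto intro: dvd_trans dvd_mult dvd_mult_left)
  then have "[n + D = n] (mod p)" "[n + D = n] (mod 8)"
    using mod_add_right_eq[of n D p] mod_add_right_eq[of n D 8] by (simp_all add: cong_def)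
  then show "qchar p (n + D) = qchar p n"
    using qchar_cong8[of p "n + D" n] qchar_cong[of p "n + D" n] by auto
qed

text \<open>A primitive root serves: its power with exponent \<open>(p - 1) div 2\<close> is not
  \<open>1\<close>, so Euler's criterion excludes a residue.\<close>

lemma nonresidue_exists:
  assumes "prime p" "2 < p"
  obtains a where "coprime a p" "Legendre (int a) (int p) = -1"
proof -
  obtain g where g: "residue_primroot p g" using prime_primitive_root_exists[of p] assms
    prime_gt_1_nat by auto
  have cop: "coprime p g" using g by (simp add: residue_primroot_def)
  have o: "ord p g = p - 1" using g assms by (simp add: residue_primroot_def totient_prime)
  have "\<not> [g ^ ((p - 1) div 2) = 1] (mod p)"
  proof
    assume "[g ^ ((p - 1) div 2) = 1] (mod p)"
    then have "(p - 1) dvd (p - 1) div 2" using o ord_divides[of g "(p - 1) div 2" p] by simp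
    then have "p - 1 \<le> (p - 1) div 2" using assms by (intro dvd_imp_le) auto
    then show False using assms by auto
  qed
  then have ng: "\<not> [int g ^ ((p - 1) div 2) = 1] (mod int p)"
    using cong_int_iff[of "g ^ ((p - 1) div 2)" 1 p] by simp
  have "[Legendre g p = int g ^ ((p - 1) div 2)] (mod p)"
    using euler_criterion assms by blast
  then have "Legendre g p \<noteq> 1" using ng by (auto dest: cong_sym)
  moreover have "Legendre g p \<noteq> 0"
  proof -
    have "\<not> p dvd g" using cop assms by (auto simp: coprime_absorb_left)
    then have "\<not> [int g = 0] (mod int p)" by (simp add: cong_0_iff)
    then show ?thesis by (simp add: Legendre_def)
  qed
  ultimately have "Legendre g p = -1" using Legendre_cases[of g p] by auto
  then show ?thesis using that[of g] cop by (simp add: coprime_commute)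
qed

text \<open>\<open>a\<close> has an inverse \<open>b\<close> modulo \<open>D\<close>, and
  periodicity gives \<open>f a * f b = f 1 = 1\<close>.\<close>

lemma rmult_coprime_nonzero:
  assumes f: "rmult f" and "D > 0" and per: "\<And>n. f (n + D) = f n" and "coprime a D"
  shows "f a \<noteq> 0"
proof
  assume "f a = 0"
  obtain b where b: "[a * b = 1] (mod D)" using \<open>coprime a D\<close> cong_solve_coprime_nat by auto
  have per': "f (r + k * D) = f r" for r k
    by (induction k) (use per[of "r + _ * D"] in \<open>auto simp: algebra_simps\<close>)
  have m: "f (n mod D) = f n" for n
    using per'[of "n mod D" "n div D"] by simp
  have "f (a * b) = f 1" using b m[of "a * b"] m[of 1] by (simp add: cong_def)
  then show False using f \<open>f a = 0\<close> by (simp add: rmult_def)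
qed

lemma qchar_1: "p > 0 \<Longrightarrow> p \<noteq> 1 \<Longrightarrow> p \<noteq> 2 \<Longrightarrow> [a = 1] (mod p) \<Longrightarrow> qchar p a = 1"
  using qchar_cong[of p a 1] Legendre_1[of p] by (simp add: qchar_def)

lemma qchar_1_8: "p \<in> {1,2} \<Longrightarrow> [a = 1] (mod 8) \<Longrightarrow> qchar p a = 1"
  using qchar_cong8[of p a 1] by (auto simp: qchar_def chi4_def chi8_def)

lemma prod_dvd_prod_nat:
  fixes T :: "nat set"
  assumes "finite T" "p \<in> T" shows "p dvd \<Prod>T"
  using dvd_prodI[of T p "\<lambda>x. x"] assms by simp

text \<open>Independence of the characters, from the Chinese remainder theorem: one factor is made
  \<open>-1\<close> and the others \<open>1\<close>. Coprimality to the modulus of the larger set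
  \<open>T\<close> is wanted because a product of two characters lives on the symmetric difference
  of their index sets, inside the union.\<close>

lemma qprod_minus_one:
  assumes T: "finite T" "\<forall>p\<in>T. qindex p" and S: "S \<subseteq> T" "S \<noteq> {}"
  shows "\<exists>a. coprime a (qmod T) \<and> qprod S a = -1"
proof -
  have Tpos: "p > 0" if "p \<in> T" for p using T that by (auto simp: qindex_def prime_gt_0_nat)
  have finS: "finite S" using T S finite_subset by blast
  show ?thesis
  proof (cases "S \<subseteq> {1, 2}")
    case False
    then obtain p where p: "p \<in> S" "p \<noteq> 1" "p \<noteq> 2" by auto
    then have pr: "prime p" "2 < p" using qindex_odd[of p] T S by auto
    obtain g where g: "coprime g p" "Legendre (int g) (int p) = -1"
      using nonresidue_exists[OF pr] by blast
    define M where "M = 8 * \<Prod>(T - {p})"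
    have "coprime p (\<Prod>(T - {p}))"
    proof (rule prod_coprime_right)
      fix r assume r: "r \<in> T - {p}"
      then have "r = 1 \<or> prime r" using T by (auto simp: qindex_def)
      then show "coprime p r" using pr r primes_coprime[of p r] by auto
    qed
    moreover have "coprime p 8"
    proof -
      have "coprime p 2" using pr primes_coprime[of p 2] two_is_prime_nat by auto
      then have "coprime p (2 ^ 3)" unfolding coprime_power_right_iff by simp
      then show ?thesis by simp
    qed
    ultimately have cop: "coprime p M" by (simp add: M_def)
    obtain a where a: "[a = g] (mod p)" "[a = 1] (mod M)"
      using binary_chinese_remainder_nat[OF cop] by blast
    have "coprime a p" using a(1) g(1) cong_imp_coprime cong_sym by blast
    moreover have "coprime a M" using a(2) cong_imp_coprime[of 1 a M] cong_sym by auto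
    ultimately have "coprime a (p * M)" by simp
    moreover have "p * M = qmod T" using p S T
      by (simp add: M_def qmod_def prod.remove[of T p] subset_iff)
    ultimately have c: "coprime a (qmod T)" by simp
    have 1: "qchar r a = 1" if "r \<in> S - {p}" for r
    proof (cases "r \<in> {1,2}")
      case True
      have "[a = 1] (mod 8)" using a(2) by (rule cong_dvd_modulus_nat) (simp add: M_def)
      then show ?thesis using True qchar_1_8 by blast
    next
      case False
      have "r dvd M" unfolding M_def using T S that by (intro dvd_mult prod_dvd_prod_nat) auto
      then have "[a = 1] (mod r)" using a(2) cong_dvd_modulus_nat by blast
      then show ?thesis using False Tpos[of r] S that qchar_1[of r a] by auto
    qed
    have "qprod S a = qchar p a * (\<Prod>r\<in>S-{p}. qchar r a)"
      unfolding qprod_def using p finS by (intro prod.remove) auto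
    also have "\<dots> = qchar p g" using 1 qchar_cong[OF p(2,3) a(1)] by simp
    also have "\<dots> = -1" using p g by (simp add: qchar_def)
    finally show ?thesis using c by blast
  next
    case True
    define M where "M = \<Prod>(T - {1,2})"
    \<comment> \<open>At \<open>5\<close> the character modulo \<open>4\<close> is \<open>1\<close>
      and the one modulo \<open>8\<close> is \<open>-1\<close>; at \<open>3\<close> the character
      modulo \<open>4\<close> is \<open>-1\<close>. The choice thus gives the product
      \<open>-1\<close> for each of \<open>{1}\<close>, \<open>{2}\<close> and
      \<open>{1, 2}\<close>.\<close>
    define u :: nat where "u = (if 2 \<in> S then 5 else 3)"
    have u: "qprod S u = -1"
    proof -
      have "S = {1} \<or> S = {2} \<or> S = {1, 2}" using True S by auto
      then show ?thesis unfolding u_def qprod_def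
        by (elim disjE) (simp_all add: qchar_def chi4_def chi8_def)
    qed
    have "coprime 2 M" unfolding M_def
    proof (rule prod_coprime_right)
      fix r assume r: "r \<in> T - {1,2}"
      then have "prime r" using T by (auto simp: qindex_def)
      then show "coprime 2 r" using r primes_coprime[of 2 r] two_is_prime_nat by auto
    qed
    then have "coprime (2 ^ 3) M" unfolding coprime_power_left_iff by simp
    then have cop: "coprime 8 M" by simp
    obtain a where a: "[a = u] (mod 8)" "[a = 1] (mod M)"
      using binary_chinese_remainder_nat[OF cop] by blast
    have "coprime u 8"
    proof -
      have "odd u" by (simp add: u_def)
      then have "coprime u (2 ^ 3)" unfolding coprime_power_right_iff by simp
      then show ?thesis by simp
    qed
    then have a8: "coprime a 8" using a(1) cong_imp_coprime cong_sym by blast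
    have "coprime a M" using a(2) cong_imp_coprime[of 1 a M] cong_sym by auto
    moreover have "coprime a (\<Prod>(T \<inter> {1,2}))"
    proof (rule prod_coprime_right)
      fix r assume "r \<in> T \<inter> {1,2}"
      then have "r dvd 8" by auto
      then show "coprime a r" using a8 coprime_divisors[of a a r 8] by simp
    qed
    moreover have "\<Prod>T = \<Prod>(T \<inter> {1,2}) * M" unfolding M_def
      using T by (subst prod.union_disjoint[symmetric]) (auto intro: arg_cong[where f = "\<lambda>x. \<Prod>x"])
    ultimately have "coprime a (qmod T)" using a8 by (simp add: qmod_def)
    moreover have "qprod S a = qprod S u" unfolding qprod_def
      using True a(1) by (intro prod.cong refl qchar_cong8) auto
    ultimately show ?thesis using u by auto
  qed
qed

lemma qmod_pos: "finite T \<Longrightarrow> \<forall>p\<in>T. qindex p \<Longrightarrow> qmod T > 0"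
  unfolding qmod_def qindex_def by (auto intro!: prod_pos dest: prime_gt_0_nat)

lemma zero_mean_qprod:
  assumes S: "finite S" "\<forall>p\<in>S. qindex p" "S \<noteq> {}"
  shows "zero_mean (qmod S) (qprod S)"
proof -
  obtain a where a: "coprime a (qmod S)" "qprod S a = -1"
    using qprod_minus_one[of S S] S by auto
  show ?thesis
    by (rule zero_meanI[OF rmult_qprod qmod_pos qprod_period a]) (use S in auto)
qed

text \<open>Common factors square to a principal character, so up to coprimality only the symmetric
  difference counts.\<close>

lemma qprod_mult:
  assumes "finite S" "finite T"
  shows "qprod S n * qprod T n = qprod ((S - T) \<union> (T - S)) n * (qprod (S \<inter> T) n)\<^sup>2"
proof -
  have "qprod S n = qprod (S - T) n * qprod (S \<inter> T) n" if "finite S" for S T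
    unfolding qprod_def using that
    by (subst prod.union_disjoint[symmetric]) (auto intro!: arg_cong[where f = "prod _"])
  from this[of S T] this[of T S] assms
  have "qprod S n * qprod T n = qprod (S - T) n * qprod (T - S) n * (qprod (S \<inter> T) n)\<^sup>2"
    by (simp add: Int_commute power2_eq_square)
  also have "qprod (S - T) n * qprod (T - S) n = qprod ((S - T) \<union> (T - S)) n"
    unfolding qprod_def using assms by (intro prod.union_disjoint[symmetric]) auto
  finally show ?thesis .
qed

lemma qprod_coprime_square:
  assumes "finite S" "\<forall>p\<in>S. qindex p" "coprime a (qmod S)"
  shows "(qprod S a)\<^sup>2 = 1"
proof -
  have r: "rmult (qprod S)" using assms by (intro rmult_qprod)
  have "qprod S a \<noteq> 0"
    using assms by (intro rmult_coprime_nonzero[OF r qmod_pos qprod_period]) auto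
  moreover have "qprod S a \<in> {-1,0,1}" using r unfolding rmult_def by blast
  ultimately show ?thesis by auto
qed

lemma qmod_dvd_mono: "finite T \<Longrightarrow> S \<subseteq> T \<Longrightarrow> qmod S dvd qmod T"
  unfolding qmod_def by (intro mult_dvd_mono prod_dvd_prod_subset) auto

lemma qmod_mono:
  assumes "finite T" "\<forall>p\<in>T. qindex p" "S \<subseteq> T"
  shows "qmod S \<le> qmod T"
  using qmod_dvd_mono[of T S] qmod_pos[of T] assms by (intro dvd_imp_le) auto

lemma qmod_union_le:
  assumes "finite S" "finite T" "\<forall>p\<in>S \<union> T. qindex p"
  shows "qmod (S \<union> T) \<le> qmod S * qmod T"
proof -
  have "S \<union> T = S \<union> (T - S)" by auto
  then have "\<Prod>(S \<union> T) = \<Prod>S * \<Prod>(T - S)"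
    using assms by (simp only:) (subst prod.union_disjoint, auto)
  then have "qmod (S \<union> T) = qmod S * \<Prod>(T - S)" by (simp add: qmod_def)
  also have "\<Prod>(T - S) \<le> qmod T"
    using qmod_mono[of T "T - S"] assms by (simp add: qmod_def)
  finally show ?thesis by simp
qed

text \<open>For \<open>S \<noteq> T\<close> the symmetric difference is nonempty, so some
  \<open>a\<close> coprime to the common modulus makes the product \<open>-1\<close>.\<close>

lemma zero_mean_qprod_mult:
  assumes S: "finite S" "\<forall>p\<in>S. qindex p" and T: "finite T" "\<forall>p\<in>T. qindex p" and "S \<noteq> T"
  shows "zero_mean (qmod (S \<union> T)) (\<lambda>n. qprod S n * qprod T n)"
proof -
  define U where "U = (S - T) \<union> (T - S)"
  have U: "U \<subseteq> S \<union> T" "U \<noteq> {}" using \<open>S \<noteq> T\<close> by (auto simp: U_def)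
  have fin: "finite (S \<union> T)" "\<forall>p\<in>S \<union> T. qindex p" using S T by auto
  obtain a where a: "coprime a (qmod (S \<union> T))" "qprod U a = -1"
    using qprod_minus_one[OF fin U] by blast
  have "coprime a (qmod (S \<inter> T))"
    using a(1) by (rule coprime_divisors[rotated 2]) (use qmod_dvd_mono[of "S \<union> T" "S \<inter> T"] fin in auto)
  then have "(qprod (S \<inter> T) a)\<^sup>2 = 1" using S by (intro qprod_coprime_square) auto
  then have m: "qprod S a * qprod T a = -1"
    using qprod_mult[of S T a] S T a(2) by (simp add: U_def)
  show ?thesis
  proof (rule zero_meanI[where a = a])
    show "rmult (\<lambda>n. qprod S n * qprod T n)" using S T by (intro rmult_mult rmult_qprod)
    show "qprod S (n + qmod (S \<union> T)) * qprod T (n + qmod (S \<union> T)) = qprod S n * qprod T n" for n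
      using S T by (simp add: qprod_period qmod_dvd_mono)
  qed (use fin a m qmod_pos in auto)
qed

lemma rmult_prime_factors:
  assumes f: "rmult f" and "k > 0"
  shows "f k = (\<Prod>p\<in>prime_factors k. f p ^ multiplicity p k)"
proof -
  have pow: "f (p ^ n) = f p ^ n" for p n
    using f by (induction n) (auto simp: rmult_def)
  have prod: "finite A \<Longrightarrow> f (\<Prod>p\<in>A. g p) = (\<Prod>p\<in>A. f (g p))" for A :: "nat set" and g
    by (induction A rule: finite_induct) (use f in \<open>auto simp: rmult_def\<close>)
  have "f k = f (\<Prod>p\<in>prime_factors k. p ^ multiplicity p k)"
    using prime_factorization_nat[of k] assms by simp
  then show ?thesis using prod pow by simp
qed

text \<open>A square root of \<open>2\<close> from a primitive eighth root of unity \<open>c\<close>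
  modulo \<open>q\<close>: since \<open>c^4 = -1\<close>, the sum \<open>c + c^(-1)\<close> squares
  to \<open>2\<close>. Below, \<open>c^7\<close> stands for the inverse.\<close>

lemma Legendre_2:
  assumes q: "prime q" "q mod 8 = 1"
  shows "Legendre 2 (int q) = 1"
proof -
  have q2: "2 < q"
  proof -
    have "q \<noteq> 2" "q \<noteq> 1" "q \<noteq> 0" using q by auto
    then show ?thesis by simp
  qed
  obtain g where g: "Legendre (int g) (int q) = -1" using nonresidue_exists[OF q(1) q2] by blast
  define c where "c = int g ^ ((q - 1) div 8)"
  have "(q - 1) div 8 * 4 = (q - 1) div 2" using q(2) by presburger
  then have "c ^ 4 = int g ^ ((q - 1) div 2)" by (simp add: c_def flip: power_mult)
  then have "[-1 = c ^ 4] (mod int q)" using euler_criterion[OF q(1) q2, of "int g"] g by simp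
  moreover have "-1 - c ^ 4 = - (c ^ 4 + 1)" by simp
  ultimately have "int q dvd - (c ^ 4 + 1)" by (simp only: cong_iff_dvd_diff)
  then have "int q dvd c ^ 4 + 1" by (simp only: dvd_minus_iff)
  moreover have "(c + c ^ 7)\<^sup>2 - 2 = (c ^ 4 + 1) * (c ^ 10 - c ^ 6 + 2 * c ^ 4 + c\<^sup>2 - 2)"
    by (simp add: eval_nat_numeral algebra_simps)
  ultimately have "int q dvd (c + c ^ 7)\<^sup>2 - 2" by simp
  then have "QuadRes q 2" unfolding QuadRes_def cong_iff_dvd_diff by blast
  moreover have "\<not> [2 = 0] (mod int q)"
    using q2 by (simp add: cong_def)
  ultimately show ?thesis by (simp add: Legendre_def)
qed

lemma rmult_legendre_char:
  assumes "prime q" "2 < q"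
  shows "rmult (\<lambda>n. legendre_char q (int n))"
proof -
  have "real_of_int (Legendre (int n) q) \<in> {-1,0,1}" for n using Legendre_cases[of n q] by auto
  then show ?thesis unfolding rmult_def legendre_char_def using assms
    by (simp add: Legendre_mult Legendre_1)
qed

text \<open>For \<open>q \<equiv> 1\<close> modulo \<open>8\<close> the sign of reciprocity is
  \<open>1\<close>. The symbol modulo the variable prime \<open>q\<close> becomes a character in
  \<open>q\<close> with a fixed modulus, over which one can average.\<close>

lemma legendre_char_prime:
  assumes q: "prime q" "q mod 8 = 1" and p: "prime p" "p \<noteq> q"
  shows "legendre_char q (int p) = qchar p q"
proof (cases "p = 2")
  case True
  then show ?thesis using Legendre_2[OF q] q by (simp add: legendre_char_def qchar_def chi8_def)
next
  case False
  then have p2: "p > 2" using prime_ge_2_nat[OF p(1)] by simp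
  have q2: "q > 2"
  proof -
    have "q \<noteq> 2" "q \<noteq> 1" "q \<noteq> 0" using q by auto
    then show ?thesis by simp
  qed
  have "even ((q - 1) div 2)" using q(2) by presburger
  then have "(-1::int) ^ ((p - 1) div 2 * ((q - 1) div 2)) = 1" by simp
  then have "Legendre p q * Legendre q p = 1"
    using Quadratic_Reciprocity[of p q] p p2 q q2 by simp
  then have "Legendre p q = Legendre q p"
    using Legendre_cases[of p q] Legendre_cases[of q p] by auto
  moreover have "p \<noteq> 1" using p by auto
  ultimately show ?thesis using False by (simp add: legendre_char_def qchar_def)
qed

text \<open>The primes of the squarefree part of \<open>k\<close>. They index the character in
  \<open>q\<close> that equals \<open>legendre_char q k\<close>.\<close>

definition odd_part :: "nat \<Rightarrow> nat set" where
  "odd_part k = {p \<in> prime_factors k. odd (multiplicity p k)}"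

lemma odd_part: "finite (odd_part k)" "p \<in> odd_part k \<Longrightarrow> prime p" "\<forall>p\<in>odd_part k. qindex p"
  by (auto simp: odd_part_def qindex_def)

lemma odd_part_prod_le:
  assumes "k > 0" shows "\<Prod>(odd_part k) \<le> k"
proof -
  have "(\<Prod>p\<in>odd_part k. p) dvd (\<Prod>p\<in>odd_part k. p ^ multiplicity p k)"
    by (intro prod_dvd_prod dvd_power) (auto simp: odd_part_def intro: Nat.gr0I)
  also have "\<dots> dvd (\<Prod>p\<in>prime_factors k. p ^ multiplicity p k)"
    by (intro prod_dvd_prod_subset) (auto simp: odd_part_def)
  also have "\<dots> = k" using prime_factorization_nat[of k] assms by simp
  finally show ?thesis using assms by (intro dvd_imp_le) auto
qed

text \<open>Even exponents contribute squares of nonzero symbols, that is \<open>1\<close>;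
  \<open>k < q\<close> keeps \<open>q\<close> out of the prime factors.\<close>

lemma legendre_char_eq_qprod:
  assumes q: "prime q" "q mod 8 = 1" and k: "0 < k" "k < q"
  shows "legendre_char q (int k) = qprod (odd_part k) q"
proof -
  have q2: "q > 2"
  proof -
    have "q \<noteq> 2" "q \<noteq> 1" "q \<noteq> 0" using q by auto
    then show ?thesis by simp
  qed
  have ne: "p \<noteq> q" "prime p" if "p \<in> prime_factors k" for p
    using that k dvd_imp_le[of p k] by (auto simp: prime_factors_dvd)
  have "legendre_char q (int k) = (\<Prod>p\<in>prime_factors k. legendre_char q (int p) ^ multiplicity p k)"
    using rmult_prime_factors[OF rmult_legendre_char[OF q(1) q2]] k by simp
  also have "\<dots> = (\<Prod>p\<in>prime_factors k. if odd (multiplicity p k) then qchar p q else 1)"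
  proof (rule prod.cong[OF refl])
    fix p assume p: "p \<in> prime_factors k"
    have "\<not> [int p = 0] (mod int q)" using ne[OF p] q primes_dvd_imp_eq[of q p]
      by (auto simp: cong_0_iff)
    then have "Legendre (int p) (int q) \<in> {-1, 1}" by (auto simp: Legendre_def)
    then have "legendre_char q (int p) = 1 \<or> legendre_char q (int p) = -1" by (auto simp: legendre_char_def)
    then show "legendre_char q (int p) ^ multiplicity p k = (if odd (multiplicity p k) then qchar p q else 1)"
      using legendre_char_prime[OF q ne(2,1)[OF p]] by (auto simp: uminus_power_if)
  qed
  also have "\<dots> = qprod (odd_part k) q" unfolding qprod_def odd_part_def
    by (rule prod.inter_filter[symmetric]) simp
  finally show ?thesis .
qed

section \<open>Logarithmic derivatives\<close>

lemma has_sum_dirichlet_pairs: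
  fixes h :: "nat \<times> nat \<Rightarrow> real"
  assumes "(h has_sum S) ({1..} \<times> {1..})"
  shows "((\<lambda>n. \<Sum>d | d dvd n. h (d, n div d)) has_sum S) {1..}"
proof -
  have "(h has_sum S) ({1..} \<times> {1..}) \<longleftrightarrow>
      ((\<lambda>(n, d). h (d, n div d)) has_sum S) (SIGMA n:{1..}. {d. d dvd n})"
    by (rule has_sum_reindex_bij_witness[where i = "\<lambda>(n, d). (d, n div d)" and j = "\<lambda>(d, e). (d * e, d)"])
       (auto simp: Suc_le_eq elim!: dvdE)
  with assms have "((\<lambda>(n, d). h (d, n div d)) has_sum S) (SIGMA n:{1..}. {d. d dvd n})" by blast
  then show ?thesis
    by (rule has_sum_SigmaD) (auto intro!: has_sum_finiteI finite_divisors_nat)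
qed

lemma dirichlet_product_sums:
  fixes a b :: "nat \<Rightarrow> real"
  assumes a: "summable (\<lambda>n. \<bar>a n\<bar>)" "a 0 = 0" and b: "summable (\<lambda>n. \<bar>b n\<bar>)" "b 0 = 0"
  shows "(\<lambda>n. \<Sum>d | d dvd n. a d * b (n div d)) sums (suminf a * suminf b)"
proof -
  have hs: "(f has_sum suminf f) {1..}" and as: "(\<lambda>n. norm (f n)) summable_on {1..}"
    if "summable (\<lambda>n. \<bar>f n\<bar>)" "f 0 = 0" for f :: "nat \<Rightarrow> real"
  proof -
    have "f sums suminf f" using that(1) by (intro summable_sums) (rule summable_rabs_cancel)
    then have "(f has_sum suminf f) UNIV"
      using that(1) by (intro norm_summable_imp_has_sum) auto
    then show "(f has_sum suminf f) {1..}"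
      by (rule has_sum_cong_neutral[THEN iffD1, rotated -1]) (use that(2) not_less_eq_eq in \<open>force+\<close>)
    have "(\<lambda>n. norm (f n)) summable_on UNIV"
      using that(1) by (intro norm_summable_imp_summable_on) auto
    then show "(\<lambda>n. norm (f n)) summable_on {1..}"
      by (rule summable_on_subset_banach) auto
  qed
  have ab: "(\<lambda>x. norm ((\<lambda>(m, n). a m * b n) x)) summable_on ({1..} \<times> {1..})"
  proof (subst Infinite_Sum.abs_summable_on_Sigma_iff, intro conjI ballI)
    show "(\<lambda>n. norm ((\<lambda>(m, n). a m * b n) (m, n))) summable_on {1..}" for m
      using summable_on_cmult_right[OF as[OF b], of "norm (a m)"] by (simp add: abs_mult)
    have "(\<lambda>m. norm (a m) * infsum (\<lambda>n. norm (b n)) {1..}) summable_on {1..}"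
      using as[OF a] by (intro summable_on_cmult_left) auto
    moreover have "infsum (\<lambda>n. norm (b n)) {1..} \<ge> 0" by (intro infsum_nonneg) auto
    ultimately show "(\<lambda>m. norm (infsum (\<lambda>n. norm ((\<lambda>(m, n). a m * b n) (m, n))) {1..})) summable_on {1..}"
      using as[OF b] by (simp add: abs_mult infsum_cmult_right)
  qed
  have "((\<lambda>(m, n). a m * b n) has_sum (suminf a * suminf b)) ({1..} \<times> {1..})"
  proof (rule has_sum_SigmaI)
    show "((\<lambda>n. case (m, n) of (m, n) \<Rightarrow> a m * b n) has_sum a m * suminf b) {1..}" for m
      using has_sum_cmult_right[OF hs[OF b]] by simp
    show "((\<lambda>m. a m * suminf b) has_sum suminf a * suminf b) {1..}"
      by (rule has_sum_cmult_left[OF hs[OF a]])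
    show "(\<lambda>(m, n). a m * b n) summable_on {1..} \<times> {1..}"
      using ab by (rule abs_summable_summable)
  qed
  then have "((\<lambda>n. \<Sum>d | d dvd n. a d * b (n div d)) has_sum (suminf a * suminf b)) {1..}"
    by (rule has_sum_dirichlet_pairs[where h = "\<lambda>(m, n). a m * b n", simplified prod.case])
  \<comment> \<open>At \<open>n = 0\<close> every number is a divisor, and the sum over this
    infinite set is \<open>0\<close> by convention.\<close>
  then have "((\<lambda>n. \<Sum>d | d dvd n. a d * b (n div d)) has_sum (suminf a * suminf b)) UNIV"
    by (rule has_sum_cong_neutral[THEN iffD1, rotated -1]) (use not_less_eq_eq in \<open>force+\<close>)
  then show ?thesis by (rule has_sum_imp_sums)
qed

definition mser :: "(nat \<Rightarrow> real) \<Rightarrow> nat \<Rightarrow> real \<Rightarrow> real" where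
  "mser f j s = (\<Sum>n. mangoldt n * f n * lnpow j s (real n))"

lemma lnpow_Suc: "real (Suc j) * lnpow (Suc j) s x = ln x * lnpow j s x"
proof -
  have "real (Suc j) * (ln x ^ Suc j / fact (Suc j)) = ln x * (ln x ^ j / fact j)"
    by (simp add: divide_simps)
  then show ?thesis by (simp only: lnpow_def mult.assoc[symmetric])
qed

lemma mangoldt_lnpow_le: "mangoldt n * lnpow j s (real n) \<le> real (Suc j) * lnpow (Suc j) s (real n)"
proof (cases "n = 0")
  case False
  then have "mangoldt n * lnpow j s (real n) \<le> ln (real n) * lnpow j s (real n)"
    by (intro mult_right_mono mangoldt_le) auto
  then show ?thesis by (simp only: lnpow_Suc)
qed simp

lemma summable_mser_abs:
  assumes "s > 1" and bd: "\<And>n. \<bar>f n\<bar> \<le> 1"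
  shows "summable (\<lambda>n. \<bar>mangoldt n * f n * lnpow j s (real n)\<bar>)"
proof (rule summable_comparison_test'[OF summable_mult[OF summable_lnpow[OF assms(1), of "Suc j"], of "real (Suc j)"], where N = 0])
  fix n
  have "\<bar>f n\<bar> * (mangoldt n * lnpow j s (real n)) \<le> 1 * (mangoldt n * lnpow j s (real n))"
    by (intro mult_right_mono bd mult_nonneg_nonneg mangoldt_nonneg lnpow_nonneg_nat)
  also have "\<dots> \<le> real (Suc j) * lnpow (Suc j) s (real n)"
    using mangoldt_lnpow_le by simp
  finally show "norm \<bar>mangoldt n * f n * lnpow j s (real n)\<bar> \<le> real (Suc j) * lnpow (Suc j) s (real n)"
    by (simp add: abs_mult mult_ac)
qed

lemma summable_mser:
  assumes "s > 1" and bd: "\<And>n. \<bar>f n\<bar> \<le> 1"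
  shows "summable (\<lambda>n. mangoldt n * f n * lnpow j s (real n))"
  using summable_mser_abs[OF assms] by (rule summable_rabs_cancel)

text \<open>The binomial theorem for \<open>ln x + ln y\<close>.\<close>

lemma lnpow_binomial:
  assumes "x > 0" "y > 0"
  shows "(\<Sum>i\<le>m. lnpow i s x * lnpow (m - i) s y) = lnpow m s (x * y)"
proof -
  have "ln (x * y) ^ m / fact m = (\<Sum>i\<le>m. (ln x ^ i / fact i) * (ln y ^ (m - i) / fact (m - i)))"
  proof -
    have "ln (x * y) ^ m = (\<Sum>i\<le>m. of_nat (m choose i) * ln x ^ i * ln y ^ (m - i))"
      using assms by (simp add: ln_mult binomial_ring)
    then have "ln (x * y) ^ m / fact m = (\<Sum>i\<le>m. of_nat (m choose i) * ln x ^ i * ln y ^ (m - i) / fact m)"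
      by (simp only: sum_divide_distrib)
    also have "\<dots> = (\<Sum>i\<le>m. (ln x ^ i / fact i) * (ln y ^ (m - i) / fact (m - i)))"
      by (intro sum.cong refl) (simp add: binomial_fact field_simps)
    finally show ?thesis .
  qed
  then have "lnpow m s (x * y) = (\<Sum>i\<le>m. (ln x ^ i / fact i) * (ln y ^ (m - i) / fact (m - i)) * (x powr (-s) * y powr (-s)))"
    using assms by (simp only: lnpow_def powr_mult sum_distrib_right) 
  also have "\<dots> = (\<Sum>i\<le>m. lnpow i s x * lnpow (m - i) s y)"
    unfolding lnpow_def by (intro sum.cong refl) (simp only: mult_ac)
  finally show ?thesis ..
qed

text \<open>Comparison of Taylor coefficients in \<open>- L' = (- L' / L) * L\<close>. On the side
  of the coefficients it is \<open>ln n = (\<Sum>d | d dvd n. mangoldt d)\<close>, twisted by the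
  completely multiplicative \<open>f\<close>.\<close>

lemma dser_mser_recursion:
  assumes f: "rmult f" and s: "s > 1"
  shows "real (Suc m) * dser f (Suc m) s = (\<Sum>i\<le>m. mser f i s * dser f (m - i) s)"
proof -
  have bd: "\<bar>f n\<bar> \<le> 1" for n using f by (rule rmult_abs)
  define a where "a = (\<lambda>i n. mangoldt n * f n * lnpow i s (real n))"
  define b where "b = (\<lambda>i n. f n * lnpow i s (real n))"
  have "(\<lambda>n. \<Sum>d | d dvd n. a i d * b (m - i) (n div d)) sums (mser f i s * dser f (m - i) s)" for i
    unfolding mser_def dser_def a_def b_def
    by (rule dirichlet_product_sums) (use bd s summable_mser_abs summable_dser_abs in auto)
  then have "(\<lambda>n. \<Sum>i\<le>m. \<Sum>d | d dvd n. a i d * b (m - i) (n div d)) sums (\<Sum>i\<le>m. mser f i s * dser f (m - i) s)"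
    by (intro sums_sum)
  moreover have "(\<Sum>i\<le>m. \<Sum>d | d dvd n. a i d * b (m - i) (n div d)) = real (Suc m) * (f n * lnpow (Suc m) s (real n))" for n
  proof (cases "n = 0")
    case False
    have "(\<Sum>i\<le>m. \<Sum>d | d dvd n. a i d * b (m - i) (n div d)) = (\<Sum>d | d dvd n. \<Sum>i\<le>m. a i d * b (m - i) (n div d))"
      by (rule sum.swap)
    also have "\<dots> = (\<Sum>d | d dvd n. mangoldt d * (f n * lnpow m s (real n)))"
    proof (intro sum.cong refl)
      fix d assume "d \<in> {d. d dvd n}"
      then obtain e where e: "n = d * e" by auto
      then have pos: "d > 0" "e > 0" using False by auto
      have "(\<Sum>i\<le>m. a i d * b (m - i) (n div d)) = (\<Sum>i\<le>m. mangoldt d * (f d * f e) * (lnpow i s (real d) * lnpow (m - i) s (real e)))"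
        using pos by (simp add: a_def b_def e mult_ac)
      also have "\<dots> = mangoldt d * (f d * f e) * lnpow m s (real d * real e)"
        using pos by (simp only: sum_distrib_left[symmetric] lnpow_binomial of_nat_0_less_iff)
      also have "f d * f e = f n" using f by (simp add: rmult_def e)
      finally show "(\<Sum>i\<le>m. a i d * b (m - i) (n div d)) = mangoldt d * (f n * lnpow m s (real n))"
        by (simp add: e)
    qed
    also have "\<dots> = ln (real n) * (f n * lnpow m s (real n))"
      using mangoldt_sum[of n, where ?'a = real] False by (simp flip: sum_distrib_right)
    also have "\<dots> = f n * (real (Suc m) * lnpow (Suc m) s (real n))" by (simp only: lnpow_Suc mult_ac)
    finally show ?thesis by (simp only: mult_ac)
  qed (simp add: a_def)
  ultimately have "(\<lambda>n. real (Suc m) * (f n * lnpow (Suc m) s (real n))) sums (\<Sum>i\<le>m. mser f i s * dser f (m - i) s)"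
    by simp
  moreover have "(\<lambda>n. real (Suc m) * (f n * lnpow (Suc m) s (real n))) sums (real (Suc m) * dser f (Suc m) s)"
    unfolding dser_def by (intro sums_mult summable_sums summable_dser s bd)
  ultimately show ?thesis by (rule sums_unique2[symmetric])
qed

text \<open>If \<open>a\<close> are the Taylor coefficients of \<open>F\<close> and \<open>b\<close> those of \<open>F' / F\<close>, then dominance of
  \<open>a 0\<close> in a disc of radius \<open>4 r\<close> bounds \<open>F' / F\<close> in a disc of radius \<open>r\<close>.\<close>

lemma log_deriv_coeff_bound:
  fixes a b :: "nat \<Rightarrow> real"
  assumes a0: "a 0 > 0" and r: "r > 0"
    and a: "\<And>j. j \<ge> 1 \<Longrightarrow> \<bar>a j\<bar> \<le> a 0 * (1 / (4 * r)) ^ j"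
    and rec: "\<And>m. real (Suc m) * a (Suc m) = (\<Sum>i\<le>m. b i * a (m - i))"
  shows "\<bar>b m\<bar> \<le> (1 / r) ^ Suc m"
proof (induction m rule: less_induct)
  case (less m)
  define R where "R = 1 / r"
  have R: "R > 0" "1 / (4 * r) = R / 4" using r by (auto simp: R_def)
  \<comment> \<open>The induction closes because the lower terms and the leading term contribute at
    most \<open>1/3\<close> and \<open>1/2\<close> of \<open>a 0 * R ^ Suc m\<close>.\<close>
  have geo: "(\<Sum>i<n. (1/4::real) ^ (n - i)) \<le> 1/3" for n
  proof (induction n)
    case (Suc n)
    have "(\<Sum>i<Suc n. (1/4::real) ^ (Suc n - i)) = (\<Sum>i<n. (1/4) * (1/4) ^ (n - i)) + 1/4"
      by (simp add: Suc_diff_le)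
    also have "\<dots> = 1/4 * (\<Sum>i<n. (1/4) ^ (n - i)) + 1/4" by (simp only: sum_distrib_left)
    finally show ?case using Suc by simp
  qed simp
  have small: "real (Suc m) * (1/4) ^ Suc m \<le> 1/2"
  proof -
    have "real (Suc m) \<le> 2 ^ Suc m" using of_nat_less_two_power[of "Suc m", where ?'a = real] by (rule less_imp_le)
    then have "real (Suc m) * (1/4) ^ Suc m \<le> 2 ^ Suc m * (1/4) ^ Suc m" by (intro mult_right_mono) auto
    also have "\<dots> = (1/2) ^ Suc m" by (simp only: power_mult_distrib[symmetric]) simp
    also have "\<dots> \<le> (1/2) ^ 1" by (intro power_decreasing) auto
    finally show ?thesis by simp
  qed
  have "(\<Sum>i\<le>m. b i * a (m - i)) = (\<Sum>i<m. b i * a (m - i)) + b m * a 0"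
    by (simp add: lessThan_Suc_atMost[symmetric])
  then have "b m * a 0 = real (Suc m) * a (Suc m) - (\<Sum>i<m. b i * a (m - i))"
    using rec[of m] by simp
  moreover have "\<bar>real (Suc m) * a (Suc m)\<bar> \<le> real (Suc m) * (a 0 * (R / 4) ^ Suc m)"
    using a[of "Suc m"] unfolding R(2) abs_mult by (intro mult_mono) auto
  moreover have "\<bar>\<Sum>i<m. b i * a (m - i)\<bar> \<le> (\<Sum>i<m. R ^ Suc i * (a 0 * (R / 4) ^ (m - i)))"
  proof (rule order_trans[OF sum_abs], rule sum_mono)
    fix i assume "i \<in> {..<m}"
    then have "\<bar>b i\<bar> \<le> R ^ Suc i" "\<bar>a (m - i)\<bar> \<le> a 0 * (R / 4) ^ (m - i)"
      using less[of i] a[of "m - i"] unfolding R(2) R_def[symmetric] by auto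
    then show "\<bar>b i * a (m - i)\<bar> \<le> R ^ Suc i * (a 0 * (R / 4) ^ (m - i))"
      unfolding abs_mult by (intro mult_mono) (use R in auto)
  qed
  ultimately have "\<bar>b m * a 0\<bar> \<le> real (Suc m) * (a 0 * (R / 4) ^ Suc m) + (\<Sum>i<m. R ^ Suc i * (a 0 * (R / 4) ^ (m - i)))"
    by linarith
  also have "real (Suc m) * (a 0 * (R / 4) ^ Suc m) = a 0 * R ^ Suc m * (real (Suc m) * (1/4) ^ Suc m)"
    by (simp add: power_divide field_simps)
  also have "(\<Sum>i<m. R ^ Suc i * (a 0 * (R / 4) ^ (m - i))) = (\<Sum>i<m. a 0 * R ^ Suc m * (1/4) ^ (m - i))"
  proof (intro sum.cong refl)
    fix i assume "i \<in> {..<m}"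
    then have "R ^ Suc m = R ^ Suc i * R ^ (m - i)" by (simp flip: power_add)
    then show "R ^ Suc i * (a 0 * (R / 4) ^ (m - i)) = a 0 * R ^ Suc m * (1/4) ^ (m - i)"
      by (simp add: power_divide mult_ac del: power_Suc)
  qed
  also have "\<dots> = a 0 * R ^ Suc m * (\<Sum>i<m. (1/4) ^ (m - i))" by (simp only: sum_distrib_left)
  also have "a 0 * R ^ Suc m * (real (Suc m) * (1/4) ^ Suc m) + a 0 * R ^ Suc m * (\<Sum>i<m. (1/4) ^ (m - i))
    \<le> a 0 * R ^ Suc m * (1/2) + a 0 * R ^ Suc m * (1/3)"
    using a0 R by (intro add_mono mult_left_mono small geo) auto
  also have "\<dots> \<le> a 0 * R ^ Suc m" 
  proof -
    have "a 0 * R ^ Suc m \<ge> 0" using a0 R by simp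
    then show ?thesis by linarith
  qed
  finally have "\<bar>b m\<bar> * a 0 \<le> R ^ Suc m * a 0" using a0 by (simp add: abs_mult mult_ac)
  then show ?case using a0 unfolding R_def by (simp only: mult_le_cancel_right_pos)
qed

text \<open>An antiderivative of \<open>lnpow j (1 + e)\<close>, from repeated integration by parts.
  It vanishes at infinity, so minus its value at \<open>1\<close> is the integral over
  \<open>[1, \<infinity>)\<close>.\<close>

primrec lnpow_prim :: "nat \<Rightarrow> real \<Rightarrow> real \<Rightarrow> real" where
  "lnpow_prim 0 e x = - (1/e) * lnpow 0 e x"
| "lnpow_prim (Suc j) e x = (1/e) * lnpow_prim j e x - (1/e) * lnpow (Suc j) e x"

lemma lnpow_prim_deriv:
  assumes "x > 0" "e > 0"
  shows "(lnpow_prim j e has_real_derivative lnpow j (1 + e) x) (at x)"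
proof (induction j)
  case 0
  have "((\<lambda>x. - (1/e) * lnpow 0 e x) has_real_derivative - (1/e) * (0 - e * lnpow 0 (e+1) x)) (at x)"
    using lnpow_deriv[OF assms(1), of 0 e] by (intro DERIV_cmult) simp
  moreover have "- (1/e) * (0 - e * lnpow 0 (e+1) x) = lnpow 0 (1 + e) x"
    using assms by (simp add: add.commute)
  ultimately show ?case by simp
next
  case (Suc j)
  have "((\<lambda>x. (1/e) * lnpow_prim j e x - (1/e) * lnpow (Suc j) e x) has_real_derivative
     (1/e) * lnpow j (1 + e) x - (1/e) * (lnpow j (e+1) x - e * lnpow (Suc j) (e+1) x)) (at x)"
    using lnpow_deriv[OF assms(1), of "Suc j" e] by (intro DERIV_diff DERIV_cmult Suc) simp
  moreover have "(1/e) * lnpow j (1 + e) x - (1/e) * (lnpow j (e+1) x - e * lnpow (Suc j) (e+1) x) = lnpow (Suc j) (1 + e) x"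
    using assms by (simp add: field_simps)
  ultimately show ?case by simp
qed

lemma lnpow_prim_1: "lnpow_prim j e 1 = - ((1/e) ^ Suc j)"
  by (induction j) (auto simp: lnpow_def)

lemma lnpow_tendsto_0:
  assumes "e > 0"
  shows "(\<lambda>n. lnpow j e (real (Suc n))) \<longlonglongrightarrow> 0"
proof (rule tendsto_sandwich[where f = "\<lambda>_. 0"])
  show "\<forall>\<^sub>F n in sequentially. lnpow j e (real (Suc n)) \<le> (1/(e/2)) ^ j * real (Suc n) powr (-(e/2))"
    using lnpow_le[of "real (Suc _)" "e/2" j e] assms by (intro always_eventually) (simp add: field_simps)
  have "(\<lambda>n. real (Suc n) powr (-(e/2))) \<longlonglongrightarrow> 0"
    using assms by (intro tendsto_neg_powr filterlim_compose[OF filterlim_real_sequentially filterlim_Suc]) auto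
  then show "(\<lambda>n. (1/(e/2)) ^ j * real (Suc n) powr (-(e/2))) \<longlonglongrightarrow> 0"
    by (rule tendsto_mult_right_zero)
qed (auto simp: lnpow_nonneg)

lemma lnpow_prim_tendsto_0:
  assumes "e > 0"
  shows "(\<lambda>n. lnpow_prim j e (real (Suc n))) \<longlonglongrightarrow> 0"
proof (induction j)
  case 0
  show ?case unfolding lnpow_prim.simps by (intro tendsto_mult_right_zero lnpow_tendsto_0 assms)
next
  case (Suc j)
  have "(\<lambda>n. (1/e) * lnpow_prim j e (real (Suc n)) - (1/e) * lnpow (Suc j) e (real (Suc n))) \<longlonglongrightarrow> 0 - 0"
    by (intro tendsto_diff tendsto_mult_right_zero Suc lnpow_tendsto_0 assms)
  then show ?case by simp
qed

text \<open>The sum is compared with the integral \<open>(1/e) ^ Suc j\<close>. On each unit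
  interval the error is at most the decrease of \<open>variation_bound j\<close>, and these
  decreases telescope to at most \<open>variation_bound j 1 = 6 * 2 ^ j\<close>.\<close>

lemma zeta_coeff:
  assumes e: "0 < e" "e \<le> 1"
  shows "\<bar>dser (\<lambda>_. 1) j (1 + e) - (1/e) ^ Suc j\<bar> \<le> 6 * 2 ^ j"
proof -
  have step: "\<bar>lnpow j (1 + e) (real n) - (lnpow_prim j e (real (Suc n)) - lnpow_prim j e (real n))\<bar>
     \<le> variation_bound j (real n) - variation_bound j (real (Suc n))" if "n \<ge> 1" for n
  proof -
    have "\<exists>z::real. z > real n \<and> z < real (Suc n) \<and>
       lnpow_prim j e (real (Suc n)) - lnpow_prim j e (real n) = (real (Suc n) - real n) * lnpow j (1 + e) z"
      by (rule MVT2) (use that e in \<open>auto intro!: lnpow_prim_deriv\<close>)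
    then obtain z where z: "real n < z" "z < real (Suc n)"
      "lnpow_prim j e (real (Suc n)) - lnpow_prim j e (real n) = lnpow j (1 + e) z" by auto
    have "\<bar>lnpow j (1 + e) (real n) - lnpow j (1 + e) z\<bar> \<le> variation_bound j (real n) - variation_bound j z"
      using z that e by (intro lnpow_variation) auto
    moreover have "variation_bound j (real (Suc n)) \<le> variation_bound j z"
      unfolding variation_bound_def using z that by (intro mult_left_mono powr_mono2') auto
    ultimately show ?thesis unfolding z(3) by linarith
  qed
  have part: "\<bar>(\<Sum>n<Suc N. lnpow j (1 + e) (real n)) - (lnpow_prim j e (real (Suc N)) + (1/e) ^ Suc j)\<bar>
    \<le> 6 * 2 ^ j - variation_bound j (real (Suc N))" for N
  proof (induction N)
    case 0
    then show ?case by (simp add: lnpow_prim_1 variation_bound_def)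
  next
    case (Suc N)
    then show ?case using step[of "Suc N"] by simp
  qed
  have "(\<lambda>N. (\<Sum>n<Suc N. lnpow j (1 + e) (real n)) - (lnpow_prim j e (real (Suc N)) + (1/e) ^ Suc j))
     \<longlonglongrightarrow> dser (\<lambda>_. 1) j (1 + e) - (0 + (1/e) ^ Suc j)"
  proof (intro tendsto_diff tendsto_add tendsto_const lnpow_prim_tendsto_0)
    have "(\<lambda>N. \<Sum>n<N. lnpow j (1 + e) (real n)) \<longlonglongrightarrow> dser (\<lambda>_. 1) j (1 + e)"
      using summable_LIMSEQ[OF summable_lnpow[of "1 + e" j]] e by (simp add: dser_def)
    then show "(\<lambda>N. \<Sum>n<Suc N. lnpow j (1 + e) (real n)) \<longlonglongrightarrow> dser (\<lambda>_. 1) j (1 + e)"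
      by (rule LIMSEQ_Suc)
  qed (use e in auto)
  then have "(\<lambda>N. \<bar>(\<Sum>n<Suc N. lnpow j (1 + e) (real n)) - (lnpow_prim j e (real (Suc N)) + (1/e) ^ Suc j)\<bar>)
     \<longlonglongrightarrow> \<bar>dser (\<lambda>_. 1) j (1 + e) - (0 + (1/e) ^ Suc j)\<bar>"
    by (rule tendsto_rabs)
  then have "\<bar>dser (\<lambda>_. 1) j (1 + e) - (0 + (1/e) ^ Suc j)\<bar> \<le> 6 * 2 ^ j"
  proof (rule LIMSEQ_le_const2, intro exI[of _ 0] allI impI)
    fix N
    have "variation_bound j (real (Suc N)) \<ge> 0" by (simp add: variation_bound_def)
    then show "\<bar>(\<Sum>n<Suc N. lnpow j (1 + e) (real n)) - (lnpow_prim j e (real (Suc N)) + (1/e) ^ Suc j)\<bar> \<le> 6 * 2 ^ j"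
      using part[of N] by linarith
  qed
  then show ?thesis by simp
qed

text \<open>The function \<open>\<zeta>(s) (s - 1)\<close> has the coefficients \<open>u\<close> below, which removes the pole.\<close>

lemma mser_zeta:
  assumes e: "0 < e" "e \<le> 1/12"
  shows "\<bar>mser (\<lambda>_. 1) m (1 + e) - (1/e) ^ Suc m\<bar> \<le> 144 ^ Suc m"
proof -
  define \<alpha> where "\<alpha> = (\<lambda>j. dser (\<lambda>_. 1) j (1 + e))"
  define \<beta> where "\<beta> = (\<lambda>j. mser (\<lambda>_. 1) j (1 + e))"
  \<comment> \<open>\<open>A\<close> is the shifted sequence: with the alternating signs built into
    the coefficients, multiplication by \<open>s - 1 = e + (s - (1 + e))\<close> sends
    \<open>\<alpha>\<close> to \<open>e * \<alpha> k - \<alpha> (k - 1)\<close>.\<close>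
  define A where "A = (\<lambda>k. if k = 0 then 0 else \<alpha> (k - 1))"
  define u where "u = (\<lambda>k. e * \<alpha> k - A k)"
  have rec: "real (Suc m) * \<alpha> (Suc m) = (\<Sum>i\<le>m. \<beta> i * \<alpha> (m - i))" for m
    unfolding \<alpha>_def \<beta>_def using e by (intro dser_mser_recursion rmult_one) auto
  have \<alpha>: "\<bar>\<alpha> j - (1/e) ^ Suc j\<bar> \<le> 6 * 2 ^ j" for j
    unfolding \<alpha>_def using e by (intro zeta_coeff) auto
  \<comment> \<open>\<open>e \<le> 1/12\<close> makes the error \<open>6 * e\<close> in
    \<open>e * \<alpha> 0\<close> at most \<open>1/2\<close>.\<close>
  have u0: "u 0 \<ge> 1/2"
  proof -
    have "\<bar>e * (\<alpha> 0 - 1/e)\<bar> \<le> 1/12 * 6"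
      unfolding abs_mult using \<alpha>[of 0] e by (intro mult_mono) auto
    then have "\<bar>e * \<alpha> 0 - 1\<bar> \<le> 1/2" using e by (simp add: right_diff_distrib)
    moreover have "u 0 = e * \<alpha> 0" by (simp add: u_def A_def)
    ultimately show ?thesis by linarith
  qed
  \<comment> \<open>The coefficients are at most \<open>9 * 2 ^ j\<close>, hence at most
    \<open>1/2 * 36 ^ j\<close> for \<open>j \<ge> 1\<close>; from \<open>36 = 1 / (4 * r)\<close>
    comes the radius \<open>r = 1/144\<close>.\<close>
  have u: "\<bar>u j\<bar> \<le> u 0 * (1 / (4 * (1/144))) ^ j" if j: "j \<ge> 1" for j
  proof -
    obtain i where i: "j = Suc i" using j by (cases j) auto
    define P where "P = (1/e) ^ Suc i"
    have P: "(1/e) ^ Suc (Suc i) = P / e" "e * (P / e) = P" using e by (simp_all add: P_def)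
    have "u j = e * (\<alpha> (Suc i) - P / e) - (\<alpha> i - P)"
      using P by (simp add: u_def A_def i right_diff_distrib)
    then have "\<bar>u j\<bar> \<le> \<bar>e * (\<alpha> (Suc i) - P / e)\<bar> + \<bar>\<alpha> i - P\<bar>"
      by (simp only: abs_triangle_ineq4)
    moreover have "\<bar>e * (\<alpha> (Suc i) - P / e)\<bar> \<le> 1 * (6 * 2 ^ Suc i)"
      unfolding abs_mult using \<alpha>[of "Suc i"] e unfolding P(1) by (intro mult_mono) auto
    moreover have "\<bar>\<alpha> i - P\<bar> \<le> 6 * 2 ^ i" using \<alpha>[of i] by (simp add: P_def)
    ultimately have "\<bar>u j\<bar> \<le> 1 * (6 * 2 ^ Suc i) + 6 * 2 ^ i" by (meson add_mono order_trans)
    also have "\<dots> = 1/2 * (18 * 2 ^ j)" by (simp add: i)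
    also have "\<dots> \<le> 1/2 * (18 ^ j * 2 ^ j)"
      using power_increasing[of 1 j "18::real"] j by (intro mult_left_mono mult_right_mono) auto
    also have "\<dots> = 1/2 * 36 ^ j" by (simp flip: power_mult_distrib)
    also have "\<dots> \<le> u 0 * 36 ^ j" using u0 by (intro mult_right_mono) auto
    finally show ?thesis by simp
  qed
  \<comment> \<open>The logarithmic derivative of \<open>\<zeta>(s) (s - 1)\<close> differs from
    that of \<zeta> by \<open>1 / (s - 1)\<close>, whose coefficients are
    \<open>(1/e) ^ Suc i\<close>.\<close>
  have recu: "real (Suc m) * u (Suc m) = (\<Sum>i\<le>m. (\<beta> i - (1/e) ^ Suc i) * u (m - i))" for m
  proof -
    have 1: "(\<Sum>i\<le>m. \<beta> i * A (m - i)) = real m * \<alpha> m"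
    proof (cases m)
      case (Suc k)
      have "(\<Sum>i\<le>Suc k. \<beta> i * A (Suc k - i)) = (\<Sum>i\<le>k. \<beta> i * \<alpha> (k - i))"
        by (simp add: A_def Suc_diff_le)
      then show ?thesis using rec[of k] Suc by simp
    qed (simp add: A_def)
    define g where "g = (\<lambda>i. if i \<le> m then (1/e) ^ i * \<alpha> (m - i) else 0)"
    have "(\<Sum>i\<le>m. (1/e) ^ Suc i * u (m - i)) = (\<Sum>i\<le>m. g i - g (Suc i))"
    proof (intro sum.cong refl)
      fix i assume "i \<in> {..m}"
      then have "g (Suc i) = (1/e) ^ Suc i * A (m - i)" by (auto simp: g_def A_def)
      moreover have "g i = (1/e) ^ Suc i * (e * \<alpha> (m - i))" using \<open>i \<in> {..m}\<close> e by (simp add: g_def)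
      ultimately show "(1/e) ^ Suc i * u (m - i) = g i - g (Suc i)"
        by (simp only: u_def right_diff_distrib)
    qed
    also have "\<dots> = \<alpha> m" by (subst sum_telescope) (simp add: g_def)
    finally have 2: "(\<Sum>i\<le>m. (1/e) ^ Suc i * u (m - i)) = \<alpha> m" .
    have "(\<Sum>i\<le>m. \<beta> i * u (m - i)) = e * (\<Sum>i\<le>m. \<beta> i * \<alpha> (m - i)) - (\<Sum>i\<le>m. \<beta> i * A (m - i))"
      by (simp add: u_def right_diff_distrib sum_subtractf sum_distrib_left mult_ac)
    also have "\<dots> = e * (real (Suc m) * \<alpha> (Suc m)) - real m * \<alpha> m" by (simp only: 1 rec)
    finally have 3: "(\<Sum>i\<le>m. \<beta> i * u (m - i)) = e * (real (Suc m) * \<alpha> (Suc m)) - real m * \<alpha> m" .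
    have "(\<Sum>i\<le>m. (\<beta> i - (1/e) ^ Suc i) * u (m - i)) = e * (real (Suc m) * \<alpha> (Suc m)) - real m * \<alpha> m - \<alpha> m"
      unfolding left_diff_distrib sum_subtractf 2 3 ..
    also have "\<dots> = real (Suc m) * u (Suc m)" by (simp add: u_def A_def algebra_simps)
    finally show ?thesis ..
  qed
  have "\<bar>\<beta> m - (1/e) ^ Suc m\<bar> \<le> (1 / (1/144)) ^ Suc m"
    by (rule log_deriv_coeff_bound[where a = u, OF _ _ u recu]) (use u0 in auto)
  then show ?thesis by (simp add: \<beta>_def)
qed

section \<open>Lower bounds for values near 1\<close>

lemma infsum_tail_tendsto_0:
  fixes g :: "nat \<Rightarrow> real"
  assumes "summable (\<lambda>n. \<bar>g n\<bar>)"
  shows "(\<lambda>N. infsum (\<lambda>n. \<bar>g n\<bar>) {N<..}) \<longlonglongrightarrow> 0"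
proof -
  have hs: "((\<lambda>n. \<bar>g n\<bar>) has_sum (\<Sum>n. \<bar>g n\<bar>)) UNIV"
    using assms by (intro norm_summable_imp_has_sum summable_sums) auto
  have "infsum (\<lambda>n. \<bar>g n\<bar>) {N<..} = (\<Sum>n. \<bar>g n\<bar>) - (\<Sum>n<Suc N. \<bar>g n\<bar>)" for N
  proof -
    have "((\<lambda>n. \<bar>g n\<bar>) has_sum (\<Sum>n. \<bar>g n\<bar>) - (\<Sum>n<Suc N. \<bar>g n\<bar>)) (UNIV - {..<Suc N})"
      by (intro has_sum_Diff hs has_sum_finiteI) auto
    moreover have "UNIV - {..<Suc N} = {N<..}" by auto
    ultimately show ?thesis by (metis infsumI)
  qed
  moreover have "(\<lambda>N. (\<Sum>n. \<bar>g n\<bar>) - (\<Sum>n<Suc N. \<bar>g n\<bar>)) \<longlonglongrightarrow> (\<Sum>n. \<bar>g n\<bar>) - (\<Sum>n. \<bar>g n\<bar>)"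
    by (intro tendsto_diff tendsto_const LIMSEQ_Suc[OF summable_LIMSEQ[OF assms]])
  ultimately show ?thesis by simp
qed

text \<open>The reciprocal of the Euler product truncated at \<open>N\<close>. Inequalities between
  finitely many Euler factors pass to the series through the limit
  \<open>dser f 0 s * eprod f s N\<close> towards \<open>1\<close>.\<close>

definition eprod :: "(nat \<Rightarrow> real) \<Rightarrow> real \<Rightarrow> nat \<Rightarrow> real" where
  "eprod f s N = (\<Prod>p | prime p \<and> p \<le> N. 1 - f p * real p powr (-s))"

lemma finite_primes_le [simp]: "finite {p::nat. prime p \<and> p \<le> N}"
  by (rule finite_subset[of _ "{..N}"]) auto

text \<open>Sieving out the multiples of one prime after the other multiplies the Dirichlet series by the
  corresponding Euler factor and leaves the term \<open>n = 1\<close> in the limit.\<close>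

lemma dser_eprod_tendsto:
  assumes f: "rmult f" and s: "s > 1"
  shows "(\<lambda>N. dser f 0 s * eprod f s N) \<longlonglongrightarrow> 1"
proof -
  define g where "g = (\<lambda>n. f n * lnpow 0 s (real n))"
  have bd: "\<bar>f n\<bar> \<le> 1" for n using f by (rule rmult_abs)
  have g_eq: "g n = f n * real n powr (-s)" for n by (simp add: g_def lnpow_def)
  have gm: "g (m * n) = g m * g n" for m n
    using f by (simp add: g_eq rmult_def powr_mult)
  have g1: "g 1 = 1" using f by (simp add: g_eq rmult_def)
  have abs: "summable (\<lambda>n. \<bar>g n\<bar>)" unfolding g_def using bd s by (intro summable_dser_abs)
  have sumU: "g summable_on UNIV" "(\<lambda>n. \<bar>g n\<bar>) summable_on UNIV"
    using abs by (auto intro: norm_summable_imp_summable_on)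
  have sumA: "g summable_on A" "(\<lambda>n. \<bar>g n\<bar>) summable_on A" for A
    using sumU by (auto intro: summable_on_subset_banach)
  have "g sums dser f 0 s"
    unfolding dser_def g_def[symmetric] using summable_rabs_cancel[OF abs] by (rule summable_sums)
  then have "(g has_sum dser f 0 s) UNIV"
    using abs by (intro norm_summable_imp_has_sum) auto
  then have dser: "infsum g UNIV = dser f 0 s" by (rule infsumI)
  have sieve: "infsum g {n. \<forall>p\<in>P. \<not> p dvd n} = dser f 0 s * (\<Prod>p\<in>P. 1 - g p)"
    if "finite P" "\<forall>p\<in>P. prime p" for P
    using that
  proof (induction P rule: finite_induct)
    case empty
    then show ?case using dser by simp
  next
    case (insert q P)
    define A where "A = {n. \<forall>p\<in>P. \<not> p dvd n}"
    define B where "B = {n. \<forall>p\<in>insert q P. \<not> p dvd n}"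
    have q: "prime q" using insert by auto
    have dq: "p dvd q * n \<longleftrightarrow> p dvd n" if "p \<in> P" for p n
    proof -
      have "prime p" "p \<noteq> q" using that insert by auto
      then have "\<not> p dvd q" using q primes_dvd_imp_eq[of p q] by blast
      then show ?thesis using \<open>prime p\<close> by (simp add: prime_dvd_mult_iff)
    qed
    then have qA: "q * n \<in> A \<longleftrightarrow> n \<in> A" for n by (simp add: A_def)
    have B: "n \<in> B \<longleftrightarrow> n \<in> A \<and> \<not> q dvd n" for n by (auto simp: A_def B_def)
    define C where "C = (\<lambda>n. q * n) ` A"
    have AB: "B \<union> C = A"
    proof (intro equalityI subsetI)
      fix n assume n: "n \<in> A"
      show "n \<in> B \<union> C"
      proof (cases "q dvd n")
        case True
        then obtain k where k: "n = q * k" by (elim dvdE)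
        then have "k \<in> A" using n qA by blast
        then show ?thesis using k by (auto simp: C_def)
      next
        case False
        then show ?thesis using n B by blast
      qed
    next
      fix n assume "n \<in> B \<union> C"
      then show "n \<in> A"
      proof
        assume "n \<in> C"
        then obtain k where "n = q * k" "k \<in> A" unfolding C_def by (elim imageE)
        then show ?thesis using qA by blast
      qed (use B in blast)
    qed
    have BC: "B \<inter> C = {}"
    proof -
      have "q dvd n" if "n \<in> C" for n using that unfolding C_def by (elim imageE) simp
      then show ?thesis using B by blast
    qed
    have "infsum g (B \<union> C) = infsum g B + infsum g C"
      by (rule infsum_Un_disjoint[OF sumA(1) sumA(1) BC])
    then have "infsum g A = infsum g B + infsum g C" by (simp only: AB)
    also have "infsum g C = infsum (\<lambda>n. g (q * n)) A"
      unfolding C_def using q by (subst infsum_reindex) (auto simp: inj_on_def o_def dest: prime_gt_0_nat)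
    also have "\<dots> = g q * infsum g A" unfolding gm by (rule infsum_cmult_right) (rule sumA(1))
    finally have "infsum g A = infsum g B + g q * infsum g A" .
    then have "infsum g B = infsum g A * (1 - g q)"
      unfolding right_diff_distrib mult.commute[of "g q"] by linarith
    then show ?case using insert by (simp add: A_def B_def mult_ac)
  qed
  have bound: "\<bar>dser f 0 s * eprod f s N - 1\<bar> \<le> infsum (\<lambda>n. \<bar>g n\<bar>) {N<..}" if N: "N \<ge> 2" for N
  proof -
    define A where "A = {n. \<forall>p\<in>{p. prime p \<and> p \<le> N}. \<not> p dvd n}"
    have "A - {1} \<subseteq> {N<..}"
    proof
      fix n assume n: "n \<in> A - {1}"
      then obtain p where p: "prime p" "p dvd n" using prime_factor_nat[of n] by auto
      have "n \<noteq> 0"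
      proof
        assume "n = 0"
        then show False using n N two_is_prime_nat unfolding A_def by auto
      qed
      have "p > N" using n p by (auto simp: A_def not_le)
      then show "n \<in> {N<..}" using p dvd_imp_le[of p n] \<open>n \<noteq> 0\<close> by auto
    qed
    have "1 \<in> A" using not_prime_1 by (auto simp: A_def)
    have "infsum g A = infsum g ({1} \<union> (A - {1}))"
      using \<open>1 \<in> A\<close> by (intro arg_cong[where f = "infsum g"]) auto
    also have "\<dots> = 1 + infsum g (A - {1})"
      using infsum_Un_disjoint[of g "{1}" "A - {1}"] sumA g1 by simp
    finally have "infsum g A - 1 = infsum g (A - {1})" by simp
    moreover have "\<bar>infsum g (A - {1})\<bar> \<le> infsum (\<lambda>n. \<bar>g n\<bar>) (A - {1})"
      using norm_infsum_bound[of g "A - {1}"] sumA by simp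
    moreover have "\<dots> \<le> infsum (\<lambda>n. \<bar>g n\<bar>) {N<..}"
      using \<open>A - {1} \<subseteq> {N<..}\<close> by (intro infsum_mono_neutral sumA) auto
    moreover have "infsum g A = dser f 0 s * eprod f s N"
      unfolding A_def eprod_def g_eq[symmetric] by (intro sieve) auto
    ultimately show ?thesis by simp
  qed
  have "(\<lambda>N. dser f 0 s * eprod f s N - 1) \<longlonglongrightarrow> 0"
    by (rule tendsto_0_le[OF infsum_tail_tendsto_0[OF abs], where K = 1])
       (use bound in \<open>auto intro!: eventually_sequentiallyI[of 2] order_trans[OF _ abs_ge_self]\<close>)
  then show ?thesis by (simp add: LIM_zero_iff)
qed

lemma euler_factor_pos:
  assumes "rmult f" "prime p" "s > 1"
  shows "1 - f p * real p powr (-s) > 0" "0 < real p powr (-s)" "real p powr (-s) < 1"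
proof -
  show x: "0 < real p powr (-s)" using assms prime_gt_0_nat by auto
  have "real p powr (-s) < real p powr 0"
    using assms prime_gt_1_nat[of p] by (intro powr_less_mono) auto
  then show x1: "real p powr (-s) < 1" using assms prime_gt_0_nat[of p] by simp
  have "f p * real p powr (-s) \<le> 1 * real p powr (-s)"
    using rmult_abs[OF assms(1), of p] x by (intro mult_right_mono) auto
  then show "1 - f p * real p powr (-s) > 0" using x1 by simp
qed

lemma eprod_pos: "rmult f \<Longrightarrow> s > 1 \<Longrightarrow> eprod f s N > 0"
  unfolding eprod_def by (intro prod_pos) (use euler_factor_pos(1) in blast)

lemma dser_pos:
  assumes "rmult f" "s > 1" shows "dser f 0 s > 0"
proof (rule ccontr)
  assume "\<not> dser f 0 s > 0"
  then have "dser f 0 s * eprod f s N \<le> 0" for N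
    using eprod_pos[OF assms, of N] by (intro mult_nonpos_nonneg) auto
  then have "(1::real) \<le> 0"
    using LIMSEQ_le_const2[OF dser_eprod_tendsto[OF assms]] by blast
  then show False by simp
qed

text \<open>The four characters \<open>1\<close>, \<open>f\<close>, \<open>g\<close>,
  \<open>f * g\<close> add up to \<open>(1 + f) * (1 + g) \<ge> 0\<close>, so the product of the
  four series behaves like a Dirichlet series with nonnegative coefficients and leading term
  \<open>1\<close>. Here it is seen prime by prime: each combined reciprocal Euler factor lies in
  \<open>[0, 1]\<close>.\<close>

lemma four_dser_ge_1:
  assumes f: "rmult f" and g: "rmult g" and s: "s > 1"
  shows "dser (\<lambda>_. 1) 0 s * dser f 0 s * dser g 0 s * dser (\<lambda>n. f n * g n) 0 s \<ge> 1"
proof -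
  define E where "E = (\<lambda>N. eprod (\<lambda>_. 1) s N * eprod f s N * eprod g s N * eprod (\<lambda>n. f n * g n) s N)"
  define F where "F = dser (\<lambda>_. 1) 0 s * dser f 0 s * dser g 0 s * dser (\<lambda>n. f n * g n) 0 s"
  note fg = rmult_mult[OF f g]
  have F: "F > 0" unfolding F_def using f g fg rmult_one s by (intro mult_pos_pos dser_pos)
  have "(\<lambda>N. (dser (\<lambda>_. 1) 0 s * eprod (\<lambda>_. 1) s N) * (dser f 0 s * eprod f s N)
     * (dser g 0 s * eprod g s N) * (dser (\<lambda>n. f n * g n) 0 s * eprod (\<lambda>n. f n * g n) s N)) \<longlonglongrightarrow> 1 * 1 * 1 * 1"
    by (intro tendsto_mult dser_eprod_tendsto f g fg rmult_one s)
  then have lim: "(\<lambda>N. F * E N) \<longlonglongrightarrow> 1" by (simp add: F_def E_def mult_ac)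
  have "E N \<le> 1" for N
  proof -
    have "E N = (\<Prod>p | prime p \<and> p \<le> N. (1 - 1 * real p powr (-s)) * (1 - f p * real p powr (-s)) *
       (1 - g p * real p powr (-s)) * (1 - f p * g p * real p powr (-s)))"
      by (simp only: E_def eprod_def prod.distrib)
    also have "\<dots> \<le> 1"
    proof (rule prod_le_1, safe)
      fix p :: nat assume p: "prime p" "p \<le> N"
      define x where "x = real p powr (-s)"
      have x: "0 < x" "x < 1" using euler_factor_pos[OF f p(1) s] by (auto simp: x_def)
      have fp: "f p = -1 \<or> f p = 0 \<or> f p = 1" "g p = -1 \<or> g p = 0 \<or> g p = 1"
        using f g unfolding rmult_def by auto
      have sq: "0 \<le> (1 - x) * (1 + x)" "(1 - x) * (1 + x) \<le> 1"
        using x mult_le_one[of x x] by (auto simp: algebra_simps)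
      have sq2: "0 \<le> (1 - x) * (1 - x)" "(1 - x) * (1 - x) \<le> 1" using x by (auto intro: mult_le_one)
      \<comment> \<open>The nine sign patterns of \<open>f p\<close> and \<open>g p\<close> produce
        only these five products.\<close>
      have cases: "(1 - 1 * x) * (1 - f p * x) * (1 - g p * x) * (1 - f p * g p * x) \<in>
         {((1 - x) * (1 - x)) * ((1 - x) * (1 - x)), ((1 - x) * (1 + x)) * ((1 - x) * (1 + x)),
          (1 - x) * (1 + x), (1 - x) * (1 - x), 1 - x}"
        using fp by (elim disjE) simp_all
      have "0 \<le> y \<and> y \<le> 1" if "y \<in>
         {((1 - x) * (1 - x)) * ((1 - x) * (1 - x)), ((1 - x) * (1 + x)) * ((1 - x) * (1 + x)),
          (1 - x) * (1 + x), (1 - x) * (1 - x), 1 - x}" for y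
        using that x sq sq2 mult_le_one[OF sq(2,1,2)] mult_le_one[OF sq2(2,1,2)]
          mult_nonneg_nonneg[OF sq(1,1)] mult_nonneg_nonneg[OF sq2(1,1)]
        by (elim insertE) simp_all
      from this[OF cases]
      show "0 \<le> (1 - 1 * real p powr (-s)) * (1 - f p * real p powr (-s)) *
       (1 - g p * real p powr (-s)) * (1 - f p * g p * real p powr (-s))"
       "(1 - 1 * real p powr (-s)) * (1 - f p * real p powr (-s)) *
       (1 - g p * real p powr (-s)) * (1 - f p * g p * real p powr (-s)) \<le> 1"
        unfolding x_def by auto
    qed
    finally show ?thesis .
  qed
  then have "F * E N \<le> F" for N using F mult_left_mono[of "E N" 1 F] by simp
  then have "1 \<le> F" using LIMSEQ_le_const2[OF lim] by blast
  then show ?thesis by (simp add: F_def)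
qed

text \<open>\<open>L(s, f) / \<zeta>(s)\<close> is nondecreasing in \<open>s\<close>, because each
  of its Euler factors is. This carries a small value of \<open>L\<close> to points closer to
  \<open>1\<close>.\<close>

lemma dser_zeta_ratio_mono:
  assumes f: "rmult f" and s: "1 < s" "s \<le> s'"
  shows "dser f 0 s * dser (\<lambda>_. 1) 0 s' \<le> dser f 0 s' * dser (\<lambda>_. 1) 0 s"
proof -
  let ?Z = "\<lambda>_::nat. 1::real"
  have s': "1 < s'" using s by simp
  have le: "eprod ?Z s N * eprod f s' N \<le> eprod ?Z s' N * eprod f s N" for N
  proof -
    have "eprod ?Z s N * eprod f s' N = (\<Prod>p | prime p \<and> p \<le> N. (1 - 1 * real p powr (-s)) * (1 - f p * real p powr (-s')))"
      by (simp only: eprod_def prod.distrib)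
    also have "\<dots> \<le> (\<Prod>p | prime p \<and> p \<le> N. (1 - 1 * real p powr (-s')) * (1 - f p * real p powr (-s)))"
    proof (rule prod_mono, safe)
      fix p :: nat assume p: "prime p" "p \<le> N"
      show "0 \<le> (1 - 1 * real p powr (-s)) * (1 - f p * real p powr (-s'))"
        using euler_factor_pos(1)[OF f p(1) s'] euler_factor_pos(1)[OF rmult_one p(1) s(1)] by simp
      have x: "real p powr (-s') \<le> real p powr (-s)"
        using s prime_gt_0_nat[OF p(1)] by (intro powr_mono) auto
      have "f p = -1 \<or> f p = 0 \<or> f p = 1" using f unfolding rmult_def by auto
      then show "(1 - 1 * real p powr (-s)) * (1 - f p * real p powr (-s'))
         \<le> (1 - 1 * real p powr (-s')) * (1 - f p * real p powr (-s))"
        using x by (elim disjE) (auto simp: algebra_simps)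
    qed
    also have "\<dots> = eprod ?Z s' N * eprod f s N" by (simp only: eprod_def prod.distrib)
    finally show ?thesis .
  qed
  define c where "c = dser ?Z 0 s * dser f 0 s' * dser ?Z 0 s' * dser f 0 s"
  have c: "c > 0" unfolding c_def using f rmult_one s s' by (intro mult_pos_pos dser_pos)
  have "(\<lambda>N. (dser ?Z 0 s * eprod ?Z s N) * (dser f 0 s' * eprod f s' N) * (dser f 0 s * dser ?Z 0 s'))
     \<longlonglongrightarrow> 1 * 1 * (dser f 0 s * dser ?Z 0 s')"
    by (intro tendsto_mult tendsto_const dser_eprod_tendsto f rmult_one s s')
  then have 1: "(\<lambda>N. c * (eprod ?Z s N * eprod f s' N)) \<longlonglongrightarrow> dser f 0 s * dser ?Z 0 s'"
    by (simp add: c_def mult_ac)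
  have "(\<lambda>N. (dser ?Z 0 s' * eprod ?Z s' N) * (dser f 0 s * eprod f s N) * (dser f 0 s' * dser ?Z 0 s))
     \<longlonglongrightarrow> 1 * 1 * (dser f 0 s' * dser ?Z 0 s)"
    by (intro tendsto_mult tendsto_const dser_eprod_tendsto f rmult_one s s')
  then have 2: "(\<lambda>N. c * (eprod ?Z s' N * eprod f s N)) \<longlonglongrightarrow> dser f 0 s' * dser ?Z 0 s"
    by (simp add: c_def mult_ac)
  show ?thesis
    by (rule LIMSEQ_le[OF 1 2]) (use le c in auto)
qed

section \<open>Nonvanishing at 1 through Lambert series\<close>

lemma divisor_sum_prime_power:
  fixes f :: "nat \<Rightarrow> real"
  assumes f: "rmult f" and p: "prime p" and m: "\<not> p dvd m" "m > 0"
  shows "(\<Sum>d | d dvd p ^ a * m. f d) = (\<Sum>i\<le>a. f p ^ i) * (\<Sum>d | d dvd m. f d)"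
proof (induction a)
  case 0
  then show ?case by simp
next
  case (Suc a)
  have p0: "p > 0" using p prime_gt_0_nat by auto
  have split: "{d. d dvd p ^ Suc a * m} = {d. d dvd p ^ a * m} \<union> (\<lambda>d. p ^ Suc a * d) ` {d. d dvd m}"
  proof (intro equalityI subsetI)
    fix d assume "d \<in> {d. d dvd p ^ Suc a * m}"
    then have d: "d dvd p ^ Suc a * m" by simp
    show "d \<in> {d. d dvd p ^ a * m} \<union> (\<lambda>d. p ^ Suc a * d) ` {d. d dvd m}"
    proof (cases "p ^ Suc a dvd d")
      case True
      then obtain e where e: "d = p ^ Suc a * e" by auto
      then have "e dvd m" using d p0 by simp
      then show ?thesis using e by auto
    next
      case False
      obtain i e where ie: "d = p ^ i * e" "\<not> p dvd e"
        using multiplicity_decompose'[of d p] d m p0 p by (metis dvd_0_left_iff mult_eq_0_iff not_prime_unit power_not_zero neq0_conv)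
      have "i \<le> a"
      proof (rule ccontr)
        assume "\<not> i \<le> a"
        then have "p ^ Suc a dvd p ^ i" by (intro le_imp_power_dvd) simp
        then show False using False ie by auto
      qed
      have "coprime e p" using prime_imp_coprime[OF p ie(2)] by (simp only: coprime_commute)
      then have "coprime e (p ^ Suc a)" by (simp only: coprime_power_right_iff) simp
      moreover have "e dvd p ^ Suc a * m" using d ie by (meson dvd_mult_right)
      ultimately have "e dvd m" by (simp only: coprime_dvd_mult_right_iff)
      then have "d dvd p ^ a * m" unfolding ie(1) using \<open>i \<le> a\<close> by (intro mult_dvd_mono le_imp_power_dvd)
      then show ?thesis by simp
    qed
  qed (auto simp: mult.assoc intro: dvd_mult)
  have disj: "{d. d dvd p ^ a * m} \<inter> (\<lambda>d. p ^ Suc a * d) ` {d. d dvd m} = {}"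
  proof -
    have False if "p ^ Suc a * d dvd p ^ a * m" for d
    proof -
      have "p * d dvd m" using that p0 by (simp add: mult.assoc mult.left_commute[of p])
      then show False using m by (meson dvd_mult_left)
    qed
    then show ?thesis by blast
  qed
  have pw: "f (p ^ n) = f p ^ n" for n using f by (induction n) (auto simp: rmult_def)
  have "(\<Sum>d | d dvd p ^ Suc a * m. f d) = (\<Sum>d | d dvd p ^ a * m. f d) + sum f ((\<lambda>d. p ^ Suc a * d) ` {d. d dvd m})"
    unfolding split using m p0 disj by (intro sum.union_disjoint) (auto intro!: finite_divisors_nat)
  also have "sum f ((\<lambda>d. p ^ Suc a * d) ` {d. d dvd m}) = (\<Sum>d | d dvd m. f (p ^ Suc a * d))"
    using p0 by (subst sum.reindex) (auto simp: inj_on_def)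
  also have "\<dots> = (\<Sum>d | d dvd m. f p ^ Suc a * f d)"
    using f pw[of "Suc a"] by (simp only: rmult_def)
  also have "\<dots> = f p ^ Suc a * (\<Sum>d | d dvd m. f d)" by (simp only: sum_distrib_left)
  finally show ?case using Suc by (simp add: algebra_simps)
qed

lemma geometric_sign_sum:
  fixes x :: real
  assumes "x \<in> {-1, 0, 1}"
  shows "(\<Sum>i\<le>a. x ^ i) \<ge> 0" "even a \<Longrightarrow> (\<Sum>i\<le>a. x ^ i) \<ge> 1"
proof -
  have "(\<Sum>i\<le>a. x ^ i) = (if x = 1 then real a + 1 else if x = 0 then 1 else if even a then 1 else 0)"
    using assms by (induction a) (auto simp: power_0_left)
  then show "(\<Sum>i\<le>a. x ^ i) \<ge> 0" "even a \<Longrightarrow> (\<Sum>i\<le>a. x ^ i) \<ge> 1" by auto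
qed

text \<open>The divisor sum is a product over primes of sums \<open>1 + f p + ... + f p ^ a\<close>
  with \<open>f p\<close> in \<open>{-1, 0, 1}\<close>. Such a sum is never negative, and it is at
  least \<open>1\<close> when \<open>a\<close> is even.\<close>

lemma divisor_sum_rmult:
  assumes f: "rmult f" and "m > 0"
  shows "(\<Sum>d | d dvd m. f d) \<ge> 0 \<and> ((\<exists>k. m = k ^ 2) \<longrightarrow> (\<Sum>d | d dvd m. f d) \<ge> 1)"
  using \<open>m > 0\<close>
proof (induction m rule: less_induct)
  case (less m)
  show ?case
  proof (cases "m = 1")
    case True
    then show ?thesis using f by (simp add: rmult_def)
  next
    case False
    then obtain p where p: "prime p" "p dvd m" using prime_factor_nat by blast
    define a where "a = multiplicity p m"
    obtain n where n: "m = p ^ a * n" "\<not> p dvd n"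
      using multiplicity_decompose'[of m p] less.prems p unfolding a_def
      by (metis neq0_conv not_prime_unit)
    have "a > 0" using p less.prems unfolding a_def by (simp add: prime_multiplicity_gt_zero_iff)
    have n0: "n > 0" using n less.prems by (auto intro: Nat.gr0I)
    have "p ^ a > 1" using \<open>a > 0\<close> prime_gt_1_nat[OF p(1)] by (intro one_less_power) auto
    then have nm: "n < m" using n n0 by simp
    have eq: "(\<Sum>d | d dvd m. f d) = (\<Sum>i\<le>a. f p ^ i) * (\<Sum>d | d dvd n. f d)"
      unfolding n(1) using f p n n0 by (intro divisor_sum_prime_power)
    have fp: "f p \<in> {-1, 0, 1}" using f unfolding rmult_def by blast
    note IH = less.IH[OF nm n0]
    show ?thesis
    proof (intro conjI impI)
      show "(\<Sum>d | d dvd m. f d) \<ge> 0"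
        unfolding eq using IH geometric_sign_sum(1)[OF fp] by (intro mult_nonneg_nonneg) auto
      assume "\<exists>k. m = k ^ 2"
      then obtain k where k: "m = k ^ 2" by auto
      have k0: "k > 0" using k less.prems by (auto intro: Nat.gr0I)
      define b where "b = multiplicity p k"
      obtain l where l: "k = p ^ b * l" "\<not> p dvd l"
        using multiplicity_decompose'[of k p] k0 p unfolding b_def
        by (metis neq0_conv not_prime_unit)
      have a2: "a = 2 * b" unfolding a_def b_def k using p k0 by (simp add: prime_elem_multiplicity_power_distrib)
      have "0 < p ^ a" using prime_gt_0_nat[OF p(1)] by simp
      have "m = p ^ a * l ^ 2"
        unfolding k l(1) a2 by (simp add: power_mult_distrib mult.commute flip: power_mult)
      then have "p ^ a * n = p ^ a * l ^ 2" using n(1) by (simp only:)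
      then have "n = l ^ 2"
        using nat_mult_eq_cancel1[of "p ^ a" n "l ^ 2"] \<open>0 < p ^ a\<close> by blast
      then have "(\<Sum>d | d dvd n. f d) \<ge> 1" using IH by blast
      moreover have "(\<Sum>i\<le>a. f p ^ i) \<ge> 1" using geometric_sign_sum(2)[OF fp] a2 by simp
      ultimately show "(\<Sum>d | d dvd m. f d) \<ge> 1"
        unfolding eq using mult_mono[of 1 "\<Sum>i\<le>a. f p ^ i" 1 "\<Sum>d | d dvd n. f d"] by simp
    qed
  qed
qed

text \<open>The arithmetic-geometric mean inequality after pairing the index \<open>i\<close> with
  \<open>n - 1 - i\<close>.\<close>

lemma sum_powers_amgm:
  fixes u :: real
  assumes "u \<ge> 0"
  shows "real n * u ^ (n - 1) \<le> (\<Sum>i<n. (u\<^sup>2) ^ i)"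
proof -
  have "(\<Sum>i<n. 2 * u ^ (n - 1)) \<le> (\<Sum>i<n. (u\<^sup>2) ^ i + (u\<^sup>2) ^ (n - Suc i))"
  proof (rule sum_mono)
    fix i assume "i \<in> {..<n}"
    then have "u ^ (n - 1) = u ^ i * u ^ (n - Suc i)" by (simp flip: power_add)
    moreover have "2 * u ^ i * u ^ (n - Suc i) \<le> (u ^ i)\<^sup>2 + (u ^ (n - Suc i))\<^sup>2"
      by (rule sum_squares_bound)
    moreover have "(u\<^sup>2) ^ k = (u ^ k)\<^sup>2" for k
      by (simp add: mult.commute flip: power_mult)
    ultimately show "2 * u ^ (n - 1) \<le> (u\<^sup>2) ^ i + (u\<^sup>2) ^ (n - Suc i)"
      by (simp only: mult.assoc)
  qed
  also have "\<dots> = 2 * (\<Sum>i<n. (u\<^sup>2) ^ i)"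
    using sum.nat_diff_reindex[of "\<lambda>i. (u\<^sup>2) ^ i" n] by (simp add: sum.distrib)
  finally show ?thesis by simp
qed

text \<open>What remains of the Lambert term \<open>t ^ n / (1 - t ^ n)\<close> against its leading
  part \<open>1 / (n * (1 - t))\<close>. It is nonnegative and decreasing in \<open>n\<close>, as
  Abel summation wants, and equals \<open>1\<close> at \<open>n = 1\<close> for every
  \<open>t\<close>.\<close>

definition lambert_gap :: "real \<Rightarrow> nat \<Rightarrow> real" where
  "lambert_gap t n = 1 / (real n * (1 - t)) - t ^ n / (1 - t ^ n)"

text \<open>With \<open>S n = 1 + ... + t ^ (n - 1)\<close>, the decrease amounts to
  \<open>n * (n + 1) * t ^ n \<le> S n * S (n + 1)\<close>, which follows from
  \<open>S n \<ge> n * u ^ (n - 1)\<close> for \<open>u = sqrt t\<close>.\<close>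

lemma lambert_gap:
  assumes t: "0 < t" "t < 1" and n: "n \<ge> 1"
  shows "lambert_gap t n \<ge> 0" "lambert_gap t (Suc n) \<le> lambert_gap t n"
proof -
  define u where "u = sqrt t"
  have u: "0 < u" "u < 1" "u\<^sup>2 = t" using t by (auto simp: u_def)
  define S where "S = (\<lambda>n. \<Sum>i<n. t ^ i)"
  have S1: "1 - t ^ n = (1 - t) * S n" for n unfolding S_def by (rule one_diff_power_eq)
  have Spos: "S n > 0" if "n \<ge> 1" for n unfolding S_def using t that by (intro sum_pos) (auto simp: lessThan_empty_iff)
  have "(\<Sum>i<n. t ^ n) \<le> S n" unfolding S_def using t by (intro sum_mono power_decreasing) auto
  then have "real n * t ^ n \<le> S n" by simp
  then have "t ^ n / S n \<le> 1 / real n" using Spos[OF n] n by (simp add: field_simps)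
  then have "t ^ n / S n / (1 - t) \<le> 1 / real n / (1 - t)" using t by (intro divide_right_mono) auto
  then show "lambert_gap t n \<ge> 0" by (simp add: lambert_gap_def S1 mult.commute)
  have "real n * u ^ (n - 1) \<le> S n" "real (Suc n) * u ^ n \<le> S (Suc n)"
    unfolding S_def using sum_powers_amgm[of u n] sum_powers_amgm[of u "Suc n"] u by auto
  then have "(real n * u ^ (n - 1)) * (real (Suc n) * u ^ n) \<le> S n * S (Suc n)"
    using u Spos[OF n] by (intro mult_mono) auto
  moreover have "t ^ n \<le> u ^ (n - 1) * u ^ n"
  proof -
    have "t ^ n = u ^ (n + n)" unfolding u(3)[symmetric] by (simp flip: power_mult add: mult_2)
    also have "\<dots> \<le> u ^ ((n - 1) + n)" using u by (intro power_decreasing) auto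
    finally show ?thesis by (simp add: power_add)
  qed
  then have "real n * real (Suc n) * t ^ n \<le> real n * real (Suc n) * (u ^ (n - 1) * u ^ n)"
    by (intro mult_left_mono) auto
  ultimately have le: "real n * real (Suc n) * t ^ n \<le> S n * S (Suc n)" by (simp add: mult_ac)
  have p: "S n > 0" "S (Suc n) > 0" "1 - t > 0" using Spos n t by auto
  have "t ^ n / X \<le> 1 / Y" if "Y * t ^ n \<le> X" "X > 0" "Y > 0" for X Y :: real
    using that by (simp add: field_simps)
  from this[OF le] have "t ^ n / (S n * S (Suc n)) \<le> 1 / (real n * real (Suc n))"
    using p n by simp
  then have "t ^ n / (S n * S (Suc n)) / (1 - t) \<le> 1 / (real n * real (Suc n)) / (1 - t)"
    using t by (intro divide_right_mono) auto
  also have "1 / (real n * real (Suc n)) / (1 - t) = 1 / (real n * (1 - t)) - 1 / (real (Suc n) * (1 - t))"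
    using n p by (simp add: divide_simps)
  also have "t ^ n / (S n * S (Suc n)) / (1 - t) = t ^ n / (1 - t ^ n) - t ^ Suc n / (1 - t ^ Suc n)"
  proof -
    have "t ^ n / (1 - t ^ n) - t ^ Suc n / (1 - t ^ Suc n)
      = (t ^ n * (1 - t ^ Suc n) - t ^ Suc n * (1 - t ^ n)) / ((1 - t ^ n) * (1 - t ^ Suc n))"
      using S1[of n] S1[of "Suc n"] p by (intro diff_frac_eq) auto
    also have "t ^ n * (1 - t ^ Suc n) - t ^ Suc n * (1 - t ^ n) = t ^ n * (1 - t)"
      by (simp add: algebra_simps)
    also have "t ^ n * (1 - t) / ((1 - t ^ n) * (1 - t ^ Suc n)) = t ^ n / (S n * S (Suc n)) / (1 - t)"
    proof -
      have "a * c / ((c * x) * (c * z)) = a / (x * z) / c" if "c > 0" for a c x z :: real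
        using that by simp
      then show ?thesis unfolding S1 using p(3) by blast
    qed
    finally show ?thesis ..
  qed
  finally show "lambert_gap t (Suc n) \<le> lambert_gap t n" by (simp add: lambert_gap_def)
qed

text \<open>Rearranged as a power series in \<open>t\<close>, the Lambert series has the divisor
  sums of \<open>f\<close> as coefficients: nonnegative everywhere and at least \<open>1\<close> at
  the squares.\<close>

lemma lambert_series_lower:
  assumes f: "rmult f" and t: "0 < t" "t < 1"
  shows "(\<Sum>j=1..J. t ^ (j\<^sup>2)) \<le> (\<Sum>n. f n * (t ^ n / (1 - t ^ n)))"
proof -
  have bd: "\<bar>f n\<bar> \<le> 1" for n using f by (rule rmult_abs)
  have tn: "0 < t ^ n" "t ^ n < 1" if "n \<ge> 1" for n
    using t that power_Suc_less_one[of t "n - 1"] by auto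
  have "summable (\<lambda>n. norm (t ^ n / (1 - t ^ n)))"
  proof (rule summable_comparison_test'[where N = 1])
    show "summable (\<lambda>n. t ^ n / (1 - t))" using t by (intro summable_divide summable_geometric) auto
    fix n :: nat assume n: "n \<ge> 1"
    have "t ^ n \<le> t ^ 1" using n t by (intro power_decreasing) auto
    then have "t ^ n / (1 - t ^ n) \<le> t ^ n / (1 - t)" using t tn[OF n] by (intro divide_left_mono) auto
    then show "norm (norm (t ^ n / (1 - t ^ n))) \<le> t ^ n / (1 - t)" using tn[OF n] by simp
  qed
  then have sU: "(\<lambda>n. t ^ n / (1 - t ^ n)) summable_on {1..}"
    by (intro summable_on_subset_banach[OF norm_summable_imp_summable_on]) auto
  have sabs: "summable (\<lambda>n. norm (f n * (t ^ n / (1 - t ^ n))))"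
    proof (rule summable_comparison_test'[OF \<open>summable (\<lambda>n. norm (t ^ n / (1 - t ^ n)))\<close>, where N = 0])
    fix n
    show "norm (norm (f n * (t ^ n / (1 - t ^ n)))) \<le> norm (t ^ n / (1 - t ^ n))"
      using mult_right_mono[OF bd[of n], of "norm (t ^ n / (1 - t ^ n))"] by (simp add: norm_mult abs_mult)
  qed
  define L where "L = (\<Sum>n. f n * (t ^ n / (1 - t ^ n)))"
  have "((\<lambda>n. f n * (t ^ n / (1 - t ^ n))) has_sum L) UNIV"
    unfolding L_def using sabs by (intro norm_summable_imp_has_sum summable_sums) (auto intro: summable_norm_cancel)
  then have outer: "((\<lambda>n. f n * (t ^ n / (1 - t ^ n))) has_sum L) {1..}"
    by (rule has_sum_cong_neutral[THEN iffD1, rotated -1]) (auto simp: not_less_eq_eq)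
  have inner: "((\<lambda>k. t ^ (n * k)) has_sum t ^ n / (1 - t ^ n)) {1..}" if n: "n \<ge> 1" for n
  proof -
    have "(\<lambda>k. t ^ n * (t ^ n) ^ k) sums (t ^ n * (1 / (1 - t ^ n)))"
      using tn[OF n] by (intro sums_mult geometric_sums) auto
    then have "((\<lambda>k. t ^ n * (t ^ n) ^ k) has_sum (t ^ n * (1 / (1 - t ^ n)))) UNIV"
      using tn[OF n] by (intro sums_nonneg_imp_has_sum) auto
    then have "((\<lambda>k. t ^ (n * Suc k)) has_sum (t ^ n / (1 - t ^ n))) UNIV"
      by (simp add: power_add power_mult)
    moreover have "bij_betw Suc UNIV {1..}"
      by (rule bij_betwI[where g = "\<lambda>n. n - 1"]) auto
    ultimately show ?thesis using has_sum_reindex_bij_betw[of Suc UNIV "{1..}" "\<lambda>k. t ^ (n * k)"] by simp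
  qed
  define h where "h = (\<lambda>(n, k). f n * t ^ (n * k))"
  have "(\<lambda>(n, k). t ^ (n * k)) summable_on ({1..} \<times> {1..})"
    by (rule summable_on_SigmaI[where g = "\<lambda>n. t ^ n / (1 - t ^ n)"]) (use inner sU t in auto)
  then have "(\<lambda>x. norm (h x)) summable_on ({1..} \<times> {1..})"
  proof (rule summable_on_comparison_test)
    fix x :: "nat \<times> nat" assume "x \<in> {1..} \<times> {1..}"
    show "norm (h x) \<le> (case x of (n, k) \<Rightarrow> t ^ (n * k))"
      using t mult_right_mono[OF bd, of "t ^ (fst x * snd x)" "fst x"]
      by (cases x) (auto simp: h_def abs_mult)
  qed simp
  then have sh: "h summable_on ({1..} \<times> {1..})" by (rule abs_summable_summable)
  have "(h has_sum L) ({1..} \<times> {1..})"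
    by (rule has_sum_SigmaI[OF _ outer sh])
       (use has_sum_cmult_right[OF inner] in \<open>auto simp: h_def\<close>)
  then have "((\<lambda>n. \<Sum>d | d dvd n. h (d, n div d)) has_sum L) {1..}"
    by (rule has_sum_dirichlet_pairs)
  also have "?this \<longleftrightarrow> ((\<lambda>n. (\<Sum>d | d dvd n. f d) * t ^ n) has_sum L) {1..}"
    by (rule has_sum_cong) (auto simp: h_def sum_distrib_right intro!: sum.cong)
  finally have hs: "((\<lambda>n. (\<Sum>d | d dvd n. f d) * t ^ n) has_sum L) {1..}" .
  define B where "B = (\<lambda>j::nat. j\<^sup>2) ` {1..J}"
  have "(\<Sum>n\<in>B. (\<Sum>d | d dvd n. f d) * t ^ n) \<le> infsum (\<lambda>n. (\<Sum>d | d dvd n. f d) * t ^ n) {1..}"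
    using hs divisor_sum_rmult[OF f] t
    by (intro finite_sum_le_infsum) (auto simp: B_def summable_on_def intro!: mult_nonneg_nonneg)
  also have "\<dots> = L" using hs by (rule infsumI)
  finally have "(\<Sum>n\<in>B. (\<Sum>d | d dvd n. f d) * t ^ n) \<le> L" .
  moreover have "(\<Sum>n\<in>B. 1 * t ^ n) \<le> (\<Sum>n\<in>B. (\<Sum>d | d dvd n. f d) * t ^ n)"
  proof (rule sum_mono)
    fix n assume "n \<in> B"
    then have "(\<Sum>d | d dvd n. f d) \<ge> 1" using divisor_sum_rmult[OF f, of n] by (auto simp: B_def)
    then show "1 * t ^ n \<le> (\<Sum>d | d dvd n. f d) * t ^ n" using t by (intro mult_right_mono) auto
  qed
  moreover have "(\<Sum>n\<in>B. 1 * t ^ n) = (\<Sum>j=1..J. t ^ (j\<^sup>2))"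
    unfolding B_def by (subst sum.reindex) (auto simp: inj_on_def)
  ultimately show ?thesis by (simp add: L_def)
qed

text \<open>When the series of \<open>f n / n\<close> vanishes, the leading parts
  \<open>f n / (n * (1 - t))\<close> sum to \<open>0\<close>. The gaps are left, and Abel summation
  bounds them by \<open>D\<close> uniformly in \<open>t\<close>.\<close>

lemma lambert_series_upper:
  assumes f: "rmult f" and zm: "zero_mean D f" and t: "0 < t" "t < 1"
    and lim: "(\<lambda>N. \<Sum>n=1..N. f n / real n) \<longlonglongrightarrow> 0"
  shows "(\<Sum>n. f n * (t ^ n / (1 - t ^ n))) \<le> D"
proof -
  have bd: "\<bar>f n\<bar> \<le> 1" for n using f by (rule rmult_abs)
  have tn: "0 < t ^ n" "t ^ n < 1" if "n \<ge> 1" for n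
    using t that power_Suc_less_one[of t "n - 1"] by auto
  have "summable (\<lambda>n. f n * (t ^ n / (1 - t ^ n)))"
  proof (rule summable_comparison_test'[where N = 1])
    show "summable (\<lambda>n. t ^ n / (1 - t))" using t by (intro summable_divide summable_geometric) auto
    fix n :: nat assume n: "n \<ge> 1"
    have "t ^ n \<le> t ^ 1" using n t by (intro power_decreasing) auto
    then have "t ^ n / (1 - t ^ n) \<le> t ^ n / (1 - t)" using t tn[OF n] by (intro divide_left_mono) auto
    moreover have "\<bar>f n\<bar> * (t ^ n / (1 - t ^ n)) \<le> 1 * (t ^ n / (1 - t ^ n))"
      using bd tn[OF n] by (intro mult_right_mono) auto
    ultimately show "norm (f n * (t ^ n / (1 - t ^ n))) \<le> t ^ n / (1 - t)" using tn[OF n] by (simp add: abs_mult)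
  qed
  then have "(\<lambda>N. \<Sum>n<N. f n * (t ^ n / (1 - t ^ n))) \<longlonglongrightarrow> (\<Sum>n. f n * (t ^ n / (1 - t ^ n)))"
    by (rule summable_LIMSEQ)
  then have l1: "(\<lambda>N. \<Sum>n<Suc N. f n * (t ^ n / (1 - t ^ n))) \<longlonglongrightarrow> (\<Sum>n. f n * (t ^ n / (1 - t ^ n)))"
    by (rule LIMSEQ_Suc)
  have l2: "(\<lambda>N. (\<Sum>n=1..N. f n / real n) / (1 - t) + D) \<longlonglongrightarrow> 0 / (1 - t) + D"
    using t by (intro tendsto_intros lim) auto
  have le: "(\<Sum>n<Suc N. f n * (t ^ n / (1 - t ^ n))) \<le> (\<Sum>n=1..N. f n / real n) / (1 - t) + D" if "N \<ge> 1" for N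
  proof -
    have "\<bar>\<Sum>n=1..N. f n * lambert_gap t n\<bar> \<le> D * lambert_gap t 1"
      by (rule abel_bound) (use lambert_gap[OF t] zero_mean_partial'[OF zm bd] that in auto)
    also have "lambert_gap t 1 = 1" using t by (simp add: lambert_gap_def field_simps)
    finally have 1: "\<bar>\<Sum>n=1..N. f n * lambert_gap t n\<bar> \<le> D" by simp
    have "{..<Suc N} = insert 0 {1..N}" by auto
    then have "(\<Sum>n<Suc N. f n * (t ^ n / (1 - t ^ n))) = (\<Sum>n=1..N. f n * (t ^ n / (1 - t ^ n)))"
      by (simp only:) simp
    also have "\<dots> = (\<Sum>n=1..N. f n / real n / (1 - t) - f n * lambert_gap t n)"
      by (intro sum.cong refl) (simp add: lambert_gap_def algebra_simps)
    also have "\<dots> = (\<Sum>n=1..N. f n / real n) / (1 - t) - (\<Sum>n=1..N. f n * lambert_gap t n)"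
      by (simp only: sum_subtractf sum_divide_distrib)
    finally show ?thesis using 1 by linarith
  qed
  have "(\<Sum>n. f n * (t ^ n / (1 - t ^ n))) \<le> 0 / (1 - t) + D"
    by (rule LIMSEQ_le[OF l1 l2]) (use le in blast)
  then show ?thesis by simp
qed

text \<open>Monsky's proof that the series of a real character does not vanish at \<open>1\<close>: otherwise its
  Lambert series would stay bounded, but it dominates a theta series.\<close>

lemma dser_at_1_nonzero:
  assumes f: "rmult f" and zm: "zero_mean D f"
  shows "\<not> (\<lambda>N. \<Sum>n=1..N. f n / real n) \<longlonglongrightarrow> 0"
proof
  assume lim: "(\<lambda>N. \<Sum>n=1..N. f n / real n) \<longlonglongrightarrow> 0"
  \<comment> \<open>\<open>J\<close> terms of the theta series, each at least \<open>1/2\<close>,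
    give \<open>D + 1\<close>, one more than the upper bound.\<close>
  define J where "J = 2 * D + 2"
  define t where "t = root (J\<^sup>2) (1/2)"
  have J: "J\<^sup>2 > 0" by (simp add: J_def)
  have t: "0 < t" "t < 1" "t ^ (J\<^sup>2) = 1/2" using J by (auto simp: t_def real_root_pow_pos)
  have "(\<Sum>j=1..J. 1/2) \<le> (\<Sum>j=1..J. t ^ (j\<^sup>2))"
  proof (rule sum_mono)
    fix j assume "j \<in> {1..J}"
    then have "t ^ (J\<^sup>2) \<le> t ^ (j\<^sup>2)" using t by (intro power_decreasing power_mono) auto
    then show "1/2 \<le> t ^ (j\<^sup>2)" using t by simp
  qed
  also have "\<dots> \<le> D"
    using lambert_series_lower[OF f t(1,2)] lambert_series_upper[OF f zm t(1,2) lim] by (rule order_trans)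
  finally show False by (simp add: J_def)
qed

lemma dser_tail:
  assumes zm: "zero_mean D f" and bd: "\<And>n. \<bar>f n\<bar> \<le> 1" and "1 \<le> M" "1 < s" "s \<le> 2"
  shows "\<bar>dser f j s - (\<Sum>n<M. f n * lnpow j s (real n))\<bar> \<le> D * variation_bound j (real M)"
proof -
  have "(\<lambda>N. \<Sum>n<N. f n * lnpow j s (real n)) \<longlonglongrightarrow> dser f j s"
    unfolding dser_def using assms by (intro summable_LIMSEQ summable_dser)
  then have l: "(\<lambda>N. \<bar>(\<Sum>n<N. f n * lnpow j s (real n)) - (\<Sum>n<M. f n * lnpow j s (real n))\<bar>)
    \<longlonglongrightarrow> \<bar>dser f j s - (\<Sum>n<M. f n * lnpow j s (real n))\<bar>"
    by (intro tendsto_intros)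
  show ?thesis
  proof (rule LIMSEQ_le_const2[OF l], intro exI[of _ M] allI impI)
    fix N assume "M \<le> N"
    then have "(\<Sum>n<N. f n * lnpow j s (real n)) - (\<Sum>n<M. f n * lnpow j s (real n)) = (\<Sum>n=M..<N. f n * lnpow j s (real n))"
      by (simp add: sum_diff_nat_ivl lessThan_atLeast0)
    then show "\<bar>(\<Sum>n<N. f n * lnpow j s (real n)) - (\<Sum>n<M. f n * lnpow j s (real n))\<bar> \<le> D * variation_bound j (real M)"
      using zero_mean_tail[OF zm bd] assms by simp
  qed
qed

text \<open>The tail bound is uniform down to \<open>s = 1\<close>. So values tending to
  \<open>0\<close> would make the partial sums of \<open>f n / n\<close> smaller than a multiple of
  \<open>M powr (-1/2)\<close>, and the sum at \<open>1\<close> would vanish.\<close>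

lemma dser_not_tendsto_0:
  assumes f: "rmult f" and zm: "zero_mean D f"
    and e: "\<And>k. 0 < e k" "\<And>k. e k \<le> 1" "e \<longlonglongrightarrow> (0::real)"
  shows "\<not> (\<lambda>k::nat. dser f 0 (1 + e k)) \<longlonglongrightarrow> 0"
proof
  assume lim: "(\<lambda>k. dser f 0 (1 + e k)) \<longlonglongrightarrow> 0"
  have bd: "\<bar>f n\<bar> \<le> 1" for n using f by (rule rmult_abs)
  have bound: "\<bar>\<Sum>n<M. f n * lnpow 0 1 (real n)\<bar> \<le> D * variation_bound 0 (real M)" if M: "M \<ge> 1" for M
  proof -
    have "(\<lambda>k. \<bar>dser f 0 (1 + e k) - (\<Sum>n<M. f n * lnpow 0 (1 + e k) (real n))\<bar>)
      \<longlonglongrightarrow> \<bar>0 - (\<Sum>n<M. f n * lnpow 0 1 (real n))\<bar>"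
    proof (intro tendsto_rabs tendsto_diff lim tendsto_sum tendsto_mult tendsto_const)
      fix n
      show "(\<lambda>k. lnpow 0 (1 + e k) (real n)) \<longlonglongrightarrow> lnpow 0 1 (real n)"
      proof (cases "n = 0")
        case False
        have "(\<lambda>k. real n powr (-(1 + e k))) \<longlonglongrightarrow> real n powr (-(1 + 0))"
          using False e(3) by (intro tendsto_intros) auto
        then show ?thesis by (simp add: lnpow_def)
      qed simp
    qed
    then have "\<bar>0 - (\<Sum>n<M. f n * lnpow 0 1 (real n))\<bar> \<le> D * variation_bound 0 (real M)"
    proof (rule LIMSEQ_le_const2, intro exI[of _ 0] allI impI)
      fix k
      show "\<bar>dser f 0 (1 + e k) - (\<Sum>n<M. f n * lnpow 0 (1 + e k) (real n))\<bar> \<le> D * variation_bound 0 (real M)"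
        using e(1,2)[of k] by (intro dser_tail zm bd M) auto
    qed
    then show ?thesis by simp
  qed
  have "(\<lambda>N. D * variation_bound 0 (real (Suc N))) \<longlonglongrightarrow> real D * (6 * 2 ^ 0 * 0)"
    unfolding variation_bound_def
    by (intro tendsto_mult tendsto_const tendsto_neg_powr filterlim_compose[OF filterlim_real_sequentially filterlim_Suc]) simp
  then have v: "(\<lambda>N. D * variation_bound 0 (real (Suc N))) \<longlonglongrightarrow> 0" by simp
  have "(\<lambda>N. \<Sum>n=1..N. f n / real n) \<longlonglongrightarrow> 0"
  proof (rule tendsto_0_le[OF v, where K = 1], intro always_eventually allI)
    fix N
    have "{..<Suc N} = insert 0 {1..N}" by auto
    then have "(\<Sum>n<Suc N. f n * lnpow 0 1 (real n)) = (\<Sum>n=1..N. f n * lnpow 0 1 (real n))"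
      by (simp only:) simp
    also have "\<dots> = (\<Sum>n=1..N. f n / real n)"
      by (intro sum.cong refl) (auto simp: lnpow_def powr_minus_divide)
    finally show "norm (\<Sum>n=1..N. f n / real n) \<le> norm (D * variation_bound 0 (real (Suc N))) * 1"
      using bound[of "Suc N"] by simp
  qed
  then show False using dser_at_1_nonzero[OF f zm] by blast
qed

section \<open>Good scales and the repulsion of small values\<close>

lemma ln_le_of_le_exp: "0 < x \<Longrightarrow> x \<le> exp a \<Longrightarrow> ln x \<le> (a::real)"
  using ln_le_cancel_iff[of x "exp a"] by simp

lemma inverse_le_inverse: "0 < b \<Longrightarrow> b \<le> a \<Longrightarrow> 1 / a \<le> 1 / (b::real)"
  by (rule divide_left_mono) auto

text \<open>The bound \<open>exp (y^2)\<close> leaves room for the product of all primes up to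
  \<open>y\<close>, at most \<open>y ^ y\<close>, times an argument \<open>k\<close> bounded by a
  power of \<open>y\<close>.\<close>

definition qfam :: "nat \<Rightarrow> nat set set" where
  "qfam y = {S. finite S \<and> (\<forall>p\<in>S. qindex p) \<and> S \<noteq> {} \<and> real (qmod S) \<le> exp (real y ^ 2)}"

text \<open>The exponents balance two demands. Against Taylor coefficients of size
  \<open>(2 * y^2) ^ Suc j\<close>, a value of order \<open>y^(-8)\<close> dominates at radius
  \<open>8 * y^(-12)\<close>. In the repulsion, one factor \<zeta> of size \<open>y^12\<close>, two
  values of order \<open>y^(-8)\<close> and one of size \<open>y^2\<close> multiply to order
  \<open>y^(-2)\<close>, below \<open>1\<close>.\<close>

definition good_scale :: "nat \<Rightarrow> bool" where
  "good_scale y \<longleftrightarrow> (\<forall>S\<in>qfam y. dser (qprod S) 0 (1 + 1 / real y ^ 12) \<ge> 160 / real y ^ 8)"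

lemma qmod_ge_8:
  assumes "finite S" "\<forall>p\<in>S. qindex p" shows "8 \<le> qmod S"
  using dvd_imp_le[of 8 "qmod S"] qmod_pos[OF assms] by (auto simp: qmod_def)

lemma qprod_coeff_bound:
  assumes S: "S \<in> qfam y" and s: "1 < s" "s \<le> 2"
  shows "\<bar>dser (qprod S) j s\<bar> \<le> 5 * (2 * real y ^ 2) ^ Suc j"
proof -
  have S': "finite S" "\<forall>p\<in>S. qindex p" "S \<noteq> {}" "real (qmod S) \<le> exp (real y ^ 2)"
    using S by (auto simp: qfam_def)
  have q8: "8 \<le> qmod S" using S' by (intro qmod_ge_8)
  have "ln (real (qmod S)) \<le> real y ^ 2" using S'(4) q8 by (intro ln_le_of_le_exp) auto
  moreover have "0 \<le> ln (real (qmod S))" using q8 by simp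
  ultimately have "(2 * ln (real (qmod S))) ^ Suc j \<le> (2 * real y ^ 2) ^ Suc j"
    by (intro power_mono) auto
  moreover have "\<bar>dser (qprod S) j s\<bar> \<le> 5 * (2 * ln (real (qmod S))) ^ Suc j"
    using S' q8 s by (intro dser_zero_mean_bound zero_mean_qprod rmult_abs rmult_qprod) auto
  ultimately show ?thesis by linarith
qed

text \<open>The gain is the factor \<open>2\<close>: the bound is
  \<open>(1 / (2 * e)) ^ Suc m\<close>, whereas the coefficient of
  \<open>- \<zeta>' / \<zeta>\<close> is about \<open>(1 / e) ^ Suc m\<close>.\<close>

lemma good_scale_mser:
  assumes good: "good_scale y" and y: "y \<ge> 2" and S: "S \<in> qfam y"
  shows "\<bar>mser (qprod S) m (1 + 1 / real y ^ 12)\<bar> \<le> (real y ^ 12 / 2) ^ Suc m"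
proof -
  define e where "e = 1 / real y ^ 12"
  have y12: "real y ^ 12 \<ge> 1" using y by (intro one_le_power) auto
  have e: "0 < e" "e \<le> 1" using y12 y by (auto simp: e_def divide_le_eq)
  have S': "finite S" "\<forall>p\<in>S. qindex p" using S by (auto simp: qfam_def)
  have f: "rmult (qprod S)" using S' by (rule rmult_qprod)
  have a0: "dser (qprod S) 0 (1 + e) \<ge> 160 / real y ^ 8"
    using good S by (simp add: good_scale_def e_def)
  have "\<bar>mser (qprod S) m (1 + e)\<bar> \<le> (1 / (2 * e)) ^ Suc m"
  proof (rule log_deriv_coeff_bound[where a = "\<lambda>j. dser (qprod S) j (1 + e)"])
    show "0 < dser (qprod S) 0 (1 + e)" using e by (intro dser_pos f) auto
    show "0 < 2 * e" using e by simp
    show "real (Suc m) * dser (qprod S) (Suc m) (1 + e)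
       = (\<Sum>i\<le>m. mser (qprod S) i (1 + e) * dser (qprod S) (m - i) (1 + e))" for m
      using e by (intro dser_mser_recursion f) auto
    fix j :: nat assume j: "j \<ge> 1"
    define Y where "Y = real y"
    have Y: "Y \<ge> 2" using y by (simp add: Y_def)
    have Y10: "16 \<le> Y ^ 10"
    proof -
      have "(2::real) ^ 10 \<le> Y ^ 10" using Y by (intro power_mono) auto
      then show ?thesis by simp
    qed
    have "\<bar>dser (qprod S) j (1 + e)\<bar> \<le> 5 * (2 * Y ^ 2) ^ Suc j"
      unfolding Y_def using e by (intro qprod_coeff_bound S) auto
    also have "\<dots> = 10 * Y ^ 2 * (2 * Y ^ 2) ^ j" by simp
    also have "\<dots> \<le> (160 / Y ^ 8 * (Y ^ 10 / 16) ^ j) * (2 * Y ^ 2) ^ j"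
    proof (rule mult_right_mono)
      \<comment> \<open>The constant \<open>160\<close> is tuned to give equality at
        \<open>j = 1\<close>; larger \<open>j\<close> only gain, as
        \<open>Y ^ 10 \<ge> 16\<close>.\<close>
      have "10 * Y ^ 2 = 160 / Y ^ 8 * (Y ^ 10 / 16) ^ 1"
      proof -
        have "Y ^ 10 = Y ^ 8 * Y ^ 2" by (simp flip: power_add)
        moreover have "10 * b = 160 / a * (a * b / 16) ^ 1" if "a > 0" for a b :: real using that by simp
        from this[of "Y ^ 8" "Y ^ 2"] have "10 * Y ^ 2 = 160 / Y ^ 8 * (Y ^ 8 * Y ^ 2 / 16) ^ 1"
          using Y zero_less_power[of Y 8] by linarith
        ultimately show ?thesis by (simp only:)
      qed
      also have "\<dots> \<le> 160 / Y ^ 8 * (Y ^ 10 / 16) ^ j"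
        using Y Y10 j by (intro mult_left_mono power_increasing) auto
      finally show "10 * Y ^ 2 \<le> 160 / Y ^ 8 * (Y ^ 10 / 16) ^ j" .
    qed (use Y in auto)
    also have "\<dots> = 160 / Y ^ 8 * ((Y ^ 10 / 16) * (2 * Y ^ 2)) ^ j"
      by (simp only: power_mult_distrib mult.assoc)
    also have "(Y ^ 10 / 16) * (2 * Y ^ 2) = 1 / (4 * (2 * e))"
      by (simp add: e_def Y_def flip: power_add)
    also have "160 / Y ^ 8 * (1 / (4 * (2 * e))) ^ j \<le> dser (qprod S) 0 (1 + e) * (1 / (4 * (2 * e))) ^ j"
      using a0 e by (intro mult_right_mono) (auto simp: Y_def)
    finally show "\<bar>dser (qprod S) j (1 + e)\<bar> \<le> dser (qprod S) 0 (1 + e) * (1 / (4 * (2 * e))) ^ j" .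
  qed
  then show ?thesis by (simp add: e_def)
qed

lemma zeta_0_bounds:
  assumes "0 < e" "e \<le> 1/10000"
  shows "dser (\<lambda>_. 1) 0 (1 + e) \<le> (1001/1000) / e" "(999/1000) / e \<le> dser (\<lambda>_. 1) 0 (1 + e)"
proof -
  have "\<bar>dser (\<lambda>_. 1) 0 (1 + e) - 1 / e\<bar> \<le> 6" using zeta_coeff[of e 0] assms by simp
  moreover have "6 \<le> (1/1000) / e" using assms by (simp add: field_simps)
  moreover have "(1001/1000) / e = 1 / e + (1/1000) / e" "(999/1000) / e = 1 / e - (1/1000) / e"
    by (simp_all add: field_simps)
  ultimately show "dser (\<lambda>_. 1) 0 (1 + e) \<le> (1001/1000) / e" "(999/1000) / e \<le> dser (\<lambda>_. 1) 0 (1 + e)" by linarith+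
qed

text \<open>Repulsion of small values: two different characters of the family cannot both have a small
  value, since \<open>\<zeta>(s) L(s, \<chi>\<^sub>1) L(s, \<chi>\<^sub>2) L(s, \<chi>\<^sub>1 \<chi>\<^sub>2) \<ge> 1\<close> for \<open>s > 1\<close>.\<close>

lemma qfam_repulsion:
  assumes y: "y \<ge> 10000" and S: "S \<in> qfam y" and T: "T \<in> qfam y"
    and small: "dser (qprod S) 0 (1 + 1 / real y ^ 12) < 640 / real y ^ 8"
      "dser (qprod T) 0 (1 + 1 / real y ^ 12) < 640 / real y ^ 8"
  shows "S = T"
proof (rule ccontr)
  assume "S \<noteq> T"
  define Y where "Y = real y"
  define e where "e = 1 / Y ^ 12"
  have Y: "Y \<ge> 10000" using y by (simp add: Y_def)
  have "Y ^ 1 \<le> Y ^ 12" using Y by (intro power_increasing) auto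
  then have Y12: "10000 \<le> Y ^ 12" using Y by simp
  have e: "0 < e" "e \<le> 1/10000" using Y12 inverse_le_inverse[OF _ Y12] by (auto simp: e_def)
  have S': "finite S" "\<forall>p\<in>S. qindex p" "real (qmod S) \<le> exp (Y ^ 2)"
    and T': "finite T" "\<forall>p\<in>T. qindex p" "real (qmod T) \<le> exp (Y ^ 2)"
    using S T by (auto simp: qfam_def Y_def)
  have fS: "rmult (qprod S)" and fT: "rmult (qprod T)" using S' T' rmult_qprod by auto
  define D where "D = qmod (S \<union> T)"
  have D8: "8 \<le> D" unfolding D_def using S' T' by (intro qmod_ge_8) auto
  have "real D \<le> real (qmod S * qmod T)"
    unfolding D_def using qmod_union_le[of S T] S' T' by (simp only: of_nat_le_iff) auto
  also have "\<dots> \<le> exp (Y ^ 2) * exp (Y ^ 2)"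
    using S' T' by (simp only: of_nat_mult) (intro mult_mono, auto)
  also have "\<dots> = exp (2 * Y ^ 2)" by (simp flip: exp_add)
  finally have "ln (real D) \<le> 2 * Y ^ 2" using D8 by (intro ln_le_of_le_exp) auto
  moreover have "\<bar>dser (\<lambda>n. qprod S n * qprod T n) 0 (1 + e)\<bar> \<le> 5 * (2 * ln (real D)) ^ Suc 0"
    using \<open>S \<noteq> T\<close> S' T' D8 e unfolding D_def
    by (intro dser_zero_mean_bound zero_mean_qprod_mult rmult_abs[OF rmult_mult[OF fS fT]]) auto
  ultimately have L12: "dser (\<lambda>n. qprod S n * qprod T n) 0 (1 + e) \<le> 20 * Y ^ 2" by simp
  have z: "dser (\<lambda>_. 1) 0 (1 + e) \<le> 2 * Y ^ 12"
    using zeta_0_bounds(1)[OF e] Y12 by (simp add: e_def)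
  have pos: "0 < dser (\<lambda>_. 1) 0 (1 + e)" "0 < dser (qprod S) 0 (1 + e)" "0 < dser (qprod T) 0 (1 + e)"
     "0 < dser (\<lambda>n. qprod S n * qprod T n) 0 (1 + e)"
    using e fS fT rmult_mult[OF fS fT] rmult_one by (auto intro!: dser_pos)
  have "1 \<le> dser (\<lambda>_. 1) 0 (1 + e) * dser (qprod S) 0 (1 + e) * dser (qprod T) 0 (1 + e) * dser (\<lambda>n. qprod S n * qprod T n) 0 (1 + e)"
    using e by (intro four_dser_ge_1 fS fT) auto
  also have "\<dots> \<le> (2 * Y ^ 12) * (640 / Y ^ 8) * (640 / Y ^ 8) * (20 * Y ^ 2)"
    using pos z L12 small Y unfolding e_def Y_def[symmetric]
    by (intro mult_mono mult_nonneg_nonneg) auto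
  \<comment> \<open>The exponent is \<open>12 - 8 - 8 + 2 = -2\<close>, and
    \<open>Y \<ge> 10000\<close> is far beyond the square root of the constant.\<close>
  also have "\<dots> = 16384000 / Y ^ 2"
  proof -
    have "Y ^ 12 * Y ^ 2 * Y ^ 2 = Y ^ 8 * Y ^ 8" by (simp flip: power_add)
    then show ?thesis using Y by (simp add: field_simps)
  qed
  finally have "Y ^ 2 \<le> 16384000" using Y by (simp add: field_simps)
  moreover have "10000 ^ 2 \<le> Y ^ 2" using Y by (intro power_mono) auto
  ultimately show False by simp
qed

lemma qfam_mono: "y \<le> z \<Longrightarrow> S \<in> qfam y \<Longrightarrow> S \<in> qfam z"
  using power_mono[of "real y" "real z" 2] by (auto simp: qfam_def intro: order_trans)

text \<open>Since \<open>L / \<zeta>\<close> does not grow towards \<open>1\<close>, the quantity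
  \<open>y^8 * L(1 + y^(-12), f)\<close> is multiplied by at most about
  \<open>((y + 1) / y)^20\<close> in the step to \<open>y + 1\<close>. For large \<open>y\<close>
  this is well below the ratio \<open>4\<close> of the two constants.\<close>

lemma small_value_next_scale:
  assumes y: "y \<ge> 10000" and f: "rmult f"
    and small: "dser f 0 (1 + 1 / real y ^ 12) < 160 / real y ^ 8"
  shows "dser f 0 (1 + 1 / real (Suc y) ^ 12) < 640 / real (Suc y) ^ 8"
proof -
  define Y where "Y = real y"
  define Z where "Z = real (Suc y)"
  define e where "e = 1 / Y ^ 12"
  define e' where "e' = 1 / Z ^ 12"
  have Y: "Y \<ge> 10000" "Z \<ge> Y" "Z \<le> (10001/10000) * Y" using y by (auto simp: Y_def Z_def)
  have "Y ^ 1 \<le> Y ^ 12" using Y by (intro power_increasing) auto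
  then have Y12: "10000 \<le> Y ^ 12" using Y by simp
  have YZ: "Y ^ 12 \<le> Z ^ 12" using Y by (intro power_mono) auto
  have e: "0 < e" "e \<le> 1/10000" "0 < e'" "e' \<le> 1/10000" "e' \<le> e"
    using Y12 YZ inverse_le_inverse[OF _ Y12] inverse_le_inverse[OF _ order_trans[OF Y12 YZ]] inverse_le_inverse[OF _ YZ]
      Y(1) by (auto simp: e_def e'_def)
  have "dser f 0 (1 + e') * dser (\<lambda>_. 1) 0 (1 + e) \<le> dser f 0 (1 + e) * dser (\<lambda>_. 1) 0 (1 + e')"
    using e by (intro dser_zeta_ratio_mono f) auto
  also have "\<dots> \<le> (160 / Y ^ 8) * ((1001/1000) / e')"
    using small e zeta_0_bounds(1)[of e'] dser_pos[OF f, of "1 + e"] dser_pos[OF rmult_one, of "1 + e'"] Y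
    unfolding e_def[symmetric] Y_def[symmetric] by (intro mult_mono) (auto simp: e_def Y_def)
  also have "\<dots> = 160 * (1001/1000) * (Z ^ 12 / Y ^ 8)" by (simp add: e'_def)
  finally have 1: "dser f 0 (1 + e') * dser (\<lambda>_. 1) 0 (1 + e) \<le> 160 * (1001/1000) * (Z ^ 12 / Y ^ 8)" .
  have "dser f 0 (1 + e') * ((999/1000) / e) \<le> dser f 0 (1 + e') * dser (\<lambda>_. 1) 0 (1 + e)"
    using zeta_0_bounds(2)[of e] e dser_pos[OF f, of "1 + e'"] by (intro mult_left_mono) auto
  then have "dser f 0 (1 + e') * ((999/1000) * Y ^ 12) \<le> 160 * (1001/1000) * (Z ^ 12 / Y ^ 8)"
    using 1 by (simp add: e_def)
  then have "dser f 0 (1 + e') * ((999/1000) * Y ^ 12) * Y ^ 8 * Z ^ 8 \<le> 160 * (1001/1000) * (Z ^ 12 / Y ^ 8) * Y ^ 8 * Z ^ 8"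
    using Y by (intro mult_right_mono) auto
  also have "\<dots> = 160 * (1001/1000) * Z ^ 20"
    using Y by (simp flip: power_add)
  also have "\<dots> \<le> 160 * (1001/1000) * ((10001/10000) * Y) ^ 20"
    using Y by (intro mult_left_mono power_mono) auto
  also have "\<dots> = 160 * ((1001/1000) * (10001/10000) ^ 20) * Y ^ 20" by (simp only: power_mult_distrib mult_ac)
  also have "\<dots> < 160 * (4 * (999/1000)) * Y ^ 20"
    using Y by (intro mult_strict_right_mono mult_strict_left_mono) (auto simp: power_divide)
  finally have "(dser f 0 (1 + e') * Z ^ 8) * ((999/1000) * Y ^ 20) < 640 * ((999/1000) * Y ^ 20)"
    by (simp add: mult_ac flip: power_add)
  then have "dser f 0 (1 + e') * Z ^ 8 < 640"
    using Y by (subst (asm) mult_less_cancel_right_pos) auto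
  then show ?thesis using Y unfolding e'_def Z_def[symmetric] by (simp add: field_simps)
qed

lemma inverse_power_tendsto_0:
  assumes "k > 0"
  shows "(\<lambda>n. c / real (n + Y) ^ k) \<longlonglongrightarrow> 0"
proof -
  have "filterlim (\<lambda>n. real (n + Y)) at_top sequentially"
    by (rule filterlim_compose[OF filterlim_real_sequentially]) (simp add: filterlim_add_const_nat_at_top)
  then have "filterlim (\<lambda>n. real (n + Y) ^ k) at_top sequentially"
    using assms by (rule filterlim_pow_at_top[rotated])
  then show ?thesis
    by (intro tendsto_divide_0[OF tendsto_const] filterlim_at_top_imp_at_infinity)
qed

text \<open>If all large scales were bad, repulsion would force the same index set \<open>S\<close> to be responsible at
  every scale, and then \<open>L(1, \<chi>\<^sub>S) = 0\<close>.\<close>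

theorem infinitely_many_good_scales: "\<exists>y\<ge>Y0. good_scale y"
proof (rule ccontr)
  assume "\<not> ?thesis"
  then have bad: "\<not> good_scale y" if "y \<ge> Y0" for y using that by blast
  define Y where "Y = max Y0 10000"
  have "\<exists>S\<in>qfam y. dser (qprod S) 0 (1 + 1 / real y ^ 12) < 160 / real y ^ 8" if "y \<ge> Y" for y
    using bad[of y] that by (auto simp: good_scale_def Y_def not_le)
  then obtain S where S: "S y \<in> qfam y" "dser (qprod (S y)) 0 (1 + 1 / real y ^ 12) < 160 / real y ^ 8"
    if "y \<ge> Y" for y by metis
  \<comment> \<open>The bad index sets of two consecutive scales are compared at the same point: the
    value that is small at scale \<open>y\<close> is still below the repulsion threshold
    \<open>640\<close> at scale \<open>y + 1\<close>.\<close>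
  have step: "S (Suc y) = S y" if y: "y \<ge> Y" for y
  proof (rule qfam_repulsion[of "Suc y"])
    show "S (Suc y) \<in> qfam (Suc y)" using S(1)[of "Suc y"] y by simp
    show "S y \<in> qfam (Suc y)" using S(1)[OF y] qfam_mono[of y "Suc y"] by simp
    have "rmult (qprod (S y))" using S(1)[OF y] by (intro rmult_qprod) (auto simp: qfam_def)
    then show "dser (qprod (S y)) 0 (1 + 1 / real (Suc y) ^ 12) < 640 / real (Suc y) ^ 8"
      using small_value_next_scale S(2)[OF y] y by (simp add: Y_def)
    have "160 / real (Suc y) ^ 8 \<le> 640 / real (Suc y) ^ 8" by (intro divide_right_mono) auto
    then show "dser (qprod (S (Suc y))) 0 (1 + 1 / real (Suc y) ^ 12) < 640 / real (Suc y) ^ 8"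
      using S(2)[of "Suc y"] y by simp
    show "10000 \<le> Suc y" using y by (simp add: Y_def)
  qed
  have const: "S (n + Y) = S Y" for n
    by (induction n) (use step in auto)
  define f where "f = qprod (S Y)"
  have SY: "finite (S Y)" "\<forall>p\<in>S Y. qindex p" "S Y \<noteq> {}" using S(1)[of Y] by (auto simp: qfam_def)
  have f: "rmult f" "zero_mean (qmod (S Y)) f"
    unfolding f_def using SY rmult_qprod zero_mean_qprod by auto
  have Y1: "real (n + Y) ^ 12 \<ge> 1" for n by (intro one_le_power) (simp add: Y_def)
  have "(\<lambda>n. dser f 0 (1 + 1 / real (n + Y) ^ 12)) \<longlonglongrightarrow> 0"
  proof (rule tendsto_sandwich[where f = "\<lambda>_. 0"])
    show "\<forall>\<^sub>F n in sequentially. 0 \<le> dser f 0 (1 + 1 / real (n + Y) ^ 12)"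
      using Y1 by (intro always_eventually allI less_imp_le dser_pos f) (smt (verit) zero_less_divide_1_iff)
    show "\<forall>\<^sub>F n in sequentially. dser f 0 (1 + 1 / real (n + Y) ^ 12) \<le> 160 / real (n + Y) ^ 8"
    proof (intro always_eventually allI)
      fix n
      show "dser f 0 (1 + 1 / real (n + Y) ^ 12) \<le> 160 / real (n + Y) ^ 8"
        using S(2)[of "n + Y"] const[of n] by (simp add: f_def)
    qed
    show "(\<lambda>n. 160 / real (n + Y) ^ 8) \<longlonglongrightarrow> 0" by (rule inverse_power_tendsto_0) simp
  qed simp
  moreover have "\<not> (\<lambda>n. dser f 0 (1 + 1 / real (n + Y) ^ 12)) \<longlonglongrightarrow> 0"
  proof (rule dser_not_tendsto_0[OF f])
    show "0 < 1 / real (n + Y) ^ 12" "1 / real (n + Y) ^ 12 \<le> 1" for n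
      using Y1[of n] by (auto simp: divide_le_eq)
    show "(\<lambda>n. 1 / real (n + Y) ^ 12) \<longlonglongrightarrow> 0" by (rule inverse_power_tendsto_0) simp
  qed
  ultimately show False by blast
qed

section \<open>Smooth numbers\<close>

lemma one_less_of_ln_ge: "30000 \<le> ln (real y) \<Longrightarrow> 1 < y"
  by (cases "y = 0 \<or> y = 1") auto

lemma mangoldt_sum_zeta:
  assumes "0 < e" "e \<le> 1/12"
  shows "summable (\<lambda>n. mangoldt n * real n powr (-(1 + e)) :: real)"
    "\<bar>(\<Sum>n. mangoldt n * real n powr (-(1 + e))) - 1 / e\<bar> \<le> 144"
  using summable_mser[of "1 + e" "\<lambda>_. 1" 0] mser_zeta[OF assms, of 0] assms
  by (simp_all add: mser_def lnpow_def)

text \<open>Rankin's trick with \<open>e = 1 / ln z\<close>: the factor \<open>n powr e\<close> is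
  at most \<open>exp 1 \<le> 3\<close> for \<open>n \<le> z\<close>.\<close>

lemma mangoldt_sum_upper:
  assumes z: "12 \<le> ln z" "0 < z" and N: "\<And>n. n \<in> N \<Longrightarrow> 0 < n \<and> real n \<le> z" "finite N"
  shows "(\<Sum>n\<in>N. mangoldt n / real n) \<le> 3 * (ln z + 144)"
proof -
  define e where "e = 1 / ln z"
  have e: "0 < e" "e \<le> 1/12" "1 / e = ln z" proof -
    have "0 < ln z" using z(1) by linarith
    then show "0 < e" "e \<le> 1/12" "1 / e = ln z"
      using inverse_le_inverse[OF _ z(1)] by (auto simp: e_def simp del: ln_gt_zero_iff)
  qed
  have "(\<Sum>n\<in>N. mangoldt n / real n) \<le> (\<Sum>n\<in>N. 3 * (mangoldt n * real n powr (-(1 + e))))"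
  proof (rule sum_mono)
    fix n assume "n \<in> N"
    then have n: "0 < n" "real n \<le> z" using N by auto
    have "e * ln (real n) \<le> e * ln z" using n z e by (intro mult_left_mono) auto
    also have "\<dots> = 1"
    proof -
      have "ln z \<noteq> 0" using z(1) by linarith
      then show ?thesis by (simp only: e_def divide_self_if) simp
    qed
    finally have "real n powr e \<le> exp 1" using n by (simp add: powr_def)
    also have "exp (1::real) \<le> 3" by (rule exp_le)
    finally have "1 \<le> 3 * real n powr (-e)" using n by (simp add: powr_minus field_simps)
    then have "(mangoldt n / real n) * 1 \<le> (mangoldt n / real n) * (3 * real n powr (-e))"
      using n mangoldt_nonneg[of n] by (intro mult_left_mono) auto
    also have "\<dots> = 3 * (mangoldt n * real n powr (-(1 + e)))"
      using n by (simp add: powr_diff powr_minus field_simps)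
    finally show "mangoldt n / real n \<le> 3 * (mangoldt n * real n powr (-(1 + e)))" by simp
  qed
  also have "\<dots> = 3 * (\<Sum>n\<in>N. mangoldt n * real n powr (-(1 + e)))" by (simp only: sum_distrib_left)
  also have "(\<Sum>n\<in>N. mangoldt n * real n powr (-(1 + e))) \<le> (\<Sum>n. mangoldt n * real n powr (-(1 + e)))"
    using mangoldt_sum_zeta[OF e(1,2)] N mangoldt_nonneg by (intro sum_le_suminf) auto
  also have "\<dots> \<le> ln z + 144" using mangoldt_sum_zeta(2)[OF e(1,2)] e(3) by linarith
  finally show ?thesis by simp
qed

text \<open>At \<open>e = 8 / ln y\<close> the full series is about \<open>ln y / 8\<close>. Its
  tail beyond \<open>y\<close> is at most \<open>y powr (-(e/2)) = exp (-4) \<le> 1/16\<close> times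
  the series at \<open>e / 2\<close>, which is about \<open>ln y / 4\<close>; the difference exceeds
  \<open>ln y / 10\<close> with room for the bounded errors once
  \<open>ln y \<ge> 30000\<close>.\<close>

lemma mangoldt_sum_lower:
  assumes y: "ln (real y) \<ge> 30000"
  shows "(\<Sum>n=1..y. mangoldt n / real n) \<ge> ln (real y) / 10"
proof -
  define l where "l = ln (real y)"
  define e where "e = 8 / l"
  have y1: "y > 1" using y by (rule one_less_of_ln_ge)
  have l: "l \<ge> 30000" using y by (simp add: l_def)
  have e: "0 < e" "e \<le> 1/12" "1 / e = l / 8" "0 < e/2" "e/2 \<le> 1/12" "1 / (e/2) = l / 4"
    using l by (auto simp: e_def divide_le_eq)
  define F where "F = (\<lambda>e n. mangoldt n * real n powr (-(1 + e)))"
  have F0: "F e n \<ge> 0" for e n unfolding F_def using mangoldt_nonneg by simp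
  have sF: "summable (F e)" "summable (F (e/2))" unfolding F_def using mangoldt_sum_zeta(1) e by auto
  have small: "real y powr (-(e/2)) \<le> 1/16"
  proof -
    have "real y powr (-(e/2)) = exp (-4)" using y1 l by (simp add: powr_def e_def l_def)
    also have "\<dots> = 1 / exp 1 ^ 4" by (simp add: exp_minus divide_inverse flip: exp_of_nat_mult)
    also have "\<dots> \<le> 1 / 2 ^ 4"
      using exp_ge_add_one_self[of 1] by (intro divide_left_mono power_mono) auto
    finally show ?thesis by simp
  qed
  have "suminf (F e) \<le> (\<Sum>n<Suc y. F e n) + 1/16 * suminf (F (e/2))"
  proof -
    have "suminf (F e) = (\<Sum>n. F e (n + Suc y)) + (\<Sum>n<Suc y. F e n)"
      using sF by (intro suminf_split_initial_segment)
    also have "(\<Sum>n. F e (n + Suc y)) \<le> (\<Sum>n. 1/16 * F (e/2) (n + Suc y))"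
    proof (rule suminf_le)
      fix n
      define k where "k = n + Suc y"
      have k: "k \<ge> y" "k > 0" by (auto simp: k_def)
      have "real k powr (-(1 + e)) = real k powr (-(1 + e/2)) * real k powr (-(e/2))"
      proof -
        have "-(1 + e) = -(1 + e/2) + -(e/2)" by simp
        then show ?thesis by (simp only: powr_add)
      qed
      also have "\<dots> \<le> real k powr (-(1 + e/2)) * (1/16)"
      proof (rule mult_left_mono)
        have "real k powr (-(e/2)) \<le> real y powr (-(e/2))"
          using k y1 e by (intro powr_mono2') auto
        then show "real k powr (-(e/2)) \<le> 1/16" using small by simp
      qed simp
      finally have "mangoldt k * real k powr (-(1 + e)) \<le> mangoldt k * (real k powr (-(1 + e/2)) * (1/16))"
        using mangoldt_nonneg by (intro mult_left_mono)
      then show "F e (n + Suc y) \<le> 1/16 * F (e/2) (n + Suc y)"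
        by (simp only: F_def k_def[symmetric])
    qed (intro summable_mult summable_ignore_initial_segment sF)+
    also have "(\<Sum>n. 1/16 * F (e/2) (n + Suc y)) = 1/16 * (\<Sum>n. F (e/2) (n + Suc y))"
      by (intro suminf_mult summable_ignore_initial_segment sF)
    also have "(\<Sum>n. F (e/2) (n + Suc y)) \<le> suminf (F (e/2))"
    proof -
      have "suminf (F (e/2)) = (\<Sum>n. F (e/2) (n + Suc y)) + (\<Sum>n<Suc y. F (e/2) n)"
        using sF by (intro suminf_split_initial_segment)
      moreover have "(\<Sum>n<Suc y. F (e/2) n) \<ge> 0" using F0 by (intro sum_nonneg)
      ultimately show ?thesis by linarith
    qed
    finally show ?thesis by simp
  qed
  moreover have "suminf (F e) \<ge> l / 8 - 144" "suminf (F (e/2)) \<le> l / 4 + 144"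
    using mangoldt_sum_zeta(2)[OF e(1,2)] mangoldt_sum_zeta(2)[OF e(4,5)] e(3,6)
    unfolding F_def by (simp_all add: abs_le_iff)
  ultimately have "(\<Sum>n<Suc y. F e n) \<ge> l / 10" using l by linarith
  also have "(\<Sum>n<Suc y. F e n) \<le> (\<Sum>n=1..y. mangoldt n / real n)"
  proof -
    have "{..<Suc y} = insert 0 {1..y}" by auto
    then have "(\<Sum>n<Suc y. F e n) = (\<Sum>n=1..y. F e n)" by (simp only:) (simp add: F_def)
    also have "\<dots> \<le> (\<Sum>n=1..y. mangoldt n / real n)"
    proof (rule sum_mono)
      fix n assume n: "n \<in> {1..y}"
      have "real n powr (-(1 + e)) \<le> real n powr (-1)" using n e by (intro powr_mono) auto
      also have "\<dots> = 1 / real n" using n by (simp add: powr_minus_divide)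
      finally have "mangoldt n * real n powr (-(1 + e)) \<le> mangoldt n * (1 / real n)"
        using mangoldt_nonneg by (intro mult_left_mono)
      then show "F e n \<le> mangoldt n / real n" by (simp add: F_def)
    qed
    finally show ?thesis .
  qed
  finally show ?thesis by (simp add: l_def)
qed

text \<open>The part up to \<open>y powr (1/100)\<close> takes away about
  \<open>3 * ln y / 100\<close> of \<open>ln y / 10\<close>. Divisors this large are wanted because
  they lower the exponent of \<open>x\<close> by at least \<open>1/100\<close> in the recursion for
  smooth numbers.\<close>

lemma mangoldt_sum_segment:
  assumes y: "ln (real y) \<ge> 30000"
  shows "(\<Sum>n | real y powr (1/100) < real n \<and> n \<le> y. mangoldt n / real n) \<ge> ln (real y) / 20"
proof -
  define l where "l = ln (real y)"
  define z where "z = real y powr (1/100)"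
  have y1: "y > 1" using y by (rule one_less_of_ln_ge)
  have z: "z > 0" "ln z = l / 100" using y1 by (auto simp: z_def l_def ln_powr)
  define A where "A = {n. z < real n \<and> n \<le> y}"
  define B where "B = {n. 0 < n \<and> real n \<le> z \<and> n \<le> y}"
  have fin: "finite A" "finite B" unfolding A_def B_def by (auto intro: finite_subset[of _ "{..y}"])
  have "{1..y} = A \<union> B" using z by (auto simp: A_def B_def intro!: Nat.gr0I)
  then have "(\<Sum>n=1..y. mangoldt n / real n) = (\<Sum>n\<in>A. mangoldt n / real n) + (\<Sum>n\<in>B. mangoldt n / real n)"
    by (simp only:) (rule sum.union_disjoint, use fin in \<open>auto simp: A_def B_def\<close>)
  moreover have "(\<Sum>n\<in>B. mangoldt n / real n) \<le> 3 * (ln z + 144)"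
    using y z fin by (intro mangoldt_sum_upper) (auto simp: B_def l_def)
  moreover have "(\<Sum>n=1..y. mangoldt n / real n) \<ge> l / 10" using mangoldt_sum_lower[OF y] by (simp add: l_def)
  ultimately have "(\<Sum>n\<in>A. mangoldt n / real n) \<ge> l / 20" proof -
    have "l / 20 \<le> b" if "a = b + c" "c \<le> 3 * (w + 144)" "l / 10 \<le> a" "w = l / 100" for a b c w
    proof -
      have "432 \<le> l / 50" using y unfolding l_def[symmetric] by simp
      moreover have "c \<le> 3 * l / 100 + 432" using that by simp
      ultimately show ?thesis using that by (simp add: field_simps)
    qed
    then show ?thesis if "(\<Sum>n=1..y. mangoldt n / real n) = (\<Sum>n\<in>A. mangoldt n / real n) + (\<Sum>n\<in>B. mangoldt n / real n)"
      "(\<Sum>n\<in>B. mangoldt n / real n) \<le> 3 * (ln z + 144)" "(\<Sum>n=1..y. mangoldt n / real n) \<ge> l / 10"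
      using that z(2) by blast
  qed
  then show ?thesis by (simp add: A_def z_def l_def)
qed

definition smooths :: "nat \<Rightarrow> real \<Rightarrow> nat set" where
  "smooths y x = {k. 0 < k \<and> real k \<le> x \<and> (\<forall>p. prime p \<longrightarrow> p dvd k \<longrightarrow> p \<le> y)}"

lemma finite_smooths [simp]: "finite (smooths y x)"
  by (rule finite_subset[of _ "{..nat \<lfloor>x\<rfloor>}"]) (auto simp: smooths_def le_nat_floor)

text \<open>Weighting the smooth numbers \<open>k\<close> by \<open>ln k = (\<Sum>d | d dvd k. \<Lambda>(d))\<close> gives a lower bound for
  their number in terms of shorter counts.\<close>

lemma smooths_recursion:
  assumes x: "x \<ge> 1"
  shows "(\<Sum>d | real y powr (1/100) < real d \<and> d \<le> y. mangoldt d * real (card (smooths y (x / real d))))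
     \<le> real (card (smooths y x)) * ln x"
proof -
  define D where "D = {d. real y powr (1/100) < real d \<and> d \<le> y}"
  have finD: "finite D" unfolding D_def by (auto intro: finite_subset[of _ "{..y}"])
  have dpos: "d > 0" if "d \<in> D" for d using that powr_ge_zero[of "real y" "1/100"] by (auto simp: D_def intro!: Nat.gr0I simp del: powr_ge_zero)
  have 1: "mangoldt d * real (card (smooths y (x / real d))) \<le> (\<Sum>k\<in>smooths y x. if d dvd k then mangoldt d else 0)"
    if d: "d \<in> D" for d
  proof (cases "primepow d")
    case False
    then have "mangoldt d = (0::real)" by (simp add: mangoldt_def)
    then show ?thesis by (auto intro!: sum_nonneg mangoldt_nonneg)
  next
    case True
    then obtain p n where p: "prime p" "n > 0" "d = p ^ n" by (auto simp: primepow_def)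
    have d0: "d > 0" using dpos d .
    have "card (smooths y (x / real d)) \<le> card {k \<in> smooths y x. d dvd k}"
    proof (rule card_inj_on_le[where f = "\<lambda>j. d * j"])
      show "inj_on (\<lambda>j. d * j) (smooths y (x / real d))" using d0 by (auto simp: inj_on_def)
      show "(\<lambda>j. d * j) ` smooths y (x / real d) \<subseteq> {k \<in> smooths y x. d dvd k}"
      proof safe
        fix j assume j: "j \<in> smooths y (x / real d)"
        have "r \<le> y" if r: "prime r" "r dvd d * j" for r
        proof (cases "r dvd d")
          case True
          then have "r \<le> d" using d0 by (intro dvd_imp_le)
          then show ?thesis using d by (simp add: D_def)
        next
          case False
          then have "r dvd j" using r prime_dvd_mult_iff by blast
          then show ?thesis using j r by (simp add: smooths_def)
        qed
        then show "d * j \<in> smooths y x" using j d0 by (auto simp: smooths_def field_simps)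
      qed simp
    qed simp
    then have "mangoldt d * real (card (smooths y (x / real d))) \<le> mangoldt d * real (card {k \<in> smooths y x. d dvd k})"
      using mangoldt_nonneg by (intro mult_left_mono) auto
    also have "\<dots> = (\<Sum>k\<in>smooths y x. if d dvd k then mangoldt d else 0)"
      by (simp add: sum.inter_filter[symmetric] mult.commute)
    finally show ?thesis .
  qed
  have "(\<Sum>d\<in>D. mangoldt d * real (card (smooths y (x / real d)))) \<le> (\<Sum>d\<in>D. \<Sum>k\<in>smooths y x. if d dvd k then mangoldt d else 0)"
    by (intro sum_mono 1)
  also have "\<dots> = (\<Sum>k\<in>smooths y x. \<Sum>d\<in>D. if d dvd k then mangoldt d else 0)" by (rule sum.swap)
  also have "\<dots> \<le> (\<Sum>k\<in>smooths y x. ln x)"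
  proof (rule sum_mono)
    fix k assume k: "k \<in> smooths y x"
    have "(\<Sum>d\<in>D. if d dvd k then (mangoldt d :: real) else 0) = (\<Sum>d\<in>{d\<in>D. d dvd k}. (mangoldt d :: real))"
      using finD by (simp add: sum.inter_filter)
    also have "\<dots> \<le> (\<Sum>d | d dvd k. (mangoldt d :: real))"
      using k by (intro sum_mono2) (auto simp: smooths_def intro!: finite_divisors_nat mangoldt_nonneg)
    also have "\<dots> = ln (real k)" using mangoldt_sum[of k, where ?'a = real] k by (simp add: smooths_def)
    also have "\<dots> \<le> ln x" using k x by (simp add: smooths_def)
    finally show "(\<Sum>d\<in>D. if d dvd k then mangoldt d else 0) \<le> ln x" .
  qed
  finally show ?thesis by (simp add: D_def)
qed

text \<open>Each step widens the range of \<open>x\<close> by \<open>y powr (1/100)\<close>, since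
  the recursion only meets \<open>x / d\<close> with \<open>d > y powr (1/100)\<close>. It costs a
  constant factor, because \<open>ln x\<close> is a bounded multiple of \<open>ln y\<close>. Up to
  \<open>x = y\<close> every number is smooth, and \<open>1/2\<close> pays for the floor.\<close>

lemma smooths_lower_step:
  "\<exists>c>0. \<forall>y x. ln (real y) \<ge> 30000 \<longrightarrow> 1 \<le> x \<longrightarrow> x \<le> real y powr (1 + real n / 100) \<longrightarrow> c * x \<le> real (card (smooths y x))"
proof (induction n)
  case 0
  show ?case
  proof (intro exI[of _ "1/2"] conjI allI impI)
    fix y :: nat and x :: real
    assume y: "ln (real y) \<ge> 30000" and x: "1 \<le> x" "x \<le> real y powr (1 + real 0 / 100)"
    have y0: "y > 0" using y by (intro Nat.gr0I) auto
    have xy: "x \<le> real y" using x y0 by simp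
    have "{1..nat \<lfloor>x\<rfloor>} \<subseteq> smooths y x"
    proof
      fix k assume k: "k \<in> {1..nat \<lfloor>x\<rfloor>}"
      then have "real k \<le> x" using x by (simp add: le_nat_iff le_floor_iff)
      moreover have "p \<le> y" if "p dvd k" for p
        using that k xy \<open>real k \<le> x\<close> dvd_imp_le[of p k] by auto
      ultimately show "k \<in> smooths y x" using k by (auto simp: smooths_def)
    qed
    then have "card {1..nat \<lfloor>x\<rfloor>} \<le> card (smooths y x)" by (intro card_mono) auto
    then have "real (nat \<lfloor>x\<rfloor>) \<le> real (card (smooths y x))" by simp
    moreover have "1/2 * x \<le> real (nat \<lfloor>x\<rfloor>)"
    proof -
      have "1 \<le> \<lfloor>x\<rfloor>" using x(1) by (simp add: le_floor_iff)
      then have "real (nat \<lfloor>x\<rfloor>) = of_int \<lfloor>x\<rfloor>" "(1::real) \<le> of_int \<lfloor>x\<rfloor>" by simp_all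
      then show ?thesis using real_of_int_floor_add_one_gt[of x] by linarith
    qed
    ultimately show "1/2 * x \<le> real (card (smooths y x))" by linarith
  qed simp
next
  case (Suc n)
  then obtain c where c: "c > 0" and IH: "\<And>y x. ln (real y) \<ge> 30000 \<Longrightarrow> 1 \<le> x \<Longrightarrow> x \<le> real y powr (1 + real n / 100) \<Longrightarrow> c * x \<le> real (card (smooths y x))"
    by blast
  \<comment> \<open>The quotient of the bound \<open>(1 + real (Suc n) / 100) * ln y\<close> for
    \<open>ln x\<close> by the bound \<open>ln y / 20\<close> for the segment of primes.\<close>
  define C where "C = 20 * (1 + real (Suc n) / 100)"
  have C: "C \<ge> 1" by (simp add: C_def)
  show ?case
  proof (intro exI[of _ "c / C"] conjI allI impI)
    show "c / C > 0" using c C by simp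
    fix y :: nat and x :: real
    assume y: "ln (real y) \<ge> 30000" and x: "1 \<le> x" "x \<le> real y powr (1 + real (Suc n) / 100)"
    have y1: "y > 1" using y by (rule one_less_of_ln_ge)
    show "c / C * x \<le> real (card (smooths y x))"
    proof (cases "x \<le> real y powr (1 + real n / 100)")
      case True
      have "c / C * x \<le> c * x" using c C x by (simp add: divide_le_eq)
      then show ?thesis using IH[OF y x(1) True] by simp
    next
      case False
      define D where "D = {d. real y powr (1/100) < real d \<and> d \<le> y}"
      have "real y powr 1 \<le> real y powr (1 + real n / 100)" using y1 by (intro powr_mono) auto
      then have xy: "real y \<le> x" using False y1 by simp
      have "c * x * (ln (real y) / 20) \<le> c * x * (\<Sum>d\<in>D. mangoldt d / real d)"
        using mangoldt_sum_segment[OF y] c x by (intro mult_left_mono) (auto simp: D_def)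
      also have "\<dots> = (\<Sum>d\<in>D. mangoldt d * (c * (x / real d)))"
        unfolding sum_distrib_left by (intro sum.cong refl) (simp add: field_simps)
      also have "\<dots> \<le> (\<Sum>d\<in>D. mangoldt d * real (card (smooths y (x / real d))))"
      proof (intro sum_mono mult_left_mono mangoldt_nonneg)
        fix d assume d: "d \<in> D"
        have dpos: "real d > 0" using d powr_ge_zero[of "real y" "1/100"] unfolding D_def by (smt (verit) mem_Collect_eq)
        have "1 \<le> x / real d" using d xy dpos by (simp add: D_def field_simps)
        moreover have "x / real d \<le> real y powr (1 + real n / 100)"
        proof -
          have "x \<le> real y powr (1 + real n / 100) * real y powr (1/100)"
            using x(2) by (simp add: field_simps flip: powr_add)
          also have "\<dots> \<le> real y powr (1 + real n / 100) * real d" using d by (intro mult_left_mono) (auto simp: D_def)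
          finally show ?thesis using dpos by (simp add: field_simps)
        qed
        ultimately show "c * (x / real d) \<le> real (card (smooths y (x / real d)))" by (intro IH y)
      qed
      also have "\<dots> \<le> real (card (smooths y x)) * ln x" unfolding D_def by (rule smooths_recursion[OF x(1)])
      also have "\<dots> \<le> real (card (smooths y x)) * ((1 + real (Suc n) / 100) * ln (real y))"
      proof (rule mult_left_mono)
        have "ln x \<le> ln (real y powr (1 + real (Suc n) / 100))" using x y1 by (subst ln_le_cancel_iff) auto
        then show "ln x \<le> (1 + real (Suc n) / 100) * ln (real y)" using y1 by (simp add: ln_powr)
      qed simp
      finally have "(c * x) * ln (real y) \<le> (real (card (smooths y x)) * C) * ln (real y)"
        by (simp add: C_def algebra_simps)
      then have "c * x \<le> real (card (smooths y x)) * C" using y by (simp add: mult_le_cancel_right)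
      then show ?thesis using C by (simp add: field_simps)
    qed
  qed
qed

theorem smooths_lower:
  fixes u :: real
  shows "\<exists>c>0. \<forall>y x. ln (real y) \<ge> 30000 \<longrightarrow> 1 \<le> x \<longrightarrow> x \<le> real y powr u \<longrightarrow> c * x \<le> real (card (smooths y x))"
proof -
  obtain n :: nat where n: "100 * u \<le> real n" using real_arch_simple by blast
  obtain c where c: "c > 0" "\<And>y x. ln (real y) \<ge> 30000 \<Longrightarrow> 1 \<le> x \<Longrightarrow> x \<le> real y powr (1 + real n / 100) \<Longrightarrow> c * x \<le> real (card (smooths y x))"
    using smooths_lower_step[of n] by blast
  show ?thesis
  proof (intro exI[of _ c] conjI c(1) allI impI c(2))
    fix y :: nat and x :: real
    assume y: "ln (real y) \<ge> 30000" and x: "x \<le> real y powr u"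
    have y1: "y \<ge> 1" using one_less_of_ln_ge[OF y] by simp
    have "real y powr u \<le> real y powr (1 + real n / 100)" using n y1 by (intro powr_mono) auto
    then show "x \<le> real y powr (1 + real n / 100)" using x by simp
  qed
qed

section \<open>Primes in a window\<close>

text \<open>The weight \<open>e^(m+1) \<Lambda>(n) (ln n)^m / m! n^-(1+e)\<close> concentrates on \<open>ln n\<close> close to \<open>m / e\<close>.\<close>

definition wgt :: "nat \<Rightarrow> real \<Rightarrow> nat \<Rightarrow> real" where
  "wgt m e n = e ^ Suc m * (mangoldt n * lnpow m (1 + e) (real n))"

lemma wgt_nonneg: "e > 0 \<Longrightarrow> wgt m e n \<ge> 0"
  by (simp add: wgt_def mangoldt_nonneg)

text \<open>Chernoff's bound for the gamma density \<open>u ^ m / fact m * exp (-u)\<close> away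
  from its peak at \<open>u = m\<close>. A little decay \<open>exp (- (u / m))\<close> is held back
  at the price of \<open>exp 2\<close>, to keep the later sum over primes convergent.\<close>

lemma gamma_tail:
  fixes u d :: real
  assumes m: "real m \<ge> 3 / d" and d: "0 < d" "d \<le> 1/2" and u: "u \<ge> 0" and out: "\<bar>u - real m\<bar> > d * real m"
  shows "u ^ m / fact m * exp (-u) \<le> exp 2 * (max ((1 - d) * exp d) ((1 + d) * exp (-d))) ^ m * exp (- (u / real m))"
proof -
  have m3: "real m * d \<ge> 3" using m d by (simp add: field_simps)
  have m0: "real m > 0" using m3 by (cases "m = 0") auto
  define M where "M = real m"
  have M: "M > 0" "M * d \<ge> 3" using m0 m3 by (auto simp: M_def)
  define k where "k = max ((1 - d) * exp d) ((1 + d) * exp (-d))"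
  consider "u < (1 - d) * M" | "u > (1 + d) * M" using out by (auto simp: M_def abs_if algebra_simps split: if_splits)
  then show ?thesis
  proof cases
    case 1
    \<comment> \<open>The Chernoff parameter: \<open>exp ((a - 1) * u)\<close> is largest at the
      edge \<open>u = (1 - d) * m\<close> of the window.\<close>
    define a where "a = 1 / (1 - d)"
    have a: "a > 0" "1 / a = 1 - d" "(a - 1) * (1 - d) = d" "a \<ge> 1" using d by (auto simp: a_def field_simps)
    have "u ^ m / fact m \<le> exp (a * u) / a ^ m" by (rule pow_fact_le_exp[OF u a(1)])
    also have "\<dots> = (1 / a) ^ m * exp (a * u)" by (simp add: power_one_over)
    also have "\<dots> = (1 - d) ^ m * exp (a * u)" by (simp only: a(2))
    finally have "u ^ m / fact m * exp (-u) \<le> (1 - d) ^ m * exp (a * u) * exp (-u)" by (intro mult_right_mono) auto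
    also have "\<dots> = (1 - d) ^ m * exp ((a - 1) * u)" by (simp add: algebra_simps flip: exp_add)
    also have "\<dots> \<le> (1 - d) ^ m * exp (2 + d * M - u / M)"
    proof (intro mult_left_mono)
      have "(a - 1) * u \<le> (a - 1) * ((1 - d) * M)" using 1 a by (intro mult_left_mono) auto
      also have "\<dots> = d * M" using a(3) by (simp add: mult.assoc[symmetric])
      finally have "(a - 1) * u \<le> d * M" .
      moreover have "u / M \<le> 1"
      proof -
        have "(1 - d) * M \<le> 1 * M" using d M by (intro mult_right_mono) auto
        then have "u \<le> M" using 1 by linarith
        then show ?thesis using M by simp
      qed
      ultimately show "exp ((a - 1) * u) \<le> exp (2 + d * M - u / M)" by simp
    qed (use d in auto)
    also have "\<dots> = exp 2 * ((1 - d) * exp d) ^ m * exp (- (u / M))"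
    proof -
      have "exp (2 + d * M - u / M) = exp 2 * exp (real m * d) * exp (- (u / M))"
        by (simp add: M_def mult.commute flip: exp_add)
      then have "exp (2 + d * M - u / M) = exp 2 * exp (d) ^ m * exp (- (u / M))"
        by (simp only: exp_of_nat_mult)
      then show ?thesis by (simp only: power_mult_distrib mult_ac)
    qed
    also have "\<dots> \<le> exp 2 * k ^ m * exp (- (u / M))"
      using d by (intro mult_right_mono mult_left_mono power_mono) (auto simp: k_def)
    finally show ?thesis by (simp add: k_def M_def)
  next
    case 2
    define a where "a = 1 / (1 + d)"
    have a: "a > 0" "1 / a = 1 + d" "(1 - a) * (1 + d) = d" "a \<le> 1" using d by (auto simp: a_def field_simps)
    have "u ^ m / fact m \<le> exp (a * u) / a ^ m" by (rule pow_fact_le_exp[OF u a(1)])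
    also have "\<dots> = (1 / a) ^ m * exp (a * u)" by (simp add: power_one_over)
    also have "\<dots> = (1 + d) ^ m * exp (a * u)" by (simp only: a(2))
    finally have "u ^ m / fact m * exp (-u) \<le> (1 + d) ^ m * exp (a * u) * exp (-u)" by (intro mult_right_mono) (use d in auto)
    also have "\<dots> = (1 + d) ^ m * exp (- ((1 - a) * u))" by (simp add: algebra_simps flip: exp_add)
    also have "\<dots> \<le> (1 + d) ^ m * exp (2 - d * M - u / M)"
    proof (intro mult_left_mono)
      \<comment> \<open>This is where \<open>m \<ge> 3 / d\<close> enters: the rate
        \<open>1 - a \<ge> d / 3\<close> must survive giving away \<open>1 / M\<close> to the factor
        \<open>exp (- (u / M))\<close>.\<close>
      have c: "1 - a - 1 / M \<ge> 0"
      proof -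
        have "1 / M \<le> d / 3" using M by (simp add: field_simps)
        moreover have "1 - a \<ge> d / 3" using d by (simp add: a_def field_simps)
        ultimately show ?thesis by simp
      qed
      have "(1 - a - 1 / M) * ((1 + d) * M) \<le> (1 - a - 1 / M) * u" using 2 c by (intro mult_left_mono) auto
      moreover have "(1 - a - 1 / M) * ((1 + d) * M) = d * M - (1 + d)"
      proof -
        have "(1 - a - 1 / M) * ((1 + d) * M) = ((1 - a) * (1 + d)) * M - (1 + d)" using M by (simp add: field_simps)
        then show ?thesis by (simp only: a(3))
      qed
      moreover have "(1 - a - 1 / M) * u = (1 - a) * u - u / M" by (simp add: algebra_simps)
      ultimately show "exp (- ((1 - a) * u)) \<le> exp (2 - d * M - u / M)" using d by simp
    qed (use d in auto)
    also have "\<dots> = exp 2 * ((1 + d) * exp (-d)) ^ m * exp (- (u / M))"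
    proof -
      have "exp (2 - d * M - u / M) = exp 2 * exp (real m * (-d)) * exp (- (u / M))"
        by (simp add: M_def mult.commute flip: exp_add)
      then have "exp (2 - d * M - u / M) = exp 2 * exp (-d) ^ m * exp (- (u / M))"
        by (simp only: exp_of_nat_mult)
      then show ?thesis by (simp only: power_mult_distrib mult_ac)
    qed
    also have "\<dots> \<le> exp 2 * k ^ m * exp (- (u / M))"
      using d by (intro mult_right_mono mult_left_mono power_mono) (auto simp: k_def)
    finally show ?thesis by (simp add: k_def M_def)
  qed
qed

lemma window_rate_less_1:
  assumes "0 < d" "d \<le> (1/2::real)"
  shows "max ((1 - d) * exp d) ((1 + d) * exp (-d)) < 1" "0 < max ((1 - d) * exp d) ((1 + d) * exp (-d))"
proof -
  have "1 - d < exp (-d)" using exp_ge_add_one_self[of "-d"] exp_minus_greater[of d] assms by auto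
  then have "(1 - d) * exp d < exp (-d) * exp d" by (intro mult_strict_right_mono) auto
  then have 1: "(1 - d) * exp d < 1" by (simp flip: exp_add)
  have "1 + d < exp d" using exp_minus_greater[of "-d"] assms by auto
  then have "(1 + d) * exp (-d) < exp d * exp (-d)" by (intro mult_strict_right_mono) auto
  then have 2: "(1 + d) * exp (-d) < 1" by (simp flip: exp_add)
  show "max ((1 - d) * exp d) ((1 + d) * exp (-d)) < 1" using 1 2 by simp
  have "0 < (1 + d) * exp (-d)" using assms by simp
  then show "0 < max ((1 - d) * exp d) ((1 + d) * exp (-d))" by (simp add: less_max_iff_disj)
qed

definition outer_window :: "nat \<Rightarrow> real \<Rightarrow> real \<Rightarrow> nat set" where
  "outer_window m e d = {n. \<bar>ln (real n) - real m / e\<bar> > d * (real m / e)}"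

text \<open>With \<open>u = e * ln n\<close>, the decay held back in the gamma tail is
  \<open>n powr (-c)\<close> for \<open>c = e / m\<close>. What is left is the series of
  \<open>mangoldt n * n powr (-(1 + c))\<close>, about \<open>m / e\<close>, and the factor
  \<open>e\<close> turns it into \<open>m\<close>.\<close>

lemma wgt_outer_sum:
  assumes m: "real m \<ge> 3 / d" "m > 0" and d: "0 < d" "d \<le> 1/2" and e: "0 < e" "e \<le> 1/12"
    and F: "finite F" "F \<subseteq> outer_window m e d"
  shows "(\<Sum>n\<in>F. wgt m e n) \<le> exp 2 * (max ((1 - d) * exp d) ((1 + d) * exp (-d))) ^ m * (real m + 144)"
proof -
  define k where "k = max ((1 - d) * exp d) ((1 + d) * exp (-d))"
  have k: "0 < k" using window_rate_less_1[OF d] by (simp add: k_def)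
  define c where "c = e / real m"
  have c: "0 < c" "c \<le> 1/12" "e / c = real m" "e * (1 / c) = real m"
  proof -
    have "c \<le> e / 1" unfolding c_def using m e by (intro divide_left_mono) auto
    then show "c \<le> 1/12" using e by simp
  qed (use m e in \<open>auto simp: c_def\<close>)
  have "(\<Sum>n\<in>F. wgt m e n) \<le> (\<Sum>n\<in>F. (exp 2 * k ^ m * e) * (mangoldt n * real n powr (-(1 + c))))"
  proof (rule sum_mono)
    fix n assume n: "n \<in> F"
    show "wgt m e n \<le> (exp 2 * k ^ m * e) * (mangoldt n * real n powr (-(1 + c)))"
    proof (cases "n = 0")
      case True
      then show ?thesis by (simp add: wgt_def)
    next
      case False
      define u where "u = e * ln (real n)"
      have u0: "u \<ge> 0" using False e by (simp add: u_def)
      have "d * (real m / e) < \<bar>ln (real n) - real m / e\<bar>" using n F by (auto simp: outer_window_def)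
      then have "e * (d * (real m / e)) < e * \<bar>ln (real n) - real m / e\<bar>" using e by (intro mult_strict_left_mono)
      also have "e * \<bar>ln (real n) - real m / e\<bar> = \<bar>e * (ln (real n) - real m / e)\<bar>"
        using e by (simp add: abs_mult)
      also have "e * (ln (real n) - real m / e) = u - real m" using e by (simp add: u_def field_simps)
      finally have out: "d * real m < \<bar>u - real m\<bar>" using e by simp
      have "e ^ m * lnpow m (1 + e) (real n) = (u ^ m / fact m * exp (-u)) * real n powr (-1)"
      proof -
        have "real n powr (-(1 + e)) = real n powr (-1) * exp (-u)"
        proof -
          have "real n powr (-(1 + e)) = real n powr (-1 + (-e))" by simp
          also have "\<dots> = real n powr (-1) * real n powr (-e)" by (rule powr_add)
          also have "real n powr (-e) = exp (-u)" using False by (simp add: powr_def u_def)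
          finally show ?thesis .
        qed
        then show ?thesis by (simp add: lnpow_def u_def power_mult_distrib)
      qed
      also have "\<dots> \<le> (exp 2 * k ^ m * exp (- (u / real m))) * real n powr (-1)"
        using gamma_tail[OF m(1) d u0 out] unfolding k_def by (intro mult_right_mono) auto
      also have "\<dots> = exp 2 * k ^ m * (real n powr (-1) * exp (- (u / real m)))" by (simp only: mult_ac)
      also have "real n powr (-1) * exp (- (u / real m)) = real n powr (-(1 + c))"
      proof -
        have "real n powr (-(1 + c)) = real n powr (-1 + (-c))" by simp
        also have "\<dots> = real n powr (-1) * real n powr (-c)" by (rule powr_add)
        also have "real n powr (-c) = exp (- (u / real m))" using False by (simp add: powr_def u_def c_def)
        finally show ?thesis ..
      qed
      finally have "(e * mangoldt n) * (e ^ m * lnpow m (1 + e) (real n)) \<le> (e * mangoldt n) * (exp 2 * k ^ m * real n powr (-(1 + c)))"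
        using e mangoldt_nonneg by (intro mult_left_mono mult_nonneg_nonneg) auto
      then show ?thesis by (simp add: wgt_def mult_ac)
    qed
  qed
  also have "\<dots> = (exp 2 * k ^ m * e) * (\<Sum>n\<in>F. mangoldt n * real n powr (-(1 + c)))"
    by (simp only: sum_distrib_left)
  also have "\<dots> \<le> (exp 2 * k ^ m * e) * (1 / c + 144)"
  proof (rule mult_left_mono)
    have "(\<Sum>n\<in>F. mangoldt n * real n powr (-(1 + c))) \<le> (\<Sum>n. mangoldt n * real n powr (-(1 + c)))"
      using mangoldt_sum_zeta(1)[OF c(1,2)] F mangoldt_nonneg by (intro sum_le_suminf) auto
    then show "(\<Sum>n\<in>F. mangoldt n * real n powr (-(1 + c))) \<le> 1 / c + 144"
      using mangoldt_sum_zeta(2)[OF c(1,2)] by linarith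
  qed (use k e in auto)
  also have "\<dots> = exp 2 * k ^ m * (e * (1 / c) + e * 144)" by (simp add: algebra_simps)
  also have "\<dots> \<le> exp 2 * k ^ m * (real m + 144)"
    using k e c by (intro mult_left_mono) auto
  finally show ?thesis by (simp add: k_def)
qed

text \<open>A proper prime power \<open>p ^ j\<close> is determined by \<open>b = p ^ (j div 2)\<close> and the parity of \<open>j\<close>, and is
  at least \<open>b\<^sup>2\<close>.\<close>

lemma proper_prime_power_sum:
  "\<exists>C\<ge>0. \<forall>F. finite F \<longrightarrow> F \<subseteq> {n. primepow n \<and> \<not> prime n} \<longrightarrow> (\<Sum>n\<in>F. real n powr (-7/8)) \<le> (C::real)"
proof -
  have sm: "summable (\<lambda>b. real b powr (-7/4))" by (simp add: summable_real_powr_iff)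
  define C where "C = 2 * (\<Sum>b. real b powr (-7/4))"
  have C: "C \<ge> 0" unfolding C_def using sm by (intro mult_nonneg_nonneg suminf_nonneg) auto
  have "(\<Sum>n\<in>F. real n powr (-7/8)) \<le> C" if F: "finite F" "F \<subseteq> {n. primepow n \<and> \<not> prime n}" for F
  proof -
    have "\<forall>n\<in>F. \<exists>p j. prime p \<and> j \<ge> 2 \<and> n = p ^ j"
    proof
      fix n assume "n \<in> F"
      then obtain p j where p: "prime p" "j > 0" "n = p ^ j" "\<not> prime n" using F by (auto simp: primepow_def)
      then have "j \<noteq> 1" by auto
      then show "\<exists>p j. prime p \<and> j \<ge> 2 \<and> n = p ^ j" using p by (intro exI[of _ p] exI[of _ j]) auto
    qed
    then obtain p j where pj: "\<And>n. n \<in> F \<Longrightarrow> prime (p n) \<and> j n \<ge> 2 \<and> n = p n ^ j n" by metis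
    define g where "g = (\<lambda>n. (p n ^ (j n div 2), odd (j n)))"
    have inj: "inj_on g F"
    proof (rule inj_onI)
      fix n n' assume n: "n \<in> F" "n' \<in> F" "g n = g n'"
      then have eq: "p n ^ (j n div 2) = p n' ^ (j n' div 2)" "odd (j n) = odd (j n')" by (auto simp: g_def)
      have pos: "j n div 2 > 0" "j n' div 2 > 0" using pj[OF n(1)] pj[OF n(2)] by auto
      have pp: "prime (p n)" "prime (p n')" using pj n by auto
      have "p n dvd p n' ^ (j n' div 2)" unfolding eq(1)[symmetric] using pos by (intro dvd_power) auto
      then have "p n dvd p n'" using pp prime_dvd_power by blast
      then have p: "p n = p n'" using pp primes_dvd_imp_eq by blast
      then have "j n div 2 = j n' div 2" using eq(1) pp prime_gt_1_nat[OF pp(1)] by (simp add: power_inject_exp)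
      moreover have "j n mod 2 = j n' mod 2" using eq(2) by (metis odd_iff_mod_2_eq_one even_iff_mod_2_eq_zero)
      ultimately have "j n = j n'" by (metis div_mult_mod_eq)
      then show "n = n'" using pj[OF n(1)] pj[OF n(2)] p by metis
    qed
    have le: "real n powr (-7/8) \<le> (case g n of (b, _) \<Rightarrow> real b powr (-7/4))" if n: "n \<in> F" for n
    proof -
      define b where "b = p n ^ (j n div 2)"
      have p1: "p n \<ge> 1" using pj[OF n] prime_ge_1_nat by auto
      have b: "b > 0" using p1 by (simp add: b_def)
      have "b ^ 2 = p n ^ (2 * (j n div 2))" by (simp add: b_def mult.commute flip: power_mult)
      also have "\<dots> \<le> p n ^ j n" using p1 by (intro power_increasing) auto
      also have "\<dots> = n" using pj[OF n] by simp
      finally have "real b ^ 2 \<le> real n" by (simp flip: of_nat_power)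
      then have "real n powr (-7/8) \<le> (real b ^ 2) powr (-7/8)" using b by (intro powr_mono2') auto
      also have "(real b ^ 2) powr (-7/8) = real b powr (-7/4)"
      proof -
        have "(real b ^ 2) powr (-7/8) = (real b powr 2) powr (-7/8)" using b by simp
        also have "\<dots> = real b powr (2 * (-7/8))" by (rule powr_powr)
        finally show ?thesis by simp
      qed
      finally show ?thesis by (simp add: g_def b_def)
    qed
    define N where "N = Suc (Max (insert 0 (fst ` g ` F)))"
    have sub: "g ` F \<subseteq> {..<N} \<times> UNIV"
    proof
      fix x assume x: "x \<in> g ` F"
      then have "fst x \<le> Max (insert 0 (fst ` g ` F))" using F by (intro Max_ge) auto
      then show "x \<in> {..<N} \<times> UNIV" by (cases x) (auto simp: N_def)
    qed
    have "(\<Sum>n\<in>F. real n powr (-7/8)) \<le> (\<Sum>n\<in>F. case g n of (b, _) \<Rightarrow> real b powr (-7/4))" by (intro sum_mono le)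
    also have "\<dots> = (\<Sum>x\<in>g ` F. case x of (b, _) \<Rightarrow> real b powr (-7/4))" by (simp add: sum.reindex[OF inj])
    also have "\<dots> \<le> (\<Sum>x\<in>{..<N} \<times> (UNIV::bool set). case x of (b, _) \<Rightarrow> real b powr (-7/4))"
      using sub by (intro sum_mono2) auto
    also have "\<dots> = (\<Sum>b<N. \<Sum>o'\<in>(UNIV::bool set). real b powr (-7/4))" by (rule sum.cartesian_product[symmetric])
    also have "\<dots> = 2 * (\<Sum>b<N. real b powr (-7/4))" by (simp add: UNIV_bool sum_distrib_left)
    also have "\<dots> \<le> C" unfolding C_def using sm by (intro mult_left_mono sum_le_suminf) auto
    finally show ?thesis .
  qed
  then show ?thesis using C by blast
qed

text \<open>A power \<open>n powr (1/16)\<close> absorbs \<open>ln n ^ m / fact m\<close> at the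
  cost of \<open>16 ^ m\<close>, another one absorbs \<open>mangoldt n\<close>; the rest is
  \<open>n powr (-7/8)\<close>, summable over proper prime powers. The factor
  \<open>(16 * e) ^ m\<close> is tiny for small \<open>e\<close>.\<close>

lemma wgt_prime_power_sum:
  "\<exists>C\<ge>0. \<forall>m e F. 0 < e \<longrightarrow> e \<le> 1 \<longrightarrow> finite F \<longrightarrow> (\<forall>n\<in>F. \<not> prime n) \<longrightarrow> (\<Sum>n\<in>F. wgt m e n) \<le> C * (16 * e) ^ m"
proof -
  obtain C where C: "C \<ge> 0" "\<And>F. finite F \<Longrightarrow> F \<subseteq> {n. primepow n \<and> \<not> prime n} \<Longrightarrow> (\<Sum>n\<in>F. real n powr (-7/8)) \<le> (C::real)"
    using proper_prime_power_sum by blast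
  have "(\<Sum>n\<in>F. wgt m e n) \<le> (16 * C) * (16 * e) ^ m"
    if e: "0 < e" "e \<le> 1" and F: "finite F" "\<forall>n\<in>F. \<not> prime n" for m e F
  proof -
    define G where "G = {n\<in>F. primepow n}"
    have G: "finite G" "G \<subseteq> {n. primepow n \<and> \<not> prime n}" using F by (auto simp: G_def)
    have "(\<Sum>n\<in>F. wgt m e n) = (\<Sum>n\<in>G. wgt m e n)"
      unfolding G_def using F by (intro sum.mono_neutral_right) (auto simp: wgt_def mangoldt_def)
    also have "\<dots> \<le> (\<Sum>n\<in>G. (16 * (16 * e) ^ m) * real n powr (-7/8))"
    proof (rule sum_mono)
      fix n assume n: "n \<in> G"
      then have n0: "real n \<ge> 1" using G primepow_gt_0_nat by fastforce
      have "mangoldt n \<le> ln (real n)" using n0 by (intro mangoldt_le) auto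
      also have "\<dots> \<le> 16 * real n powr (1/16)" using ln_pow_fact_le[of "real n" "1/16" 1] n0 by simp
      finally have 1: "mangoldt n \<le> 16 * real n powr (1/16)" .
      have "lnpow m (1 + e) (real n) \<le> 16 ^ m * real n powr (1/16 - (1 + e))"
        using lnpow_le[of "real n" "1/16" m "1 + e"] n0 by simp
      also have "real n powr (1/16 - (1 + e)) \<le> real n powr (-15/16)" using n0 e by (intro powr_mono) auto
      finally have 2: "lnpow m (1 + e) (real n) \<le> 16 ^ m * real n powr (-15/16)" by simp
      have "mangoldt n * lnpow m (1 + e) (real n) \<le> (16 * real n powr (1/16)) * (16 ^ m * real n powr (-15/16))"
        using 1 2 by (intro mult_mono) auto
      also have "\<dots> = 16 * 16 ^ m * (real n powr (1/16) * real n powr (-15/16))" by (simp only: mult_ac)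
      also have "real n powr (1/16) * real n powr (-15/16) = real n powr (-7/8)" by (simp flip: powr_add)
      finally have "e ^ Suc m * (mangoldt n * lnpow m (1 + e) (real n)) \<le> e ^ Suc m * (16 * 16 ^ m * real n powr (-7/8))"
        using e by (intro mult_left_mono) auto
      also have "\<dots> \<le> e ^ m * (16 * 16 ^ m * real n powr (-7/8))"
        using e by (intro mult_right_mono power_decreasing) auto
      finally show "wgt m e n \<le> (16 * (16 * e) ^ m) * real n powr (-7/8)"
        by (simp add: wgt_def power_mult_distrib mult_ac)
    qed
    also have "\<dots> = (16 * (16 * e) ^ m) * (\<Sum>n\<in>G. real n powr (-7/8))" by (simp only: sum_distrib_left)
    also have "\<dots> \<le> (16 * (16 * e) ^ m) * C" using e C(2)[OF G] by (intro mult_left_mono) auto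
    finally show ?thesis by (simp add: mult_ac)
  qed
  then show ?thesis using C(1) by (intro exI[of _ "16 * C"]) auto
qed

definition pwindow :: "nat \<Rightarrow> real \<Rightarrow> real \<Rightarrow> nat set" where
  "pwindow m e d = {q. prime q \<and> \<bar>ln (real q) - real m / e\<bar> \<le> d * (real m / e)}"

lemma finite_pwindow: "finite (pwindow m e d)"
proof (rule finite_subset)
  show "pwindow m e d \<subseteq> {..nat \<lfloor>exp ((1 + d) * (real m / e))\<rfloor>}"
  proof
    fix q assume q: "q \<in> pwindow m e d"
    then have q0: "real q > 0" using prime_gt_0_nat by (auto simp: pwindow_def)
    have "ln (real q) \<le> (1 + d) * X" if "\<bar>ln (real q) - X\<bar> \<le> d * X" for X
      using that by (simp add: distrib_right abs_le_iff)
    then have "ln (real q) \<le> (1 + d) * (real m / e)" using q by (simp only: pwindow_def mem_Collect_eq)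
    then have "real q \<le> exp ((1 + d) * (real m / e))" using q0 by (metis exp_le_cancel_iff exp_ln)
    then show "q \<in> {..nat \<lfloor>exp ((1 + d) * (real m / e))\<rfloor>}" by (simp add: le_nat_floor)
  qed
qed simp

text \<open>The bound \<open>out\<close> speaks of finite sets so that it applies to every partial
  sum of the series, from which the window is removed before passing to the limit.\<close>

lemma pwindow_sum_approx:
  assumes bd: "\<And>n. \<bar>f n\<bar> \<le> 1" and e: "0 < e"
    and out: "\<And>F. finite F \<Longrightarrow> F \<inter> pwindow m e d = {} \<Longrightarrow> (\<Sum>n\<in>F. wgt m e n) \<le> B"
  shows "\<bar>e ^ Suc m * mser f m (1 + e) - (\<Sum>q\<in>pwindow m e d. wgt m e q * f q)\<bar> \<le> B"
proof -
  define W where "W = pwindow m e d"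
  have finW: "finite W" unfolding W_def by (rule finite_pwindow)
  have "(\<lambda>n. mangoldt n * f n * lnpow m (1 + e) (real n)) sums mser f m (1 + e)"
    unfolding mser_def using e by (intro summable_sums summable_mser bd) auto
  then have "(\<lambda>n. e ^ Suc m * (mangoldt n * f n * lnpow m (1 + e) (real n))) sums (e ^ Suc m * mser f m (1 + e))"
    by (rule sums_mult)
  then have "(\<lambda>n. wgt m e n * f n) sums (e ^ Suc m * mser f m (1 + e))"
    by (simp add: wgt_def mult_ac)
  then have l: "(\<lambda>N. \<Sum>n<N. wgt m e n * f n) \<longlonglongrightarrow> e ^ Suc m * mser f m (1 + e)" by (simp add: sums_def)
  then have l: "(\<lambda>N. \<bar>(\<Sum>n<N. wgt m e n * f n) - (\<Sum>q\<in>W. wgt m e q * f q)\<bar>)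
     \<longlonglongrightarrow> \<bar>e ^ Suc m * mser f m (1 + e) - (\<Sum>q\<in>W. wgt m e q * f q)\<bar>"
    by (intro tendsto_intros)
  obtain N0 where N0: "W \<subseteq> {..<N0}" using finite_nat_bounded[OF finW] by blast
  have "\<bar>e ^ Suc m * mser f m (1 + e) - (\<Sum>q\<in>W. wgt m e q * f q)\<bar> \<le> B"
  proof (rule LIMSEQ_le_const2[OF l], intro exI[of _ N0] allI impI)
    fix N assume "N0 \<le> N"
    then have sub: "W \<subseteq> {..<N}" using N0 by auto
    have "(\<Sum>n<N. wgt m e n * f n) - (\<Sum>q\<in>W. wgt m e q * f q) = (\<Sum>n\<in>{..<N} - W. wgt m e n * f n)"
      by (rule sum_diff[symmetric]) (use sub in auto)
    also have "\<bar>\<dots>\<bar> \<le> (\<Sum>n\<in>{..<N} - W. wgt m e n)"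
    proof (rule order_trans[OF sum_abs], rule sum_mono)
      fix n
      have "wgt m e n * \<bar>f n\<bar> \<le> wgt m e n * 1" using bd wgt_nonneg[OF e] by (intro mult_left_mono) auto
      then show "\<bar>wgt m e n * f n\<bar> \<le> wgt m e n" using wgt_nonneg[OF e] by (simp add: abs_mult)
    qed
    also have "\<dots> \<le> B" by (rule out) (auto simp: W_def)
    finally show "\<bar>(\<Sum>n<N. wgt m e n * f n) - (\<Sum>q\<in>W. wgt m e q * f q)\<bar> \<le> B" .
  qed
  then show ?thesis by (simp add: W_def)
qed

lemma window_error_eventually:
  fixes b C :: real
  assumes "b > 0"
  shows "\<forall>\<^sub>F y in sequentially. exp 2 * exp (- (b * real y ^ 2)) * (real y ^ 2 + 144) + C * (1/2) ^ (y ^ 2) + (1/2) ^ (y ^ 2) \<le> (1/4) ^ y"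
proof -
  have A: "((\<lambda>y. exp (- (b * y ^ 2)) * (y ^ 2 + 144) * exp (c * y)) \<longlongrightarrow> (0::real)) at_top" if "b > 0" "c > 0" for b c :: real
    using that by real_asymp
  have B: "((\<lambda>y. exp (- (b * y ^ 2)) * exp (c * y)) \<longlongrightarrow> (0::real)) at_top" if "b > 0" "c > 0" for b c :: real
    using that by real_asymp
  have "((\<lambda>y. exp 2 * (exp (- (b * y ^ 2)) * (y ^ 2 + 144) * exp (ln 4 * y)) + (C + 1) * (exp (- (ln 2 * y ^ 2)) * exp (ln 4 * y)))
     \<longlongrightarrow> exp 2 * 0 + (C + 1) * 0) at_top"
    using assms by (intro tendsto_add tendsto_mult tendsto_const A B) auto
  then have 1: "((\<lambda>y. (exp 2 * exp (- (b * y ^ 2)) * (y ^ 2 + 144) + (C + 1) * exp (- (ln 2 * y ^ 2))) * exp (ln 4 * y)) \<longlongrightarrow> (0::real)) at_top"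
    by (simp add: algebra_simps)
  have 2: "((\<lambda>y::nat. (exp 2 * exp (- (b * real y ^ 2)) * (real y ^ 2 + 144) + (C + 1) * exp (- (ln 2 * real y ^ 2))) * exp (ln 4 * real y)) \<longlongrightarrow> (0::real)) sequentially"
    by (rule filterlim_compose[OF 1 filterlim_real_sequentially])
  have "\<forall>\<^sub>F y::nat in sequentially. (exp 2 * exp (- (b * real y ^ 2)) * (real y ^ 2 + 144) + (C + 1) * exp (- (ln 2 * real y ^ 2))) * exp (ln 4 * real y) < 1"
    using 2 by (rule order_tendstoD) simp
  then show ?thesis
  proof eventually_elim
    case (elim y)
    have half: "exp (- (ln 2 * real y ^ 2)) = (1/2::real) ^ (y ^ 2)"
    proof -
      have "exp (- (ln 2 * real y ^ 2)) = exp (real (y ^ 2) * (- ln 2))" by (simp add: mult.commute)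
      also have "\<dots> = exp (- ln 2) ^ (y ^ 2)" by (rule exp_of_nat_mult)
      also have "exp (- ln 2) = (1/2::real)" by (simp add: exp_minus)
      finally show ?thesis .
    qed
    have four: "exp (ln 4 * real y) = (4::real) ^ y"
      using exp_of_nat_mult[of y "ln (4::real)"] by (simp add: mult.commute)
    have "(exp 2 * exp (- (b * real y ^ 2)) * (real y ^ 2 + 144) + (C + 1) * (1/2) ^ (y ^ 2)) * 4 ^ y \<le> 1"
      using elim unfolding half four by simp
    then have "exp 2 * exp (- (b * real y ^ 2)) * (real y ^ 2 + 144) + (C + 1) * (1/2) ^ (y ^ 2) \<le> 1 / 4 ^ y"
      by (simp add: pos_le_divide_eq)
    then show ?case by (simp add: power_one_over algebra_simps add_divide_distrib)
  qed
qed

text \<open>The main term comes from the pole of \<zeta>, the cancellation from the factor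
  \<open>2 ^ (-m)\<close> gained at good scales. The target is \<open>(1/4) ^ y\<close> because up
  to \<open>2 ^ y\<close> characters will be summed and a factor \<open>(1/2) ^ y\<close> must
  remain.\<close>

theorem pwindow_sums:
  assumes d: "0 < d" "d \<le> 1/2"
  shows "\<forall>\<^sub>F y in sequentially. good_scale y \<longrightarrow>
    \<bar>1 - (\<Sum>q\<in>pwindow (y ^ 2) (1 / real y ^ 12) d. wgt (y ^ 2) (1 / real y ^ 12) q)\<bar> \<le> (1/4) ^ y \<and>
    (\<forall>S\<in>qfam y. \<bar>\<Sum>q\<in>pwindow (y ^ 2) (1 / real y ^ 12) d. wgt (y ^ 2) (1 / real y ^ 12) q * qprod S q\<bar> \<le> (1/4) ^ y)"
proof -
  define k where "k = max ((1 - d) * exp d) ((1 + d) * exp (-d))"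
  have k: "0 < k" "k < 1" using window_rate_less_1[OF d] by (simp_all add: k_def)
  define b where "b = - ln k"
  have b: "b > 0" using k by (simp add: b_def)
  obtain C where C: "C \<ge> 0" "\<And>m e F. 0 < e \<Longrightarrow> e \<le> 1 \<Longrightarrow> finite F \<Longrightarrow> \<forall>n\<in>F. \<not> prime n \<Longrightarrow> (\<Sum>n\<in>F. wgt m e n) \<le> C * (16 * e) ^ m"
    using wgt_prime_power_sum by blast
  have "\<forall>\<^sub>F y in sequentially. 3 / d \<le> real y"
    by (rule eventually_sequentiallyI[of "nat \<lceil>3 / d\<rceil>"]) linarith
  moreover have "\<forall>\<^sub>F y in sequentially. (2::nat) \<le> y" by (rule eventually_ge_at_top)
  moreover note window_error_eventually[OF b, of C]
  ultimately show ?thesis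
  proof eventually_elim
    case (elim y)
    define m where "m = y ^ 2"
    define e where "e = 1 / real y ^ 12"
    define E where "E = exp 2 * k ^ m * (real m + 144) + C * (1/2) ^ m"
    have y2: "real y \<ge> 2" using elim by simp
    have "(2::real) ^ 12 \<le> real y ^ 12" using y2 by (intro power_mono) auto
    then have y12: "4096 \<le> real y ^ 12" by simp
    have e: "0 < e" "e \<le> 1/4096" unfolding e_def using y12 y2 by (simp, intro inverse_le_inverse) auto
    have mpos: "m > 0" "real m \<ge> 3 / d"
    proof -
      show "m > 0" using elim by (simp add: m_def)
      have "real y * 1 \<le> real y * real y" using y2 by (intro mult_left_mono) auto
      then show "real m \<ge> 3 / d" using elim(1) by (simp add: m_def power2_eq_square)
    qed
    have km: "k ^ m = exp (- (b * real y ^ 2))"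
    proof -
      have "k ^ m = exp (ln k) ^ m" using k by simp
      also have "\<dots> = exp (real m * ln k)" by (rule exp_of_nat_mult[symmetric])
      finally show ?thesis by (simp add: b_def m_def mult.commute)
    qed
    have small: "E + (1/2) ^ m \<le> (1/4) ^ y" using elim(3) unfolding E_def km by (simp add: m_def)
    have out: "(\<Sum>n\<in>F. wgt m e n) \<le> E" if F: "finite F" "F \<inter> pwindow m e d = {}" for F
    proof -
      \<comment> \<open>\<open>F\<close> avoids the primes of the window, so its part outside
        \<open>outer_window m e d\<close> contains no primes at all.\<close>
      have "F = (F \<inter> outer_window m e d) \<union> (F - outer_window m e d)" by auto
      then have "(\<Sum>n\<in>F. wgt m e n) = (\<Sum>n\<in>F \<inter> outer_window m e d. wgt m e n) + (\<Sum>n\<in>F - outer_window m e d. wgt m e n)"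
        using F(1) by (subst sum.union_disjoint[symmetric]) auto
      moreover have "(\<Sum>n\<in>F \<inter> outer_window m e d. wgt m e n) \<le> exp 2 * k ^ m * (real m + 144)"
        unfolding k_def using mpos d e F by (intro wgt_outer_sum) auto
      moreover have "(\<Sum>n\<in>F - outer_window m e d. wgt m e n) \<le> C * (16 * e) ^ m"
        using e F by (intro C(2)) (auto simp: outer_window_def pwindow_def not_less)
      moreover have "C * (16 * e) ^ m \<le> C * (1/2) ^ m" using e C(1) by (intro mult_left_mono power_mono) auto
      ultimately show ?thesis by (simp add: E_def)
    qed
    show ?case unfolding m_def[symmetric] e_def[symmetric]
    proof (intro impI conjI ballI)
      assume good: "good_scale y"
      have "\<bar>e ^ Suc m * mser (\<lambda>_. 1) m (1 + e) - (\<Sum>q\<in>pwindow m e d. wgt m e q * 1)\<bar> \<le> E"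
        using e(1) by (intro pwindow_sum_approx out) auto
      moreover have "\<bar>e ^ Suc m * mser (\<lambda>_. 1) m (1 + e) - 1\<bar> \<le> (1/2) ^ m"
      proof -
        have "e ^ Suc m * mser (\<lambda>_. 1) m (1 + e) - 1 = e ^ Suc m * (mser (\<lambda>_. 1) m (1 + e) - (1/e) ^ Suc m)"
          using e by (simp add: right_diff_distrib power_one_over del: power_Suc)
        also have "\<bar>\<dots>\<bar> \<le> e ^ Suc m * 144 ^ Suc m"
          unfolding abs_mult using e by (intro mult_mono mser_zeta) auto
        also have "\<dots> = (e * 144) ^ Suc m" by (simp only: power_mult_distrib)
        also have "\<dots> \<le> (1/2) ^ Suc m" using e by (intro power_mono) auto
        also have "\<dots> \<le> (1/2) ^ m" by (intro power_decreasing) auto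
        finally show ?thesis .
      qed
      ultimately show "\<bar>1 - (\<Sum>q\<in>pwindow m e d. wgt m e q)\<bar> \<le> (1/4) ^ y" using small by simp
    next
      fix S assume good: "good_scale y" and S: "S \<in> qfam y"
      have f: "rmult (qprod S)" using S by (intro rmult_qprod) (auto simp: qfam_def)
      have "\<bar>e ^ Suc m * mser (qprod S) m (1 + e) - (\<Sum>q\<in>pwindow m e d. wgt m e q * qprod S q)\<bar> \<le> E"
        using e(1) by (intro pwindow_sum_approx out rmult_abs f) auto
      moreover have "\<bar>e ^ Suc m * mser (qprod S) m (1 + e)\<bar> \<le> (1/2) ^ m"
      proof -
        have "\<bar>e ^ Suc m * mser (qprod S) m (1 + e)\<bar> \<le> e ^ Suc m * (real y ^ 12 / 2) ^ Suc m"
          unfolding abs_mult using e good_scale_mser[OF good _ S, of m] elim(2) by (intro mult_mono) (auto simp: e_def)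
        also have "\<dots> = (e * (real y ^ 12 / 2)) ^ Suc m" by (simp only: power_mult_distrib)
        also have "e * (real y ^ 12 / 2) = 1/2" using y2 by (simp add: e_def)
        also have "(1/2::real) ^ Suc m \<le> (1/2) ^ m" by (intro power_decreasing) auto
        finally show ?thesis .
      qed
      ultimately show "\<bar>\<Sum>q\<in>pwindow m e d. wgt m e q * qprod S q\<bar> \<le> (1/4) ^ y" using small by linarith
    qed
  qed
qed

section \<open>Detecting primes with prescribed residues\<close>

lemma qprod_expand:
  assumes "finite I"
  shows "(\<Prod>i\<in>I. 1 + qchar i n) = (\<Sum>S\<in>Pow I. qprod S n)"
  using assms
proof (induction I rule: finite_induct)
  case empty
  then show ?case by (simp add: qprod_def)
next
  case (insert i I)
  have "(\<Sum>S\<in>Pow (insert i I). qprod S n) = (\<Sum>S\<in>Pow I. qprod S n) + (\<Sum>S\<in>insert i ` Pow I. qprod S n)"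
    unfolding Pow_insert using insert by (intro sum.union_disjoint) auto
  also have "(\<Sum>S\<in>insert i ` Pow I. qprod S n) = (\<Sum>S\<in>Pow I. qprod (insert i S) n)"
    using insert by (subst sum.reindex) (auto simp: inj_on_def)
  also have "\<dots> = (\<Sum>S\<in>Pow I. qchar i n * qprod S n)"
  proof (intro sum.cong refl)
    fix S assume "S \<in> Pow I"
    then have "finite S" "i \<notin> S" using insert finite_subset by auto
    then show "qprod (insert i S) n = qchar i n * qprod S n" by (simp add: qprod_def)
  qed
  also have "\<dots> = qchar i n * (\<Sum>S\<in>Pow I. qprod S n)" by (simp only: sum_distrib_left)
  finally show ?case using insert by (simp add: algebra_simps)
qed

definition index_set :: "nat \<Rightarrow> nat set" where
  "index_set y = insert 1 {p. prime p \<and> p \<le> y}"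

lemma index_set:
  assumes "y \<ge> 2"
  shows "finite (index_set y)" "\<forall>p\<in>index_set y. qindex p" "index_set y \<subseteq> {1..y}" "card (index_set y) \<le> y" "qmod (index_set y) \<le> 8 * y ^ y"
proof -
  show fin: "finite (index_set y)" by (simp add: index_set_def)
  show "\<forall>p\<in>index_set y. qindex p" by (auto simp: index_set_def qindex_def)
  show sub: "index_set y \<subseteq> {1..y}" using assms prime_ge_1_nat by (auto simp: index_set_def)
  show c: "card (index_set y) \<le> y" using card_mono[OF _ sub] by simp
  have "\<Prod>(index_set y) \<le> (\<Prod>p\<in>index_set y. y)" using sub by (intro prod_mono) auto
  also have "\<dots> = y ^ card (index_set y)" by simp
  also have "\<dots> \<le> y ^ y" using assms c by (intro power_increasing) auto
  finally show "qmod (index_set y) \<le> 8 * y ^ y" by (simp add: qmod_def)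
qed

lemma weight_nonneg:
  assumes "\<forall>p\<in>I. qindex p" shows "(\<Prod>i\<in>I. 1 + qchar i n) \<ge> 0"
proof (rule prod_nonneg)
  fix i assume "i \<in> I"
  then have "\<bar>qchar i n\<bar> \<le> 1" using assms rmult_abs rmult_qchar by blast
  then show "0 \<le> 1 + qchar i n" by (simp add: abs_le_iff)
qed

text \<open>The residue \<open>7\<close> is excluded by the character modulo \<open>4\<close>, which
  is why the index \<open>1\<close> belongs to \<open>index_set\<close>; \<open>3\<close> and
  \<open>5\<close> are excluded by the one modulo \<open>8\<close>.\<close>

lemma weight_nonzero_mod_8:
  assumes "y \<ge> 2" "prime q" "q > 2" "(\<Prod>i\<in>index_set y. 1 + qchar i q) \<noteq> 0"
  shows "q mod 8 = 1"
proof -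
  have "1 + qchar 1 q \<noteq> 0" "1 + qchar 2 q \<noteq> 0"
    using assms index_set(1)[OF assms(1)] two_is_prime_nat by (auto simp: index_set_def prod_zero_iff)
  then have c: "q mod 4 \<noteq> 3" "q mod 8 \<noteq> 3" "q mod 8 \<noteq> 5" by (auto simp: qchar_def chi4_def chi8_def)
  have "odd q" using assms prime_odd_nat by auto
  then show ?thesis using c by presburger
qed

lemma coprime_qmod_of_large_prime:
  assumes "prime q" "q > 2" "finite S" "\<forall>p\<in>S. qindex p \<and> p < q"
  shows "coprime q (qmod S)"
proof -
  have "coprime q (\<Prod>S)"
  proof (rule prod_coprime_right)
    fix p assume "p \<in> S"
    then have "p = 1 \<or> prime p" "p < q" using assms by (auto simp: qindex_def)
    then show "coprime q p" using assms primes_coprime[of q p] by auto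
  qed
  moreover have "coprime q 8"
  proof -
    have "odd q" using assms prime_odd_nat by auto
    then have "coprime q (2 ^ 3)" unfolding coprime_power_right_iff by simp
    then show ?thesis by simp
  qed
  ultimately show ?thesis by (simp add: qmod_def)
qed

text \<open>Averaging over the primes of the window with the nonnegative weight \<open>\<Prod>(1 + \<psi>\<^sub>i(q))\<close>, which
  selects \<open>q \<equiv> 1 (mod 8)\<close> and quadratic residues \<open>p \<le> y\<close> and expands into characters. Only those
  \<open>k\<close> whose squarefree part is \<open>y\<close>-smooth contribute a main term.\<close>

lemma biased_prime_in_window:
  fixes a v :: "nat \<Rightarrow> real"
  assumes y: "y \<ge> 2" and W: "finite W" "\<And>q. q \<in> W \<Longrightarrow> prime q \<and> q > N \<and> q > y"
    and a: "\<And>q. a q \<ge> 0" and E: "E \<ge> 0"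
    and H1: "\<bar>1 - (\<Sum>q\<in>W. a q)\<bar> \<le> E" and H2: "\<And>S. S \<in> qfam y \<Longrightarrow> \<bar>\<Sum>q\<in>W. a q * qprod S q\<bar> \<le> E"
    and v: "\<And>k. 0 \<le> v k \<and> v k \<le> 1" and N: "8 * real y ^ y * (8 * real N) \<le> exp (real y ^ 2)" "N \<ge> 1"
    and M: "M = (\<Sum>k | k \<in> {1..N} \<and> odd_part k \<subseteq> index_set y. v k)"
    and B: "B \<ge> 0" "(1 - E) * M - 2 ^ y * E * real N > B * (1 + E + 2 ^ y * E)"
  shows "\<exists>q\<in>W. q mod 8 = 1 \<and> (\<Sum>k=1..N. v k * legendre_char q (int k)) \<ge> B"
proof (rule ccontr)
  assume "\<not> ?thesis"
  then have neg: "(\<Sum>k=1..N. v k * legendre_char q (int k)) < B" if "q \<in> W" "q mod 8 = 1" for q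
    using that by (meson not_le)
  define I where "I = index_set y"
  note I = index_set[OF y, folded I_def]
  define w where "w = (\<lambda>q. \<Prod>i\<in>I. 1 + qchar i q)"
  define F where "F = (\<lambda>q. \<Sum>k=1..N. v k * qprod (odd_part k) q)"
  have w0: "w q \<ge> 0" for q unfolding w_def using I(2) by (rule weight_nonneg)
  \<comment> \<open>Multiplication by the character of \<open>k\<close> must not leave the family;
    the modulus bound \<open>exp (y^2)\<close> is made to accommodate it.\<close>
  have fam: "U \<in> qfam y" if "U \<noteq> {}" "U \<subseteq> I \<union> odd_part k" "k \<in> {1..N}" for U k
  proof -
    have fin: "finite (I \<union> odd_part k)" "\<forall>p\<in>I \<union> odd_part k. qindex p" using I odd_part by auto
    have "qmod U \<le> qmod (I \<union> odd_part k)" using fin that by (intro qmod_mono)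
    also have "\<dots> \<le> qmod I * qmod (odd_part k)" using fin by (intro qmod_union_le) auto
    also have "\<dots> \<le> (8 * y ^ y) * (8 * N)"
      using I(5) odd_part_prod_le[of k] that by (intro mult_mono) (auto simp: qmod_def)
    finally have "real (qmod U) \<le> real ((8 * y ^ y) * (8 * N))" by (simp only: of_nat_le_iff)
    also have "\<dots> \<le> exp (real y ^ 2)" using N by simp
    finally show ?thesis unfolding qfam_def using that fin finite_subset[OF that(2) fin(1)] by auto
  qed
  have famI: "S \<in> qfam y" if "S \<noteq> {}" "S \<subseteq> I" for S
    using fam[of S 1] that N(2) by auto
  have cardP: "real (card (Pow I)) \<le> 2 ^ y"
    using I power_increasing[of "card I" y "2::real"] by (simp add: card_Pow)
  have lower: "(\<Sum>q\<in>W. a q * w q * F q) \<ge> (1 - E) * M - 2 ^ y * E * real N"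
  proof -
    have "(\<Sum>q\<in>W. a q * w q * F q) = (\<Sum>q\<in>W. \<Sum>k=1..N. \<Sum>S\<in>Pow I. v k * (a q * qprod ((S - odd_part k) \<union> (odd_part k - S)) q))"
    proof (rule sum.cong[OF refl])
      fix q assume q: "q \<in> W"
      have q': "prime q" "q > 2" "q > N" "q > y" using W(2)[OF q] y by auto
      have "w q = (\<Sum>S\<in>Pow I. qprod S q)" unfolding w_def using I(1) by (rule qprod_expand)
      then have "a q * w q * F q = (\<Sum>k=1..N. \<Sum>S\<in>Pow I. a q * (qprod S q * (v k * qprod (odd_part k) q)))"
        by (simp add: F_def sum_distrib_left sum_distrib_right mult.assoc)
      also have "\<dots> = (\<Sum>k=1..N. \<Sum>S\<in>Pow I. v k * (a q * qprod ((S - odd_part k) \<union> (odd_part k - S)) q))"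
      proof (intro sum.cong refl)
        fix k S assume k: "k \<in> {1..N}" and S: "S \<in> Pow I"
        have finS: "finite S" using S I(1) finite_subset by auto
        have "coprime q (qmod (S \<inter> odd_part k))"
        proof (rule coprime_qmod_of_large_prime[OF q'(1,2)])
          show "\<forall>p\<in>S \<inter> odd_part k. qindex p \<and> p < q"
          proof
            fix p assume "p \<in> S \<inter> odd_part k"
            then have "p \<in> I" using S by blast
            then have "qindex p" "p \<le> y" using I(2,3) by auto
            then show "qindex p \<and> p < q" using q'(4) by simp
          qed
        qed (use finS in auto)
        then have "(qprod (S \<inter> odd_part k) q)\<^sup>2 = 1"
          using finS odd_part by (intro qprod_coprime_square) auto
        then have eq: "qprod S q * qprod (odd_part k) q = qprod ((S - odd_part k) \<union> (odd_part k - S)) q"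
          by (simp add: qprod_mult[OF finS odd_part(1)])
        show "a q * (qprod S q * (v k * qprod (odd_part k) q)) = v k * (a q * qprod ((S - odd_part k) \<union> (odd_part k - S)) q)"
        proof -
          have "a q * (qprod S q * (v k * qprod (odd_part k) q)) = v k * (a q * (qprod S q * qprod (odd_part k) q))"
            by (simp only: mult_ac)
          then show ?thesis by (simp only: eq)
        qed
      qed
      finally show "a q * w q * F q = (\<Sum>k=1..N. \<Sum>S\<in>Pow I. v k * (a q * qprod ((S - odd_part k) \<union> (odd_part k - S)) q))" .
    qed
    also have "\<dots> = (\<Sum>k=1..N. \<Sum>S\<in>Pow I. v k * (\<Sum>q\<in>W. a q * qprod ((S - odd_part k) \<union> (odd_part k - S)) q))"
      unfolding sum_distrib_left by (subst sum.swap, rule sum.cong[OF refl], rule sum.swap)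
    also have "\<dots> \<ge> (\<Sum>k=1..N. (if odd_part k \<subseteq> I then v k * (1 - E) else 0) - 2 ^ y * E)"
    proof (rule sum_mono)
      fix k assume k: "k \<in> {1..N}"
      define G where "G = (\<lambda>S. v k * (\<Sum>q\<in>W. a q * qprod ((S - odd_part k) \<union> (odd_part k - S)) q))"
      \<comment> \<open>A nonempty symmetric difference belongs to the family and averages out. For
        \<open>S = odd_part k\<close> the product is \<open>qprod {} = 1\<close>, and the sum is the
        total mass of the window.\<close>
      have small: "G S \<ge> - E" if S: "S \<in> Pow I" "S \<noteq> odd_part k" for S
      proof -
        have "(S - odd_part k) \<union> (odd_part k - S) \<in> qfam y"
          by (rule fam[OF _ _ k]) (use S in auto)
        then have "\<bar>\<Sum>q\<in>W. a q * qprod ((S - odd_part k) \<union> (odd_part k - S)) q\<bar> \<le> E" by (rule H2)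
        then have "\<bar>G S\<bar> \<le> 1 * E" unfolding G_def abs_mult using v[of k] by (intro mult_mono) auto
        then show ?thesis by simp
      qed
      have cnt: "(\<Sum>S\<in>Pow I - X. - E) \<ge> - (2 ^ y * E)" for X
      proof -
        have "real (card (Pow I - X)) \<le> real (card (Pow I))"
          using I(1) by (intro of_nat_mono card_mono) auto
        then have "real (card (Pow I - X)) * E \<le> 2 ^ y * E" using cardP E by (intro mult_right_mono) auto
        then show ?thesis by simp
      qed
      show "(if odd_part k \<subseteq> I then v k * (1 - E) else 0) - 2 ^ y * E \<le> (\<Sum>S\<in>Pow I. G S)"
      proof (cases "odd_part k \<subseteq> I")
        case True
        have "(\<Sum>S\<in>Pow I. G S) = G (odd_part k) + (\<Sum>S\<in>Pow I - {odd_part k}. G S)"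
          using True I(1) by (intro sum.remove) auto
        moreover have "(\<Sum>S\<in>Pow I - {odd_part k}. - E) \<le> (\<Sum>S\<in>Pow I - {odd_part k}. G S)"
          by (intro sum_mono small) auto
        moreover have "G (odd_part k) \<ge> v k * (1 - E)"
          unfolding G_def using v[of k] H1 by (intro mult_left_mono) (auto simp: qprod_def)
        ultimately show ?thesis using True cnt[of "{odd_part k}"] by simp
      next
        case False
        have "(\<Sum>S\<in>Pow I - {}. - E) \<le> (\<Sum>S\<in>Pow I - {}. G S)" using False by (intro sum_mono small) auto
        then show ?thesis using False cnt[of "{}"] by simp
      qed
    qed
    also have "(\<Sum>k=1..N. (if odd_part k \<subseteq> I then v k * (1 - E) else 0) - 2 ^ y * E) = (1 - E) * M - 2 ^ y * E * real N"
    proof -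
      have "(\<Sum>k=1..N. if odd_part k \<subseteq> I then v k * (1 - E) else 0) = (\<Sum>k | k \<in> {1..N} \<and> odd_part k \<subseteq> I. v k * (1 - E))"
        by (rule sum.inter_filter[symmetric]) simp
      also have "\<dots> = (1 - E) * M" unfolding M I_def by (simp add: sum_distrib_left mult.commute)
      finally show ?thesis by (simp add: sum_subtractf)
    qed
    finally show ?thesis .
  qed
  \<comment> \<open>Where \<open>w q\<close> is nonzero, \<open>q \<equiv> 1\<close> modulo
    \<open>8\<close>, so \<open>F q\<close> is the true Legendre sum and lies below \<open>B\<close>
    by the assumption to be refuted.\<close>
  have "(\<Sum>q\<in>W. a q * w q * F q) \<le> (\<Sum>q\<in>W. a q * w q * B)"
  proof (rule sum_mono)
    fix q assume q: "q \<in> W"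
    have q': "prime q" "q > 2" "q > N" using W(2)[OF q] y by auto
    show "a q * w q * F q \<le> a q * w q * B"
    proof (cases "w q = 0")
      case False
      then have m8: "q mod 8 = 1" using weight_nonzero_mod_8[OF y q'(1,2)] by (simp add: w_def I_def)
      have "F q = (\<Sum>k=1..N. v k * legendre_char q (int k))"
        unfolding F_def using legendre_char_eq_qprod[OF q'(1) m8] q'(3) by (intro sum.cong refl) auto
      then have "F q \<le> B" using neg[OF q m8] by simp
      then show ?thesis using a[of q] w0[of q] by (intro mult_left_mono) auto
    qed simp
  qed
  also have "\<dots> = B * (\<Sum>q\<in>W. a q * w q)" by (simp only: sum_distrib_left mult.commute)
  also have "\<dots> \<le> B * (1 + E + 2 ^ y * E)"
  proof (rule mult_left_mono[OF _ B(1)])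
    have "(\<Sum>q\<in>W. a q * w q) = (\<Sum>q\<in>W. \<Sum>S\<in>Pow I. a q * qprod S q)"
      unfolding w_def qprod_expand[OF I(1)] by (simp add: sum_distrib_left)
    also have "\<dots> = (\<Sum>S\<in>Pow I. \<Sum>q\<in>W. a q * qprod S q)" by (rule sum.swap)
    also have "\<dots> = (\<Sum>q\<in>W. a q * qprod {} q) + (\<Sum>S\<in>Pow I - {{}}. \<Sum>q\<in>W. a q * qprod S q)"
      using I(1) by (intro sum.remove) auto
    also have "(\<Sum>S\<in>Pow I - {{}}. \<Sum>q\<in>W. a q * qprod S q) \<le> (\<Sum>S\<in>Pow I - {{}}. E)"
    proof (rule sum_mono)
      fix S assume "S \<in> Pow I - {{}}"
      then have "S \<in> qfam y" by (intro famI) auto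
      then show "(\<Sum>q\<in>W. a q * qprod S q) \<le> E" using H2[of S] by simp
    qed
    also have "(\<Sum>S\<in>Pow I - {{}}. E) \<le> 2 ^ y * E"
    proof -
      have "real (card (Pow I - {{}})) \<le> real (card (Pow I))"
        using I(1) by (intro of_nat_mono card_mono) auto
      then have "real (card (Pow I - {{}})) * E \<le> 2 ^ y * E" using cardP E by (intro mult_right_mono) auto
      then show ?thesis by simp
    qed
    also have "(\<Sum>q\<in>W. a q * qprod {} q) \<le> 1 + E" using H1 by (simp add: qprod_def abs_le_iff)
    finally show "(\<Sum>q\<in>W. a q * w q) \<le> 1 + E + 2 ^ y * E" by simp
  qed
  finally show False using lower B(2) by linarith
qed

section \<open>The sinc kernel and primes with a large weighted character sum\<close>

lemma sin_minus_x_cos: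
  fixes x :: real
  assumes "x \<ge> 0"
  shows "\<bar>x * cos x - sin x\<bar> \<le> x\<^sup>2" "x \<le> pi \<Longrightarrow> x * cos x \<le> sin x"
proof -
  have D: "((\<lambda>x. x * cos x - sin x) has_real_derivative - z * sin z) (at z)" for z :: real
    by (auto intro!: derivative_eq_intros)
  show "\<bar>x * cos x - sin x\<bar> \<le> x\<^sup>2"
  proof (cases "x = 0")
    case False
    have "\<exists>z. 0 < z \<and> z < x \<and> (x * cos x - sin x) - (0 * cos 0 - sin 0) = (x - 0) * (- z * sin z)"
      by (rule MVT2) (use False assms D in auto)
    then obtain z where z: "0 < z" "z < x" "x * cos x - sin x = x * (- z * sin z)" by auto
    have "\<bar>x * (- z * sin z)\<bar> = x * (z * \<bar>sin z\<bar>)" using z by (simp add: abs_mult)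
    also have "\<dots> \<le> x * (x * 1)" using z by (intro mult_left_mono mult_mono) auto
    finally show ?thesis using z(3) by (simp add: power2_eq_square)
  qed simp
  assume "x \<le> pi"
  have "x * cos x - sin x \<le> 0 * cos 0 - sin 0"
  proof (rule DERIV_nonpos_imp_nonincreasing[OF assms], goal_cases)
    case (1 z)
    have "- z * sin z \<le> 0" using 1 \<open>x \<le> pi\<close> by (auto intro!: mult_nonneg_nonneg sin_ge_zero)
    then show ?case using D[of z] by blast
  qed
  then show "x * cos x \<le> sin x" by simp
qed

lemma sinc_lipschitz:
  fixes x y :: real
  assumes "0 < x" "0 < y"
  shows "\<bar>sin x / x - sin y / y\<bar> \<le> \<bar>x - y\<bar>"
proof -
  have main: "\<bar>sin v / v - sin u / u\<bar> \<le> v - u" if uv: "0 < u" "u < v" for u v :: real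
  proof -
    have "\<exists>z. u < z \<and> z < v \<and> sin v / v - sin u / u = (v - u) * ((z * cos z - sin z) / z\<^sup>2)"
      by (rule MVT2) (use uv in \<open>auto intro!: derivative_eq_intros simp: field_simps power2_eq_square\<close>)
    then obtain z where z: "u < z" "z < v" "sin v / v - sin u / u = (v - u) * ((z * cos z - sin z) / z\<^sup>2)" by auto
    have "\<bar>(z * cos z - sin z) / z\<^sup>2\<bar> \<le> 1"
      using sin_minus_x_cos(1)[of z] z uv by (simp add: divide_le_eq abs_divide)
    then have "\<bar>v - u\<bar> * \<bar>(z * cos z - sin z) / z\<^sup>2\<bar> \<le> (v - u) * 1" using uv by (intro mult_mono) auto
    then show ?thesis unfolding z(3) abs_mult by simp
  qed
  consider "x < y" | "x = y" | "y < x" by linarith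
  then show ?thesis
  proof cases
    case 1
    then show ?thesis using main[of x y] assms by (simp add: abs_minus_commute)
  next
    case 3
    then show ?thesis using main[of y x] assms by simp
  qed simp
qed

text \<open>The limit shape of the Fejer weights \<open>(cmod (dirichlet_poly q h k) / h)^2\<close>
  at \<open>t = k / K\<close>. At \<open>t = 0\<close> its value is \<open>0\<close>, not the
  continuous \<open>1\<close>; the sums start at \<open>k = 1\<close>.\<close>

definition sinc2 :: "real \<Rightarrow> real" where "sinc2 t = (sin (pi * t) / (pi * t))\<^sup>2"

lemma sinc2: "0 \<le> sinc2 t" "sinc2 t \<le> 1" "0 < t \<Longrightarrow> t \<le> 1/4 \<Longrightarrow> 1/4 \<le> sinc2 t"
proof -
  show "0 \<le> sinc2 t" by (simp add: sinc2_def)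
  have "\<bar>sin (pi * t) / (pi * t)\<bar> \<le> 1"
    using abs_sin_x_le_abs_x[of "pi * t"] by (simp add: abs_divide divide_le_eq_1)
  then show "sinc2 t \<le> 1" unfolding sinc2_def by (simp add: abs_square_le_1)
  assume t: "0 < t" "t \<le> 1/4"
  define x where "x = pi * t"
  have x: "0 < x" "x \<le> pi / 3" using t by (auto simp: x_def)
  have "cos (pi / 3) \<le> cos x" using x by (intro cos_monotone_0_pi_le) auto
  then have "1/2 \<le> cos x" by (simp add: cos_60)
  then have "x * (1/2) \<le> x * cos x" using x by (intro mult_left_mono) auto
  also have "\<dots> \<le> sin x" using x pi_gt_zero by (intro sin_minus_x_cos(2)) auto
  finally have "1/2 \<le> sin x / x" using x by (simp add: field_simps)
  then have "(1/2)\<^sup>2 \<le> (sin x / x)\<^sup>2" by (intro power_mono) auto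
  then show "1/4 \<le> sinc2 t" by (simp add: sinc2_def x_def power2_eq_square)
qed

text \<open>\<open>c\<close> depends on \<open>A\<close> alone and not on \<open>T\<close> or
  \<open>d\<close>, which are later chosen in terms of \<open>c\<close>. The sum is scaled by the
  centre \<open>L\<close> of the window instead of \<open>ln q\<close>: averaging over
  \<open>q\<close> needs one weight and one range of \<open>k\<close> for all primes of the window,
  and \<open>d\<close> measures how far \<open>ln q\<close> is from \<open>L\<close>.\<close>

theorem biased_prime_exists:
  assumes A: "A > 0"
  shows "\<exists>c>0. \<forall>T d Q. T \<ge> 1 \<longrightarrow> 0 < d \<longrightarrow> d \<le> 1/2 \<longrightarrow>
    (\<exists>q L. prime q \<and> q \<ge> Q \<and> q mod 8 = 1 \<and> L > 0 \<and> L \<ge> Q \<and> \<bar>ln (real q) - L\<bar> \<le> d * L \<and>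
      c * L powr A \<le> (\<Sum>k=1..nat \<lfloor>T * L powr A\<rfloor>. sinc2 (real k / L powr A) * legendre_char q (int k)))"
proof -
  \<comment> \<open>The exponent is \<open>14 * A\<close> because
    \<open>L = m / e = y^2 * y^12\<close>, so that \<open>K = L powr A\<close> is
    \<open>y powr (14 * A)\<close>.\<close>
  obtain c where c: "c > 0" "\<And>y x. ln (real y) \<ge> 30000 \<Longrightarrow> 1 \<le> x \<Longrightarrow> x \<le> real y powr (14 * A) \<Longrightarrow> c * x \<le> real (card (smooths y x))"
    using smooths_lower[of "14 * A"] by blast
  have "\<exists>q L. prime q \<and> q \<ge> Q \<and> q mod 8 = 1 \<and> L > 0 \<and> L \<ge> Q \<and> \<bar>ln (real q) - L\<bar> \<le> d * L \<and>
      c / 64 * L powr A \<le> (\<Sum>k=1..nat \<lfloor>T * L powr A\<rfloor>. sinc2 (real k / L powr A) * legendre_char q (int k))"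
    if T: "T \<ge> 1" and d: "0 < d" "d \<le> 1/2" for T d Q
  proof -
    \<comment> \<open>The growth conditions on \<open>y\<close>: \<open>lim1\<close> keeps all
      moduli below \<open>exp (y^2)\<close>, \<open>lim2\<close> puts the primes of the window above
      \<open>N\<close>, \<open>y\<close> and \<open>Q\<close>, and \<open>lim3\<close> makes the
      error \<open>2 ^ y * E * N\<close> negligible.\<close>
    have lim1: "((\<lambda>y. 64 * y powr y * (T * y powr (14 * A)) / exp (y ^ 2)) \<longlongrightarrow> (0::real)) at_top"
      using T A by real_asymp
    have lim2: "((\<lambda>y. (T * y powr (14 * A) + y + real Q) / exp (y ^ 14 / 2)) \<longlongrightarrow> (0::real)) at_top"
      using T A by real_asymp
    have lim3: "((\<lambda>y. exp (- (ln 2 * y)) * (T * (1024 / c))) \<longlongrightarrow> 0) at_top"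
    proof -
      have "((\<lambda>y. exp (- (ln 2 * y))) \<longlongrightarrow> (0::real)) at_top" by real_asymp
      then show ?thesis by (rule tendsto_mult_left_zero)
    qed
    have lim4: "filterlim (\<lambda>y. ln y) at_top (at_top :: real filter)" by real_asymp
    have lim5: "filterlim (\<lambda>y. y powr (14 * A)) at_top (at_top :: real filter)" using A by real_asymp
    have ev1: "\<forall>\<^sub>F y in at_top. 64 * y powr y * (T * y powr (14 * A)) / exp (y ^ 2) < (1::real)"
      using lim1 by (rule order_tendstoD) simp
    have ev2: "\<forall>\<^sub>F y in at_top. (T * y powr (14 * A) + y + real Q) / exp (y ^ 14 / 2) < (1::real)"
      using lim2 by (rule order_tendstoD) simp
    have ev3: "\<forall>\<^sub>F y in at_top. exp (- (ln 2 * y)) * (T * (1024 / c)) < (1::real)"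
      using lim3 by (rule order_tendstoD) simp
    have ev4: "\<forall>\<^sub>F y in at_top. 30000 \<le> ln (y::real)" using lim4 by (simp add: filterlim_at_top)
    have ev5: "\<forall>\<^sub>F y in at_top. 4 \<le> (y::real) powr (14 * A)" using lim5 by (simp add: filterlim_at_top)
    have "\<forall>\<^sub>F y in at_top. 64 * y powr y * (T * y powr (14 * A)) / exp (y ^ 2) < (1::real)
      \<and> (T * y powr (14 * A) + y + real Q) / exp (y ^ 14 / 2) < (1::real)
      \<and> exp (- (ln 2 * y)) * (T * (1024 / c)) < (1::real) \<and> 30000 \<le> ln y \<and> 4 \<le> y powr (14 * A) \<and> y \<ge> 10 \<and> y \<ge> Q"
      using ev1 ev2 ev3 ev4 ev5 eventually_ge_at_top[of "10::real"] eventually_ge_at_top[of "real Q"] by eventually_elim blast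
    from eventually_compose_filterlim[OF this filterlim_real_sequentially] pwindow_sums[OF d]
    have "\<forall>\<^sub>F y::nat in sequentially. (64 * real y powr real y * (T * real y powr (14 * A)) / exp (real y ^ 2) < 1
      \<and> (T * real y powr (14 * A) + real y + real Q) / exp (real y ^ 14 / 2) < 1
      \<and> exp (- (ln 2 * real y)) * (T * (1024 / c)) < 1 \<and> 30000 \<le> ln (real y) \<and> 4 \<le> real y powr (14 * A) \<and> real y \<ge> 10 \<and> real y \<ge> Q) \<and>
      (good_scale y \<longrightarrow>
      \<bar>1 - (\<Sum>q\<in>pwindow (y ^ 2) (1 / real y ^ 12) d. wgt (y ^ 2) (1 / real y ^ 12) q)\<bar> \<le> (1/4) ^ y \<and>
      (\<forall>S\<in>qfam y. \<bar>\<Sum>q\<in>pwindow (y ^ 2) (1 / real y ^ 12) d. wgt (y ^ 2) (1 / real y ^ 12) q * qprod S q\<bar> \<le> (1/4) ^ y))"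
      by (rule eventually_conj)
    then obtain Y0 where Y0: "\<And>y. y \<ge> Y0 \<Longrightarrow> (64 * real y powr real y * (T * real y powr (14 * A)) / exp (real y ^ 2) < 1
      \<and> (T * real y powr (14 * A) + real y + real Q) / exp (real y ^ 14 / 2) < 1
      \<and> exp (- (ln 2 * real y)) * (T * (1024 / c)) < 1 \<and> 30000 \<le> ln (real y) \<and> 4 \<le> real y powr (14 * A) \<and> real y \<ge> 10 \<and> real y \<ge> Q) \<and>
      (good_scale y \<longrightarrow>
      \<bar>1 - (\<Sum>q\<in>pwindow (y ^ 2) (1 / real y ^ 12) d. wgt (y ^ 2) (1 / real y ^ 12) q)\<bar> \<le> (1/4) ^ y \<and>
      (\<forall>S\<in>qfam y. \<bar>\<Sum>q\<in>pwindow (y ^ 2) (1 / real y ^ 12) d. wgt (y ^ 2) (1 / real y ^ 12) q * qprod S q\<bar> \<le> (1/4) ^ y))"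
      unfolding eventually_sequentially by blast
    obtain y where y: "y \<ge> Y0" "good_scale y" using infinitely_many_good_scales by blast
    define Y where "Y = real y"
    have c1: "64 * Y powr Y * (T * Y powr (14 * A)) / exp (Y ^ 2) < 1"
      and c2: "(T * Y powr (14 * A) + Y + real Q) / exp (Y ^ 14 / 2) < 1"
      and c3: "exp (- (ln 2 * Y)) * (T * (1024 / c)) < 1" and c4: "30000 \<le> ln Y" and c5: "4 \<le> Y powr (14 * A)"
      and c6: "Y \<ge> 10" "Y \<ge> Q"
      using Y0[OF y(1)] by (auto simp: Y_def)
    define e where "e = 1 / Y ^ 12"
    define m where "m = y ^ 2"
    define W where "W = pwindow m e d"
    define E where "E = (1/4::real) ^ y"
    have H: "\<bar>1 - (\<Sum>q\<in>W. wgt m e q)\<bar> \<le> E" "\<And>S. S \<in> qfam y \<Longrightarrow> \<bar>\<Sum>q\<in>W. wgt m e q * qprod S q\<bar> \<le> E"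
      using Y0[OF y(1)] y(2) by (auto simp: W_def m_def e_def Y_def E_def)
    define L where "L = real m / e"
    have L: "L = Y ^ 14" using c6 by (simp add: L_def m_def e_def Y_def flip: power_add)
    have L0: "L > 0" using L c6 by simp
    have LQ: "L \<ge> Q"
    proof -
      have "Y ^ 1 \<le> Y ^ 14" using c6 by (intro power_increasing) auto
      then show ?thesis using L c6 by simp
    qed
    define K where "K = L powr A"
    have K: "K = Y powr (14 * A)"
    proof -
      have "L = Y powr 14" using c6 L by simp
      then show ?thesis unfolding K_def by (simp only: powr_powr)
    qed
    have K4: "K \<ge> 4" using c5 K by simp
    define N where "N = nat \<lfloor>T * K\<rfloor>"
    have TK: "T * K \<ge> 4" using mult_mono[of 1 T 4 K] T K4 by simp
    have N: "real N \<le> T * K" "N \<ge> 1" using TK by (auto simp: N_def le_nat_iff le_floor_iff)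
    have e0: "e > 0" using c6 by (simp add: e_def)
    have Wq: "prime q \<and> q > N \<and> q > y \<and> q \<ge> Q \<and> \<bar>ln (real q) - L\<bar> \<le> d * L" if q: "q \<in> W" for q
    proof -
      have pr: "prime q" and lq: "\<bar>ln (real q) - L\<bar> \<le> d * L" using q by (auto simp: W_def pwindow_def L_def)
      have "d * L \<le> 1/2 * L" using d L0 by (intro mult_right_mono) auto
      then have "L / 2 \<le> ln (real q)" using lq by (simp add: abs_le_iff)
      then have "exp (L / 2) \<le> real q" using pr prime_gt_0_nat[of q] by (subst ln_ge_iff[symmetric]) auto
      moreover have "T * K + Y + real Q < exp (L / 2)" using c2 by (simp add: K L)
      moreover have "T * K \<ge> 0" "Y \<ge> 0" using TK c6 by auto
      ultimately have "real N < real q" "real y < real q" "real Q < real q" using N unfolding Y_def[symmetric] by linarith+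
      then show ?thesis using pr lq by simp
    qed
    define v where "v = (\<lambda>k::nat. sinc2 (real k / K))"
    define M where "M = (\<Sum>k | k \<in> {1..N} \<and> odd_part k \<subseteq> index_set y. v k)"
    \<comment> \<open>Only smooth \<open>k \<le> K / 4\<close> are counted; there the kernel is at
      least \<open>1/4\<close>, whence \<open>1/16\<close>.\<close>
    have Mlow: "M \<ge> c * K / 16"
    proof -
      have "c * (K / 4) \<le> real (card (smooths y (K / 4)))"
        using c4 K4 K by (intro c(2)) (auto simp: Y_def)
      also have "\<dots> = (\<Sum>k\<in>smooths y (K / 4). 1)" by simp
      finally have "c * K / 16 \<le> (\<Sum>k\<in>smooths y (K / 4). 1/4)" by (simp add: mult.commute)
      also have "\<dots> \<le> (\<Sum>k\<in>smooths y (K / 4). v k)"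
      proof (rule sum_mono)
        fix k assume "k \<in> smooths y (K / 4)"
        then have "0 < real k / K" "real k / K \<le> 1/4" using K4 by (auto simp: smooths_def field_simps)
        then show "1/4 \<le> v k" unfolding v_def by (rule sinc2(3))
      qed
      also have "\<dots> \<le> M" unfolding M_def
      proof (rule sum_mono2)
        show "smooths y (K / 4) \<subseteq> {k. k \<in> {1..N} \<and> odd_part k \<subseteq> index_set y}"
        proof
          fix k assume k: "k \<in> smooths y (K / 4)"
          have "real k \<le> K / 4" using k by (simp add: smooths_def)
          also have "K / 4 \<le> 1 * K" using K4 by simp
          also have "\<dots> \<le> T * K" using T K4 by (intro mult_right_mono) auto
          finally have "k \<le> N" by (simp add: N_def le_nat_floor)
          then show "k \<in> {k. k \<in> {1..N} \<and> odd_part k \<subseteq> index_set y}"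
            using k by (auto simp: smooths_def odd_part_def index_set_def prime_factors_dvd)
        qed
      qed (auto simp: v_def sinc2)
      finally show ?thesis .
    qed
    have two: "2 ^ y * E = exp (- (ln 2 * Y))"
    proof -
      have "2 ^ y * E = (1/2) ^ y" unfolding E_def by (simp flip: power_mult_distrib)
      also have "\<dots> = exp (- ln 2) ^ y" by (simp add: exp_minus)
      also have "\<dots> = exp (real y * (- ln 2))" by (rule exp_of_nat_mult[symmetric])
      finally show ?thesis by (simp add: Y_def mult.commute)
    qed
    have E0: "E \<ge> 0" "E \<le> 1/4"
    proof -
      show "E \<ge> 0" by (simp add: E_def)
      have "(1/4::real) ^ y \<le> (1/4) ^ 1" using c6 by (intro power_decreasing) (auto simp: Y_def)
      then show "E \<le> 1/4" by (simp add: E_def)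
    qed
    have tE: "2 ^ y * E * (T * 1024) < c" using c3 c(1) unfolding two by (simp add: field_simps)
    have tE1: "2 ^ y * E \<le> 1"
    proof -
      have "exp (- (ln 2 * Y)) \<le> exp 0" using c6 by (subst exp_le_cancel_iff) auto
      then show ?thesis unfolding two by simp
    qed
    have "\<exists>q\<in>W. q mod 8 = 1 \<and> (\<Sum>k=1..N. v k * legendre_char q (int k)) \<ge> c / 64 * K"
    proof (rule biased_prime_in_window[where y = y and E = E and M = M and a = "wgt m e"])
      show "2 \<le> y" using c6 by (simp add: Y_def)
      show "finite W" unfolding W_def by (rule finite_pwindow)
      show "prime q \<and> N < q \<and> y < q" if "q \<in> W" for q using Wq that by blast
      show "0 \<le> wgt m e q" for q using e0 by (rule wgt_nonneg)
      show "0 \<le> v k \<and> v k \<le> 1" for k by (simp add: v_def sinc2)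
      show "8 * real y ^ y * (8 * real N) \<le> exp (real y ^ 2)"
      proof -
        have "8 * real y ^ y * (8 * real N) \<le> 64 * Y powr Y * (T * K)"
          using N c6 by (simp add: Y_def powr_realpow mult_left_mono)
        also have "\<dots> \<le> exp (Y ^ 2)" using c1 by (simp add: K)
        finally show ?thesis by (simp add: Y_def)
      qed
      \<comment> \<open>In units of \<open>c * K / 1024\<close>, the main term is at least
        \<open>48\<close>, the error at most \<open>1\<close> and the right side at most
        \<open>36\<close>.\<close>
      show "(1 - E) * M - 2 ^ y * E * real N > c / 64 * K * (1 + E + 2 ^ y * E)"
      proof -
        have "(3/4) * (c * K / 16) \<le> (1 - E) * M" using E0 Mlow c(1) K4 by (intro mult_mono) auto
        moreover have "2 ^ y * E * real N \<le> c / 1024 * K"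
        proof -
          have "2 ^ y * E * real N \<le> 2 ^ y * E * (T * K)" using N E0 by (intro mult_left_mono) auto
          also have "\<dots> = (2 ^ y * E * (T * 1024)) / 1024 * K" by simp
          also have "\<dots> \<le> c / 1024 * K" using tE K4 by (intro mult_right_mono divide_right_mono) auto
          finally show ?thesis .
        qed
        moreover have "c / 64 * K * (1 + E + 2 ^ y * E) \<le> c / 64 * K * (9/4)"
          using E0 tE1 c(1) K4 by (intro mult_left_mono) auto
        moreover have "c * K > 0" using c(1) K4 by simp
        moreover have "r < a - b" if "(3/4) * (c * K / 16) \<le> a" "b \<le> c / 1024 * K" "r \<le> c / 64 * K * (9/4)" "c * K > 0" for a b r
          using that by (simp add: field_simps)
        ultimately show ?thesis by blast
      qed
    qed (use H E0 N M_def c(1) K4 in auto)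
    then obtain q where q: "q \<in> W" "q mod 8 = 1" "(\<Sum>k=1..N. v k * legendre_char q (int k)) \<ge> c / 64 * K" by blast
    show ?thesis
      using q Wq[OF q(1)] L0 LQ by (intro exI[of _ q] exI[of _ L]) (auto simp: v_def N_def K_def)
  qed
  then show ?thesis using c(1) by (intro exI[of _ "c / 64"]) auto
qed

section \<open>Gauss sums and the Fejer average\<close>

definition unity :: "nat \<Rightarrow> int \<Rightarrow> complex" where
  "unity q x = cis (2 * pi * real_of_int x / real q)"

lemma unity_add: "unity q (x + y) = unity q x * unity q y"
  by (simp add: unity_def cis_mult add_divide_distrib distrib_left)

lemma unity_0 [simp]: "unity q 0 = 1"
  by (simp add: unity_def)

lemma unity_cnj: "cnj (unity q x) = unity q (- x)"
  by (simp add: unity_def cis_cnj)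

lemma unity_multiple: "q > 0 \<Longrightarrow> unity q (int q * x) = 1"
proof -
  assume "q > 0"
  then have "2 * pi * real_of_int (int q * x) / real q = 2 * pi * real_of_int x" by simp
  then show ?thesis by (simp only: unity_def cis_multiple_2pi Ints_of_int)
qed

lemma unity_eq_1_iff:
  assumes "q > 0" shows "unity q x = 1 \<longleftrightarrow> int q dvd x"
proof
  assume "unity q x = 1"
  then have "cos (2 * pi * real_of_int x / real q) = 1"
    by (metis Re_complex_of_real cis.simps(1) of_real_1 unity_def)
  then obtain n :: int where "2 * pi * real_of_int x / real q = real_of_int n * 2 * pi"
    by (auto simp: cos_one_2pi_int)
  then have "real_of_int x = real_of_int n * real q" using assms by (simp add: field_simps)
  then have "x = n * int q" by (metis of_int_eq_iff of_int_mult of_int_of_nat_eq)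
  then show "int q dvd x" by simp
qed (use assms unity_multiple in \<open>auto elim!: dvdE\<close>)

lemma unity_power: "unity q (x * int n) = unity q x ^ n"
  by (induction n) (auto simp: unity_add distrib_left)

definition residues_of :: "nat \<Rightarrow> int set" where "residues_of q = {0..<int q}"

lemma residues_of: "finite (residues_of q)" "card (residues_of q) = q"
  by (simp_all add: residues_of_def)

lemma residues_of_dvd:
  assumes "x \<in> residues_of q" shows "int q dvd x \<longleftrightarrow> x = 0"
proof
  assume "int q dvd x"
  show "x = 0"
  proof (rule ccontr)
    assume "x \<noteq> 0"
    then have "x > 0" using assms by (simp add: residues_of_def)
    from zdvd_imp_le[OF \<open>int q dvd x\<close> this] show False using assms by (simp add: residues_of_def)
  qed
qed simp

lemma sum_residues_nat: "(\<Sum>x\<in>residues_of q. f x) = (\<Sum>n<q. f (int n))"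
  unfolding residues_of_def
  by (rule sum.reindex_bij_witness[where i = int and j = nat]) auto

lemma unity_sum:
  assumes "q > 0"
  shows "(\<Sum>x\<in>residues_of q. unity q (a * x)) = (if int q dvd a then of_nat q else 0)"
proof -
  have "(\<Sum>x\<in>residues_of q. unity q (a * x)) = (\<Sum>n<q. unity q a ^ n)"
    by (simp add: sum_residues_nat unity_power)
  also have "\<dots> = (if int q dvd a then of_nat q else 0)"
  proof (cases "int q dvd a")
    case True
    then have "unity q a = 1" using assms by (simp add: unity_eq_1_iff)
    then show ?thesis using True by simp
  next
    case False
    then have ne: "unity q a \<noteq> 1" using assms by (simp add: unity_eq_1_iff)
    have "unity q a ^ q = 1" using unity_power[of q a q] unity_multiple[OF assms, of a] by (simp add: mult.commute)
    then show ?thesis using False ne geometric_sum[OF ne, of q] by simp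
  qed
  finally show ?thesis .
qed

lemma sum_residues_shift:
  assumes "q > 0" and per: "\<And>x. f (x mod int q) = f x"
  shows "(\<Sum>x\<in>residues_of q. f (x + a)) = (\<Sum>x\<in>residues_of q. f x)"
proof -
  have "(\<Sum>x\<in>residues_of q. f ((x + a) mod int q)) = (\<Sum>x\<in>residues_of q. f x)"
    by (rule sum.reindex_bij_witness[where i = "\<lambda>x. (x - a) mod int q" and j = "\<lambda>x. (x + a) mod int q"])
       (use assms in \<open>auto simp: residues_of_def mod_diff_left_eq mod_add_left_eq\<close>)
  then show ?thesis by (simp add: per)
qed

lemma sum_residues_mult:
  assumes q: "prime q" and k: "\<not> int q dvd k" and per: "\<And>x. f (x mod int q) = f x"
  shows "(\<Sum>x\<in>residues_of q. f (x * k)) = (\<Sum>x\<in>residues_of q. f x)"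
proof -
  have q0: "q > 0" using q prime_gt_0_nat by auto
  have "coprime k (int q)" using q k by (metis coprime_commute prime_imp_coprime prime_nat_int_transfer)
  then obtain l where l: "[k * l = 1] (mod int q)" using cong_solve_coprime_int by blast
  have inv: "(x * k * l) mod int q = x mod int q" for x
  proof -
    have "[x * (k * l) = x * 1] (mod int q)" using l by (intro cong_mult cong_refl)
    then show ?thesis by (simp add: cong_def mult.assoc)
  qed
  have "(\<Sum>x\<in>residues_of q. f ((x * k) mod int q)) = (\<Sum>x\<in>residues_of q. f x)"
  proof (rule sum.reindex_bij_witness[where i = "\<lambda>x. (x * l) mod int q" and j = "\<lambda>x. (x * k) mod int q"])
    fix x assume x: "x \<in> residues_of q"
    have "((x * k) mod int q * l) mod int q = x mod int q" using inv[of x] by (simp add: mod_mult_left_eq)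
    then show "((x * k) mod int q * l) mod int q = x" using x by (simp add: residues_of_def)
    have "((x * l) mod int q * k) mod int q = x mod int q"
      using inv[of x] by (simp add: mod_mult_left_eq mult.assoc mult.commute[of k])
    then show "((x * l) mod int q * k) mod int q = x" using x by (simp add: residues_of_def)
  qed (use q0 in \<open>auto simp: residues_of_def\<close>)
  then show ?thesis by (simp add: per)
qed

lemma legendre_char_mod: "legendre_char q (x mod int q) = legendre_char q x"
  unfolding legendre_char_def by (intro arg_cong[where f = real_of_int] Legendre_cong) (simp add: cong_def)

lemma legendre_char_mult: "prime q \<Longrightarrow> q > 2 \<Longrightarrow> legendre_char q (a * b) = legendre_char q a * legendre_char q b"
  by (simp add: legendre_char_def Legendre_mult)

lemma legendre_char_square:
  "(legendre_char q a)\<^sup>2 = (if int q dvd a then 0 else 1)"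
  by (auto simp: legendre_char_def Legendre_def cong_0_iff)

lemma legendre_char_dvd: "int q dvd a \<Longrightarrow> legendre_char q a = 0"
  using legendre_char_square[of q a] by simp

lemma legendre_char_abs: "\<bar>legendre_char q a\<bar> \<le> 1"
  by (auto simp: legendre_char_def Legendre_def)

lemma legendre_char_sum:
  assumes q: "prime q" "q > 2"
  shows "(\<Sum>x\<in>residues_of q. legendre_char q x) = 0"
proof -
  obtain a where a: "coprime a q" "Legendre (int a) (int q) = -1" using nonresidue_exists[OF q] by blast
  have "zero_mean q (\<lambda>n. legendre_char q (int n))"
  proof (rule zero_meanI[OF rmult_legendre_char[OF q] _ _ a(1)])
    show "legendre_char q (int (n + q)) = legendre_char q (int n)" for n
      using legendre_char_mod[of q "int n + int q"] legendre_char_mod[of q "int n"] by simp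
  qed (use a q in \<open>auto simp: legendre_char_def\<close>)
  then show ?thesis by (simp add: sum_residues_nat zero_mean_def)
qed

definition gauss :: "nat \<Rightarrow> complex" where
  "gauss q = (\<Sum>x\<in>residues_of q. of_real (legendre_char q x) * unity q x)"

lemma unity_mod: "q > 0 \<Longrightarrow> unity q (x mod int q) = unity q x"
proof -
  assume q: "q > 0"
  have "unity q x = unity q (x mod int q + int q * (x div int q))" by simp
  also have "\<dots> = unity q (x mod int q)" unfolding unity_add using unity_multiple[OF q] by simp
  finally show ?thesis ..
qed

text \<open>For \<open>k\<close> prime to \<open>q\<close> the substitution of \<open>x * k\<close>
  for \<open>x\<close> pulls out \<open>legendre_char q k\<close>, which is its own inverse; for
  \<open>q\<close> dividing \<open>k\<close> both sides vanish, as the symbols sum to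
  \<open>0\<close>.\<close>

lemma gauss_twist:
  assumes q: "prime q" "q > 2"
  shows "(\<Sum>x\<in>residues_of q. of_real (legendre_char q x) * unity q (x * k)) = of_real (legendre_char q k) * gauss q"
proof (cases "int q dvd k")
  case True
  then have "unity q (x * k) = 1" for x using q unity_eq_1_iff[of q "x * k"] by simp
  then have "(\<Sum>x\<in>residues_of q. of_real (legendre_char q x) * unity q (x * k)) = of_real (\<Sum>x\<in>residues_of q. legendre_char q x)"
    by simp
  then show ?thesis using legendre_char_sum[OF q] legendre_char_dvd[OF True] by simp
next
  case False
  define c where "c = legendre_char q k"
  have c2: "c * c = 1" using legendre_char_square[of q k] False by (simp add: c_def power2_eq_square)
  define f where "f = (\<lambda>x. of_real (legendre_char q x) * unity q x)"
  have per: "f (x mod int q) = f x" for x unfolding f_def using q by (simp add: legendre_char_mod unity_mod)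
  have "of_real (legendre_char q x) * unity q (x * k) = of_real c * f (x * k)" for x
  proof -
    have "c * legendre_char q (x * k) = legendre_char q x * (c * c)"
      using q by (simp add: legendre_char_mult c_def mult_ac)
    then have "legendre_char q x = c * legendre_char q (x * k)" using c2 by simp
    then show ?thesis by (simp add: f_def mult.assoc del: of_real_mult flip: of_real_mult)
  qed
  then have "(\<Sum>x\<in>residues_of q. of_real (legendre_char q x) * unity q (x * k)) = of_real c * (\<Sum>x\<in>residues_of q. f (x * k))"
    by (simp only: sum_distrib_left)
  also have "(\<Sum>x\<in>residues_of q. f (x * k)) = gauss q"
    using sum_residues_mult[of q k f] q(1) False per by (simp add: gauss_def f_def)
  finally show ?thesis by (simp add: c_def)
qed

text \<open>Parseval for the twisted Gauss sums, with the factor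
  \<open>cnj (gauss q) * gauss q\<close> left in place. The case \<open>a = 0\<close>, where the
  correlation is \<open>q - 1\<close>, then yields the modulus of the Gauss sum, and with it all
  other correlations follow.\<close>

lemma legendre_correlation_gauss:
  assumes q: "prime q" "q > 2"
  shows "of_real (\<Sum>x\<in>residues_of q. legendre_char q x * legendre_char q (x + a)) * (cnj (gauss q) * gauss q)
    = of_nat q * (if int q dvd a then of_nat q - 1 else - 1)"
proof -
  let ?R = "residues_of q" and ?c = "legendre_char q"
  have q0: "q > 0" using q by simp
  have cn: "cnj (of_real (?c x) * gauss q) = (\<Sum>m\<in>?R. of_real (?c m) * unity q (- (m * x)))" for x
    unfolding gauss_twist[OF q, symmetric] by (simp add: unity_cnj)
  have "of_real (\<Sum>x\<in>?R. ?c x * ?c (x + a)) * (cnj (gauss q) * gauss q)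
     = (\<Sum>x\<in>?R. cnj (of_real (?c x) * gauss q) * (of_real (?c (x + a)) * gauss q))"
    by (simp add: sum_distrib_left sum_distrib_right mult_ac)
  also have "\<dots> = (\<Sum>x\<in>?R. (\<Sum>m\<in>?R. of_real (?c m) * unity q (- (m * x))) * (\<Sum>n\<in>?R. of_real (?c n) * unity q (n * (x + a))))"
    by (intro sum.cong refl arg_cong2[where f = "(*)"] cn gauss_twist[OF q, symmetric])
  also have "\<dots> = (\<Sum>x\<in>?R. \<Sum>m\<in>?R. \<Sum>n\<in>?R. (of_real (?c m * ?c n) * unity q (n * a)) * unity q ((n - m) * x))"
  proof (rule sum.cong[OF refl])
    fix x
    have "(of_real (?c m) * unity q (- (m * x))) * (of_real (?c n) * unity q (n * (x + a)))
       = (of_real (?c m * ?c n) * unity q (n * a)) * unity q ((n - m) * x)" for m n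
    proof -
      have "unity q (- (m * x)) * unity q (n * (x + a)) = unity q (n * a) * unity q ((n - m) * x)"
        by (simp add: algebra_simps flip: unity_add)
      then show ?thesis by (simp add: mult_ac)
    qed
    then show "(\<Sum>m\<in>?R. of_real (?c m) * unity q (- (m * x))) * (\<Sum>n\<in>?R. of_real (?c n) * unity q (n * (x + a)))
      = (\<Sum>m\<in>?R. \<Sum>n\<in>?R. (of_real (?c m * ?c n) * unity q (n * a)) * unity q ((n - m) * x))"
      by (simp only: sum_product)
  qed
  also have "\<dots> = (\<Sum>m\<in>?R. \<Sum>n\<in>?R. (of_real (?c m * ?c n) * unity q (n * a)) * (\<Sum>x\<in>?R. unity q ((n - m) * x)))"
    unfolding sum_distrib_left by (subst sum.swap, rule sum.cong[OF refl], rule sum.swap)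
  also have "\<dots> = (\<Sum>m\<in>?R. \<Sum>n\<in>?R. if n = m then (of_real (?c m * ?c n) * unity q (n * a)) * of_nat q else 0)"
  proof (intro sum.cong refl)
    fix m n assume mn: "m \<in> ?R" "n \<in> ?R"
    have "int q dvd n - m \<longleftrightarrow> n = m"
    proof
      assume "int q dvd n - m"
      then have "n mod int q = m mod int q" by (simp add: mod_eq_dvd_iff)
      then show "n = m" using mn by (simp add: residues_of_def)
    qed simp
    then show "(of_real (?c m * ?c n) * unity q (n * a)) * (\<Sum>x\<in>?R. unity q ((n - m) * x))
      = (if n = m then (of_real (?c m * ?c n) * unity q (n * a)) * of_nat q else 0)"
      unfolding unity_sum[OF q0] by simp
  qed
  also have "\<dots> = (\<Sum>m\<in>?R. of_nat q * (of_real ((?c m)\<^sup>2) * unity q (m * a)))"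
    using residues_of(1) by (intro sum.cong refl) (simp add: power2_eq_square mult_ac)
  also have "\<dots> = of_nat q * (\<Sum>m\<in>?R. of_real ((?c m)\<^sup>2) * unity q (m * a))"
    by (simp only: sum_distrib_left)
  also have "(\<Sum>m\<in>?R. of_real ((?c m)\<^sup>2) * unity q (m * a)) = (if int q dvd a then of_nat q - 1 else - 1)"
  proof -
    have "(\<Sum>m\<in>?R. of_real ((?c m)\<^sup>2) * unity q (m * a)) = (\<Sum>m\<in>?R. unity q (a * m) - (if m = 0 then 1 else 0))"
    proof (rule sum.cong[OF refl])
      fix m assume "m \<in> ?R"
      then have "int q dvd m \<longleftrightarrow> m = 0" by (rule residues_of_dvd)
      then show "of_real ((?c m)\<^sup>2) * unity q (m * a) = unity q (a * m) - (if m = 0 then 1 else 0)"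
        by (simp add: legendre_char_square mult.commute)
    qed
    also have "\<dots> = (if int q dvd a then of_nat q else 0) - 1"
      unfolding sum_subtractf unity_sum[OF q0] using q0 residues_of(1)[of q] by (simp add: residues_of_def)
    finally show ?thesis by simp
  qed
  finally show ?thesis .
qed

lemma cmod_gauss:
  assumes q: "prime q" "q > 2"
  shows "(cmod (gauss q))\<^sup>2 = real q"
proof -
  have "(\<Sum>x\<in>residues_of q. legendre_char q x * legendre_char q (x + 0)) = (\<Sum>x\<in>residues_of q. if x = 0 then 0 else 1)"
  proof (rule sum.cong[OF refl])
    fix x assume "x \<in> residues_of q"
    then have "int q dvd x \<longleftrightarrow> x = 0" by (rule residues_of_dvd)
    then show "legendre_char q x * legendre_char q (x + 0) = (if x = 0 then 0 else 1)"
      using legendre_char_square[of q x] by (simp add: power2_eq_square)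
  qed
  also have "\<dots> = (\<Sum>x\<in>residues_of q. 1 - (if x = 0 then 1 else 0))" by (intro sum.cong) auto
  also have "\<dots> = real q - 1"
    unfolding sum_subtractf using q residues_of(1)[of q] by (simp add: residues_of_def)
  finally have "of_real (real q - 1) * (cnj (gauss q) * gauss q) = of_nat q * (of_nat q - 1)"
    using legendre_correlation_gauss[OF q, of 0] by simp
  moreover have "cnj (gauss q) * gauss q = of_real ((cmod (gauss q))\<^sup>2)"
    by (metis complex_norm_square mult.commute)
  ultimately have "complex_of_real ((real q - 1) * (cmod (gauss q))\<^sup>2) = complex_of_real (real q * (real q - 1))"
    by simp
  then have "(real q - 1) * (cmod (gauss q))\<^sup>2 = real q * (real q - 1)" by (simp only: of_real_eq_iff)
  then show ?thesis using q by simp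
qed

lemma legendre_correlation:
  assumes q: "prime q" "q > 2"
  shows "(\<Sum>x\<in>residues_of q. legendre_char q x * legendre_char q (x + a)) = (if int q dvd a then real q - 1 else -1)"
proof -
  define S where "S = (\<Sum>x\<in>residues_of q. legendre_char q x * legendre_char q (x + a))"
  have "cnj (gauss q) * gauss q = of_real (real q)"
    using cmod_gauss[OF q] by (metis complex_norm_square mult.commute)
  then have "complex_of_real (S * real q) = complex_of_real (real q * (if int q dvd a then real q - 1 else -1))"
  proof -
    have "complex_of_real S * of_real (real q) = of_nat q * (if int q dvd a then of_nat q - 1 else - 1)"
      using legendre_correlation_gauss[OF q, of a] \<open>cnj (gauss q) * gauss q = of_real (real q)\<close>
      unfolding S_def[symmetric] by (simp only:)
    also have "\<dots> = complex_of_real (real q * (if int q dvd a then real q - 1 else -1))" by simp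
    finally show ?thesis by (simp only: of_real_mult)
  qed
  then have "S * real q = real q * (if int q dvd a then real q - 1 else -1)" by (simp only: of_real_eq_iff)
  then show ?thesis using q by (simp add: S_def)
qed

text \<open>Distinct shifts have correlation \<open>-1\<close>, which an upper bound may drop;
  \<open>h \<le> q\<close> makes the shifts \<open>1, ..., h\<close> distinct modulo
  \<open>q\<close>.\<close>

lemma short_sum_second_moment:
  assumes q: "prime q" "q > 2" and h: "h \<le> q"
  shows "(\<Sum>x\<in>residues_of q. (\<Sum>j=1..h. legendre_char q (x + int j))\<^sup>2) \<le> real h * real q"
proof -
  let ?c = "legendre_char q"
  have corr: "(\<Sum>x\<in>residues_of q. ?c (x + int i) * ?c (x + int j)) \<le> (if i = j then real q else 0)"
    if ij: "i \<in> {1..h}" "j \<in> {1..h}" for i j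
  proof -
    define f where "f = (\<lambda>x. ?c x * ?c (x + (int j - int i)))"
    have "f (x mod int q) = f x" for x
      unfolding f_def using legendre_char_mod[of q x] legendre_char_mod[of q "x mod int q + (int j - int i)"]
        legendre_char_mod[of q "x + (int j - int i)"] by (simp add: mod_add_left_eq)
    then have "(\<Sum>x\<in>residues_of q. f (x + int i)) = (\<Sum>x\<in>residues_of q. f x)"
      using q by (intro sum_residues_shift) auto
    also have "\<dots> = (if int q dvd int j - int i then real q - 1 else -1)"
      unfolding f_def by (rule legendre_correlation[OF q])
    finally have eq: "(\<Sum>x\<in>residues_of q. ?c (x + int i) * ?c (x + int j)) = (if int q dvd int j - int i then real q - 1 else -1)"
      by (simp add: f_def)
    have "i = j" if "int q dvd int j - int i"
    proof (rule ccontr)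
      assume "i \<noteq> j"
      then have "int q \<le> \<bar>int j - int i\<bar>" using that dvd_imp_le_int[of "int j - int i" "int q"] by simp
      then show False using ij h by auto
    qed
    then show ?thesis unfolding eq by auto
  qed
  have "(\<Sum>x\<in>residues_of q. (\<Sum>j=1..h. ?c (x + int j))\<^sup>2) = (\<Sum>x\<in>residues_of q. \<Sum>i=1..h. \<Sum>j=1..h. ?c (x + int i) * ?c (x + int j))"
    by (simp add: power2_eq_square sum_product)
  also have "\<dots> = (\<Sum>i=1..h. \<Sum>j=1..h. \<Sum>x\<in>residues_of q. ?c (x + int i) * ?c (x + int j))"
    by (subst sum.swap, rule sum.cong[OF refl], rule sum.swap)
  also have "\<dots> \<le> (\<Sum>i=1..h. \<Sum>j=1..h. if i = j then real q else 0)"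
    by (intro sum_mono corr)
  also have "\<dots> = real h * real q" by simp
  finally show ?thesis .
qed

text \<open>Its squared modulus is \<open>h\<close> times the Fejer kernel of order \<open>h\<close>
  at \<open>k / q\<close>.\<close>

definition dirichlet_poly :: "nat \<Rightarrow> nat \<Rightarrow> int \<Rightarrow> complex" where
  "dirichlet_poly q h k = (\<Sum>j=1..h. unity q (int j * k))"

text \<open>The Gauss sum turns the Fejer weighted sum into the double sum of
  \<open>legendre_char q (i - j)\<close>, which adds up the short sums started at
  \<open>-1, ..., -h\<close>. Absolute values remove the argument of the Gauss sum, whose modulus is
  \<open>sqrt q\<close>.\<close>

lemma fejer_identity:
  assumes q: "prime q" "q > 2"
  shows "\<bar>\<Sum>k\<in>residues_of q. legendre_char q k * (cmod (dirichlet_poly q h k))\<^sup>2\<bar>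
    = sqrt (real q) * \<bar>\<Sum>i=1..h. \<Sum>j=1..h. legendre_char q (int i - int j)\<bar>"
proof -
  let ?c = "legendre_char q" and ?R = "residues_of q"
  have sq: "complex_of_real ((cmod (dirichlet_poly q h k))\<^sup>2) = (\<Sum>i=1..h. \<Sum>j=1..h. unity q (k * (int i - int j)))" for k
  proof -
    have "complex_of_real ((cmod (dirichlet_poly q h k))\<^sup>2) = dirichlet_poly q h k * cnj (dirichlet_poly q h k)"
      by (rule complex_norm_square)
    also have "\<dots> = (\<Sum>i=1..h. \<Sum>j=1..h. unity q (int i * k) * unity q (- (int j * k)))"
      by (simp add: dirichlet_poly_def sum_product unity_cnj)
    also have "\<dots> = (\<Sum>i=1..h. \<Sum>j=1..h. unity q (k * (int i - int j)))"
      by (intro sum.cong refl) (simp add: algebra_simps flip: unity_add)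
    finally show ?thesis .
  qed
  have "complex_of_real (\<Sum>k\<in>?R. ?c k * (cmod (dirichlet_poly q h k))\<^sup>2)
     = (\<Sum>k\<in>?R. of_real (?c k) * (\<Sum>i=1..h. \<Sum>j=1..h. unity q (k * (int i - int j))))"
    by (simp only: of_real_sum of_real_mult sq)
  also have "\<dots> = (\<Sum>k\<in>?R. \<Sum>i=1..h. \<Sum>j=1..h. of_real (?c k) * unity q (k * (int i - int j)))"
    by (simp only: sum_distrib_left)
  also have "\<dots> = (\<Sum>i=1..h. \<Sum>j=1..h. \<Sum>k\<in>?R. of_real (?c k) * unity q (k * (int i - int j)))"
    by (subst sum.swap, rule sum.cong[OF refl], rule sum.swap)
  also have "\<dots> = (\<Sum>i=1..h. \<Sum>j=1..h. of_real (?c (int i - int j)) * gauss q)"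
    by (simp only: gauss_twist[OF q])
  also have "\<dots> = of_real (\<Sum>i=1..h. \<Sum>j=1..h. ?c (int i - int j)) * gauss q"
    by (simp add: sum_distrib_right)
  finally have "cmod (complex_of_real (\<Sum>k\<in>?R. ?c k * (cmod (dirichlet_poly q h k))\<^sup>2))
    = cmod (of_real (\<Sum>i=1..h. \<Sum>j=1..h. ?c (int i - int j)) * gauss q)" by simp
  moreover have "cmod (gauss q) = sqrt (real q)"
    using cmod_gauss[OF q] by (metis norm_ge_zero real_sqrt_unique)
  ultimately show ?thesis by (simp only: norm_of_real norm_mult mult.commute)
qed

section \<open>Short sums near zero and uniform integrability\<close>

lemma short_char_sum_eq:
  assumes "H \<ge> 0"
  shows "short_char_sum f H x = (\<Sum>j=1..nat \<lfloor>H\<rfloor>. f (x + int j))"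
  unfolding short_char_sum_def
proof (rule sum.reindex_bij_witness[where i = "\<lambda>j. x + int j" and j = "\<lambda>n. nat (n - x)"])
  fix n assume "n \<in> {n. x < n \<and> real_of_int n \<le> real_of_int x + H}"
  then have n: "x < n" "real_of_int (n - x) \<le> H" by auto
  then have "n - x \<le> \<lfloor>H\<rfloor>" by (simp only: le_floor_iff)
  then show "nat (n - x) \<in> {1..nat \<lfloor>H\<rfloor>}" using n by auto
  show "x + int (nat (n - x)) = n" "f (x + int (nat (n - x))) = f n" using n by auto
next
  fix j assume j: "j \<in> {1..nat \<lfloor>H\<rfloor>}"
  then have "int j \<le> \<lfloor>H\<rfloor>" by auto
  then have "real j \<le> H" by (simp add: le_floor_iff)
  then show "x + int j \<in> {n. x < n \<and> real_of_int n \<le> real_of_int x + H}" using j by auto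
qed auto

text \<open>The mean of \<open>F^2\<close> is at most \<open>1\<close>. If truncation at
  \<open>T^2\<close> leaves at least \<open>1 - d\<close>, the total excess of \<open>F^2\<close>
  over \<open>T^2\<close> is at most \<open>d * q\<close>, wherever it sits. So the \<open>h\<close>
  points \<open>q - i\<close>, which stand for \<open>-i\<close>, have square sum at most
  \<open>T^2 * h + d * q\<close>, and Cauchy-Schwarz bounds the sum of \<open>F\<close> over them,
  the double sum of the Fejer identity up to \<open>sqrt H\<close>.\<close>

lemma fejer_bound_of_truncated_moment:
  assumes q: "prime q" "q > 2" and H: "1 \<le> H" "H \<le> real q" and h: "h = nat \<lfloor>H\<rfloor>" and T: "T > 0"
    and F: "F = (\<lambda>x. short_char_sum (legendre_char q) H x / sqrt H)"
    and trunc: "(\<Sum>x\<in>residues_of q. min ((F x)\<^sup>2) (T\<^sup>2)) / real q \<ge> 1 - d"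
  shows "(\<Sum>k\<in>residues_of q. legendre_char q k * (cmod (dirichlet_poly q h k))\<^sup>2)\<^sup>2
    \<le> (real q * real h)\<^sup>2 * (2 * (T\<^sup>2 * (real h / real q) + d))"
proof -
  let ?c = "legendre_char q" and ?R = "residues_of q"
  define E where "E = (\<lambda>x. (F x)\<^sup>2 - min ((F x)\<^sup>2) (T\<^sup>2))"
  define G where "G = (\<lambda>i. F (int q - int i))"
  have E0: "E x \<ge> 0" for x by (simp add: E_def)
  have "1 \<le> \<lfloor>H\<rfloor>" using H by (simp add: le_floor_iff)
  then have h1: "h \<ge> 1" "real h \<le> H" "H \<le> 2 * real h"
    using h by linarith+
  then have hq: "h \<le> q" using H by simp
  have Fs: "F x = (\<Sum>j=1..h. ?c (x + int j)) / sqrt H" for x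
    using H by (simp add: F h short_char_sum_eq)
  have "(\<Sum>x\<in>?R. (F x)\<^sup>2) = (\<Sum>x\<in>?R. (\<Sum>j=1..h. ?c (x + int j))\<^sup>2) / H"
    using H by (simp add: Fs power_divide flip: sum_divide_distrib)
  also have "\<dots> \<le> (real h * real q) / H"
    using short_sum_second_moment[OF q hq] H by (intro divide_right_mono) auto
  also have "\<dots> \<le> real q" using h1 H by (simp add: divide_le_eq mult.commute mult_left_mono)
  finally have m2: "(\<Sum>x\<in>?R. (F x)\<^sup>2) \<le> real q" .
  have "(\<Sum>x\<in>?R. min ((F x)\<^sup>2) (T\<^sup>2)) \<ge> (1 - d) * real q"
    using trunc q by (simp add: le_divide_eq)
  then have sumE: "(\<Sum>x\<in>?R. E x) \<le> d * real q"
    using m2 by (simp add: E_def sum_subtractf algebra_simps)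
  have "(\<Sum>i=1..h. (G i)\<^sup>2) \<le> (\<Sum>i=1..h. T\<^sup>2 + E (int q - int i))"
    by (intro sum_mono) (simp add: G_def E_def)
  also have "\<dots> = T\<^sup>2 * real h + (\<Sum>i=1..h. E (int q - int i))" by (simp add: sum.distrib)
  also have "(\<Sum>i=1..h. E (int q - int i)) = (\<Sum>x\<in>(\<lambda>i. int q - int i) ` {1..h}. E x)"
    by (subst sum.reindex) (auto simp: inj_on_def)
  also have "\<dots> \<le> (\<Sum>x\<in>?R. E x)"
    using hq E0 residues_of(1) by (intro sum_mono2) (auto simp: residues_of_def)
  finally have G2: "(\<Sum>i=1..h. (G i)\<^sup>2) \<le> T\<^sup>2 * real h + d * real q" using sumE by simp
  have "(\<Sum>i=1..h. 1 * G i)\<^sup>2 \<le> (\<Sum>i=1..h. 1\<^sup>2) * (\<Sum>i=1..h. (G i)\<^sup>2)"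
    by (rule Cauchy_Schwarz_ineq_sum)
  also have "\<dots> \<le> real h * (T\<^sup>2 * real h + d * real q)"
    using G2 by (simp add: mult_left_mono)
  finally have CS: "(\<Sum>i=1..h. G i)\<^sup>2 \<le> real h * (T\<^sup>2 * real h + d * real q)" by simp
  have "(\<Sum>i=1..h. G i) = (\<Sum>i=1..h. \<Sum>j=1..h. ?c (int j - int i)) / sqrt H"
  proof -
    have "?c (int q - int i + int j) = ?c (int j - int i)" for i j
    proof -
      have "int q - int i + int j = (int j - int i) + int q" by simp
      then have "?c (int q - int i + int j) = ?c (((int j - int i) + int q) mod int q)"
        by (simp only: legendre_char_mod)
      then show ?thesis by (simp only: mod_add_self2 legendre_char_mod)
    qed
    then show ?thesis by (simp add: G_def Fs sum_divide_distrib)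
  qed
  also have "(\<Sum>i=1..h. \<Sum>j=1..h. ?c (int j - int i)) = (\<Sum>i=1..h. \<Sum>j=1..h. ?c (int i - int j))"
    by (rule sum.swap)
  finally have "(\<Sum>i=1..h. \<Sum>j=1..h. ?c (int i - int j)) = sqrt H * (\<Sum>i=1..h. G i)" using H by simp
  then have "(\<Sum>i=1..h. \<Sum>j=1..h. ?c (int i - int j))\<^sup>2 = H * (\<Sum>i=1..h. G i)\<^sup>2"
    using H by (simp add: power_mult_distrib)
  also have "\<dots> \<le> (2 * real h) * (real h * (T\<^sup>2 * real h + d * real q))"
    using CS h1 by (intro mult_mono) auto
  finally have S: "(\<Sum>i=1..h. \<Sum>j=1..h. ?c (int i - int j))\<^sup>2 \<le> (2 * real h) * (real h * (T\<^sup>2 * real h + d * real q))" .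
  have "(\<Sum>k\<in>?R. ?c k * (cmod (dirichlet_poly q h k))\<^sup>2)\<^sup>2 = (sqrt (real q) * \<bar>\<Sum>i=1..h. \<Sum>j=1..h. ?c (int i - int j)\<bar>)\<^sup>2"
    unfolding fejer_identity[OF q, symmetric] by simp
  also have "\<dots> = real q * (\<Sum>i=1..h. \<Sum>j=1..h. ?c (int i - int j))\<^sup>2" by (simp add: power_mult_distrib)
  also have "\<dots> \<le> real q * ((2 * real h) * (real h * (T\<^sup>2 * real h + d * real q)))"
    using S by (intro mult_left_mono) auto
  also have "\<dots> = (real q * real h)\<^sup>2 * (2 * (T\<^sup>2 * (real h / real q) + d))"
    using q by (simp add: field_simps power2_eq_square)
  finally show ?thesis .
qed

text \<open>\<open>min (x^2) (T^2) \<ge> x^2 - x^4 / T^2\<close>, and the fourth moment of the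
  normal law is \<open>3\<close>.\<close>

lemma normal_truncated_second_moment:
  assumes "T > 0"
  shows "1 - 3 / T\<^sup>2 \<le> (LINT x|std_normal_distribution. min (x\<^sup>2) (T\<^sup>2))"
proof -
  interpret real_distribution std_normal_distribution by (rule real_dist_normal_dist)
  note m2 = std_normal_distribution_even_moments[of 1] and m4 = std_normal_distribution_even_moments[of 2]
  have i2: "integrable std_normal_distribution (\<lambda>x. x\<^sup>2)" using m2(2) by simp
  have i4: "integrable std_normal_distribution (\<lambda>x. x ^ 4)" using m4(2) by simp
  have v2: "(LINT x|std_normal_distribution. x\<^sup>2) = 1" using m2(1) by simp
  have v4: "(LINT x|std_normal_distribution. x ^ 4) = 3" using m4(1) by (simp add: fact_numeral)
  have "(LINT x|std_normal_distribution. x\<^sup>2 - x ^ 4 / T\<^sup>2) = 1 - 3 / T\<^sup>2"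
    using i2 i4 v2 v4 by simp
  moreover have "(LINT x|std_normal_distribution. x\<^sup>2 - x ^ 4 / T\<^sup>2) \<le> (LINT x|std_normal_distribution. min (x\<^sup>2) (T\<^sup>2))"
  proof (rule integral_mono)
    show "integrable std_normal_distribution (\<lambda>x. x\<^sup>2 - x ^ 4 / T\<^sup>2)" using i2 i4 by simp
    show "integrable std_normal_distribution (\<lambda>x. min (x\<^sup>2) (T\<^sup>2))"
      using i2 by (rule Bochner_Integration.integrable_bound) auto
    fix x
    show "x\<^sup>2 - x ^ 4 / T\<^sup>2 \<le> min (x\<^sup>2) (T\<^sup>2)"
    proof (cases "x\<^sup>2 \<le> T\<^sup>2")
      case True
      then show ?thesis by simp
    next
      case False
      have "T\<^sup>2 > 0" using assms by simp
      have "T\<^sup>2 * x\<^sup>2 \<le> x\<^sup>2 * x\<^sup>2" using False by (intro mult_right_mono) auto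
      also have "x\<^sup>2 * x\<^sup>2 = x ^ 4" by (simp flip: power_add)
      finally have "x\<^sup>2 \<le> x ^ 4 / T\<^sup>2" using \<open>T\<^sup>2 > 0\<close> by (simp add: le_divide_eq mult.commute)
      moreover have "T\<^sup>2 \<ge> 0" by simp
      moreover have "min (x\<^sup>2) (T\<^sup>2) = T\<^sup>2" using False by simp
      ultimately show ?thesis by linarith
    qed
  qed
  ultimately show ?thesis by simp
qed

lemma infinite_primes_nat: "infinite {q::nat. prime q}"
  using primes_infinite by simp

lemma nth_prime: "prime (nth_prime k)" "k \<le> nth_prime k"
  using enumerate_in_set[OF infinite_primes_nat, of k] le_enumerate[OF infinite_primes_nat, of k]
  by (auto simp: nth_prime_def)

lemma prime_eq_nth_prime:
  assumes "prime q" "q \<ge> nth_prime K" obtains k where "k \<ge> K" "q = nth_prime k"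
proof -
  obtain k where k: "nth_prime k = q" unfolding nth_prime_def
    using enumerate_Ex[OF infinite_primes_nat, of q] assms by auto
  have "nth_prime K \<le> nth_prime k" using assms(2) k by simp
  then have "k \<ge> K" unfolding nth_prime_def by (simp only: enumerate_mono_le_iff[OF infinite_primes_nat])
  then show ?thesis using k that by blast
qed

text \<open>The second moments are at most \<open>1\<close>, the second moment of the limit, so convergence in
  distribution entails uniform integrability of the squares. Hence the very few points within
  \<open>H\<close> of \<open>0\<close> carry a negligible part of the second moment.\<close>

lemma fejer_small_of_weak_conv:
  fixes A e :: real
  assumes A: "A > 0" and e: "e > 0"
    and weak: "weak_conv_m (\<lambda>k. distr (uniform_residues (nth_prime k)) borel
        (\<lambda>x. short_char_sum (legendre_char (nth_prime k)) (H (nth_prime k)) x / sqrt (H (nth_prime k)))) std_normal_distribution"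
    and H: "\<And>q. H q = real q / ln (real q) powr A"
  shows "\<exists>Q. \<forall>q\<ge>Q. prime q \<longrightarrow>
    \<bar>\<Sum>k\<in>residues_of q. legendre_char q k * (cmod (dirichlet_poly q (nat \<lfloor>H q\<rfloor>) k))\<^sup>2\<bar> \<le> e * (real q * real (nat \<lfloor>H q\<rfloor>))"
proof -
  \<comment> \<open>Makes \<open>4 / T^2 = e^2 / 4\<close>. Together with
    \<open>T^2 * h / q \<le> e^2 / 8\<close> for large \<open>q\<close>, this keeps
    \<open>2 * (T^2 * h / q + 4 / T^2)\<close> below \<open>e^2\<close>.\<close>
  define T where "T = 4 / e"
  have T: "T > 0" "4 / T\<^sup>2 = e\<^sup>2 / 4" using e by (auto simp: T_def power_divide)
  \<comment> \<open>Weak convergence tests bounded continuous functions, hence the truncated square.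
    The loss \<open>3 / T^2\<close> of the normal law is relaxed to \<open>4 / T^2\<close>, so that
    the strict inequality passes to large indices.\<close>
  define g where "g = (\<lambda>x::real. min (x\<^sup>2) (T\<^sup>2))"
  define \<mu> where "\<mu> = (\<lambda>k. distr (uniform_residues (nth_prime k)) borel
        (\<lambda>x. short_char_sum (legendre_char (nth_prime k)) (H (nth_prime k)) x / sqrt (H (nth_prime k))))"
  have rd: "real_distribution (\<mu> k)" for k
    unfolding \<mu>_def uniform_residues_def by (intro prob_space.real_distribution_distr measure_pmf.prob_space_axioms) simp
  have "(\<lambda>k. integral\<^sup>L (\<mu> k) g) \<longlonglongrightarrow> integral\<^sup>L std_normal_distribution g"
  proof (rule weak_conv_imp_integral_bdd_continuous_conv[OF rd real_dist_normal_dist])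
    show "weak_conv_m \<mu> std_normal_distribution" using weak by (simp add: \<mu>_def)
    show "isCont g x" for x unfolding g_def by (intro continuous_intros)
    show "norm (g x) \<le> T\<^sup>2" for x by (simp add: g_def)
  qed
  moreover have "1 - 4 / T\<^sup>2 < integral\<^sup>L std_normal_distribution g"
  proof -
    have "3 / T\<^sup>2 < 4 / T\<^sup>2" using T by (intro divide_strict_right_mono) auto
    then show ?thesis using normal_truncated_second_moment[OF T(1)] by (simp add: g_def)
  qed
  ultimately have "\<forall>\<^sub>F k in sequentially. 1 - 4 / T\<^sup>2 < integral\<^sup>L (\<mu> k) g"
    by (rule order_tendstoD(1))
  then obtain K0 where K0: "\<And>k. k \<ge> K0 \<Longrightarrow> 1 - 4 / T\<^sup>2 < integral\<^sup>L (\<mu> k) g"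
    unfolding eventually_sequentially by blast
  have int_eq: "integral\<^sup>L (\<mu> k) g = (\<Sum>x\<in>residues_of (nth_prime k).
      min ((short_char_sum (legendre_char (nth_prime k)) (H (nth_prime k)) x / sqrt (H (nth_prime k)))\<^sup>2) (T\<^sup>2)) / real (nth_prime k)" for k
  proof -
    have q0: "nth_prime k > 0" using nth_prime(1)[of k] prime_gt_0_nat by blast
    have gm: "g \<in> borel_measurable borel" unfolding g_def by measurable
    have "integral\<^sup>L (\<mu> k) g = (LINT x|uniform_residues (nth_prime k). g (short_char_sum (legendre_char (nth_prime k)) (H (nth_prime k)) x / sqrt (H (nth_prime k))))"
      unfolding \<mu>_def by (intro integral_distr gm) (simp add: uniform_residues_def)
    also have "\<dots> = (\<Sum>x\<in>{0..<int (nth_prime k)}. g (short_char_sum (legendre_char (nth_prime k)) (H (nth_prime k)) x / sqrt (H (nth_prime k)))) / real (card {0..<int (nth_prime k)})"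
      unfolding uniform_residues_def using q0 by (intro integral_pmf_of_set) auto
    finally show ?thesis by (simp add: residues_of_def g_def)
  qed
  have lim1: "((\<lambda>x. ln x powr A / x) \<longlongrightarrow> (0::real)) at_top" using A by real_asymp
  have lim2: "filterlim (\<lambda>x. ln x powr A) at_top (at_top :: real filter)" using A by real_asymp
  have "\<forall>\<^sub>F x in at_top. ln x powr A / x < (1::real)" using lim1 by (rule order_tendstoD) simp
  moreover have "\<forall>\<^sub>F x in at_top. max 1 (8 * T\<^sup>2 / e\<^sup>2) \<le> ln (x::real) powr A" using lim2 by (simp only: filterlim_at_top)
  ultimately have "\<forall>\<^sub>F x in at_top. ln x powr A / x < (1::real) \<and> max 1 (8 * T\<^sup>2 / e\<^sup>2) \<le> ln x powr A \<and> x > 2"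
    using eventually_gt_at_top[of "2::real"] by eventually_elim blast
  from eventually_compose_filterlim[OF this filterlim_real_sequentially]
  obtain Q1 where Q1: "\<And>q. q \<ge> Q1 \<Longrightarrow> ln (real q) powr A / real q < 1 \<and> max 1 (8 * T\<^sup>2 / e\<^sup>2) \<le> ln (real q) powr A \<and> real q > 2"
    unfolding eventually_sequentially by blast
  show ?thesis
  proof (intro exI[of _ "max Q1 (nth_prime K0)"] allI impI)
    fix q assume q: "max Q1 (nth_prime K0) \<le> q" "prime q"
    obtain k where k: "k \<ge> K0" "q = nth_prime k" using prime_eq_nth_prime[of q K0] q by auto
    define l where "l = ln (real q) powr A"
    have l: "l / real q < 1" "1 \<le> l" "8 * T\<^sup>2 / e\<^sup>2 \<le> l" "q > 2" using Q1[of q] q by (auto simp: l_def)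
    have Hq: "H q = real q / l" by (simp add: H l_def)
    have H1: "1 \<le> H q" "H q \<le> real q" using l by (auto simp: Hq field_simps)
    define h where "h = nat \<lfloor>H q\<rfloor>"
    have hH: "real h \<le> H q" using H1 by (simp add: h_def)
    have "1 - 4 / T\<^sup>2 \<le> (\<Sum>x\<in>residues_of q. min ((short_char_sum (legendre_char q) (H q) x / sqrt (H q))\<^sup>2) (T\<^sup>2)) / real q"
      using K0[OF k(1)] int_eq[of k] unfolding k(2)[symmetric] by simp
    then have "(\<Sum>k\<in>residues_of q. legendre_char q k * (cmod (dirichlet_poly q h k))\<^sup>2)\<^sup>2
      \<le> (real q * real h)\<^sup>2 * (2 * (T\<^sup>2 * (real h / real q) + 4 / T\<^sup>2))"
      using q l H1 T by (intro fejer_bound_of_truncated_moment[where H = "H q"]) (auto simp: h_def)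
    also have "\<dots> \<le> (real q * real h)\<^sup>2 * e\<^sup>2"
    proof (rule mult_left_mono)
      have arith: "2 * (a + b / 4) \<le> b" if "a \<le> b / 8" "b \<ge> 0" for a b :: real
        using that by (simp add: field_simps)
      have "T\<^sup>2 * (real h / real q) \<le> T\<^sup>2 * (1 / l)"
      proof (intro mult_left_mono)
        have "real h / real q \<le> (real q / l) / real q" using hH l unfolding Hq by (intro divide_right_mono) auto
        then show "real h / real q \<le> 1 / l" using l by simp
      qed simp
      also have "\<dots> \<le> e\<^sup>2 / 8"
      proof -
        have "8 * T\<^sup>2 \<le> l * e\<^sup>2" using l(3) e by (simp add: divide_le_eq)
        then show ?thesis using l(2) by (simp add: field_simps)
      qed
      finally have "T\<^sup>2 * (real h / real q) \<le> e\<^sup>2 / 8" .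
      then show "2 * (T\<^sup>2 * (real h / real q) + 4 / T\<^sup>2) \<le> e\<^sup>2"
        unfolding T(2) by (rule arith) simp
    qed simp
    also have "\<dots> = (e * (real q * real h))\<^sup>2" by (simp add: power_mult_distrib)
    finally have "\<bar>\<Sum>k\<in>residues_of q. legendre_char q k * (cmod (dirichlet_poly q h k))\<^sup>2\<bar> \<le> \<bar>e * (real q * real h)\<bar>"
      by (simp only: abs_le_square_iff)
    then show "\<bar>\<Sum>k\<in>residues_of q. legendre_char q k * (cmod (dirichlet_poly q (nat \<lfloor>H q\<rfloor>) k))\<^sup>2\<bar> \<le> e * (real q * real (nat \<lfloor>H q\<rfloor>))"
      using e by (simp add: h_def)
  qed
qed

section \<open>Comparison of the Fejer weights with the sinc kernel\<close>

lemma sin_ge_quarter: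
  fixes x :: real
  assumes "0 \<le> x" "x \<le> pi / 2"
  shows "x / 4 \<le> sin x"
proof (cases "x \<le> pi / 6")
  case True
  have "cos (pi / 3) \<le> cos x" using True assms pi_gt_zero by (intro cos_monotone_0_pi_le) auto
  then have "x * (1 / 2) \<le> x * cos x" using assms by (intro mult_left_mono) (auto simp: cos_60)
  also have "\<dots> \<le> sin x" using sin_minus_x_cos(2)[of x] assms by simp
  finally show ?thesis using assms by simp
next
  case False
  have "sin (pi / 6) \<le> sin x" using False assms pi_gt_zero by (intro sin_monotone_2pi_le) auto
  then show ?thesis using assms pi_less_4 by (simp add: sin_30)
qed

lemma x_over_sin_squared_le:
  fixes z :: real
  assumes "0 < z" "z \<le> 1"
  shows "1 \<le> (z / sin z)\<^sup>2" "(z / sin z)\<^sup>2 \<le> 1 + 3 * z\<^sup>2"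
proof -
  define w where "w = z\<^sup>2"
  have w: "0 < w" "w \<le> 1" using assms by (auto simp: w_def power_le_one)
  have s0: "sin z > 0" using assms pi_gt3 by (intro sin_gt_zero) auto
  have "sin z \<le> z" using assms by (simp add: sin_x_le_x)
  then have "1 \<le> z / sin z" using s0 by (simp add: le_divide_eq)
  then show "1 \<le> (z / sin z)\<^sup>2" by (rule one_le_power)
  have "(sin (z / 2))\<^sup>2 \<le> (z / 2)\<^sup>2"
    using assms sin_x_le_x[of "z / 2"] pi_gt3 sin_ge_zero[of "z / 2"] by (intro power_mono) auto
  then have "1 - w / 2 \<le> cos z" using cos_double_sin[of "z / 2"] by (simp add: w_def power_divide)
  then have "z * (1 - w / 2) \<le> z * cos z" using assms by (intro mult_left_mono) auto
  also have "\<dots> \<le> sin z" using sin_minus_x_cos(2)[of z] assms pi_gt3 by simp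
  finally have 1: "z * (1 - w / 2) \<le> sin z" .
  have "w * w \<le> w" using w by (simp add: mult_le_cancel_right1)
  then have "1 \<le> (1 - w / 2) * (1 + w)" by (simp add: algebra_simps)
  then have "z * 1 \<le> z * ((1 - w / 2) * (1 + w))" using assms by (intro mult_left_mono) auto
  also have "\<dots> = (z * (1 - w / 2)) * (1 + w)" by simp
  also have "\<dots> \<le> sin z * (1 + w)" using 1 w by (intro mult_right_mono) auto
  finally have "z / sin z \<le> 1 + w" using s0 by (simp add: divide_le_eq mult.commute)
  then have "(z / sin z)\<^sup>2 \<le> (1 + w)\<^sup>2" using assms s0 by (intro power_mono) auto
  also have "\<dots> = 1 + 2 * w + w * w" by (simp add: power2_eq_square algebra_simps)
  also have "\<dots> \<le> 1 + 3 * w" using \<open>w * w \<le> w\<close> by simp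
  finally show "(z / sin z)\<^sup>2 \<le> 1 + 3 * z\<^sup>2" by (simp add: w_def)
qed

lemma sum_inverse_squares_le:
  assumes "N \<ge> 1"
  shows "(\<Sum>k\<in>{N<..M}. 1 / (real k)\<^sup>2) \<le> 1 / real N"
proof -
  have "(\<Sum>k\<in>{N<..M}. 1 / (real k)\<^sup>2) \<le> 1 / real N - 1 / real M" if "N \<le> M"
    using that
  proof (induction M rule: dec_induct)
    case (step n)
    have n: "n \<ge> 1" using step assms by simp
    have "1 / (real (Suc n))\<^sup>2 \<le> 1 / (real n * real (Suc n))"
      using n by (intro divide_left_mono) (auto simp: power2_eq_square)
    also have "\<dots> = 1 / real n - 1 / real (Suc n)" using n by (simp add: field_simps)
    finally have "1 / (real (Suc n))\<^sup>2 \<le> 1 / real n - 1 / real (Suc n)" .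
    moreover have "{N<..Suc n} = insert (Suc n) {N<..n}" using step by auto
    ultimately show ?case using step by simp
  qed simp
  moreover have "1 / real M \<ge> 0" "1 / real N \<ge> 0" by simp_all
  ultimately show ?thesis by (cases "N \<le> M") (linarith, simp)
qed

lemma cmod_unity [simp]: "cmod (unity q x) = 1"
  by (simp add: unity_def)

lemma cmod_unity_minus_1: "cmod (1 - unity q x) = 2 * \<bar>sin (pi * real_of_int x / real q)\<bar>"
  using dist_exp_i_1[of "2 * pi * real_of_int x / real q"]
  by (simp add: unity_def cis_conv_exp norm_minus_commute)

text \<open>The geometric sum in product form, which covers the multiples of \<open>q\<close>, where
  both sines vanish.\<close>

lemma cmod_dirichlet_poly_sin:
  "cmod (dirichlet_poly q h k) * \<bar>sin (pi * real_of_int k / real q)\<bar> = \<bar>sin (real h * (pi * real_of_int k / real q))\<bar>"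
proof -
  let ?z = "unity q k"
  have pw: "unity q (int j * k) = ?z ^ j" for j using unity_power[of q k j] by (simp add: mult.commute)
  have "dirichlet_poly q h k = (\<Sum>j<h. ?z * ?z ^ j)"
    unfolding dirichlet_poly_def pw
    by (rule sum.reindex_bij_witness[where i = Suc and j = "\<lambda>j. j - 1"]) (auto simp flip: power_Suc)
  then have D: "dirichlet_poly q h k = ?z * (\<Sum>j<h. ?z ^ j)" by (simp add: sum_distrib_left)
  have "1 - ?z ^ h = (1 - ?z) * (\<Sum>j<h. ?z ^ j)" by (rule one_diff_power_eq)
  then have "cmod (1 - ?z ^ h) = cmod (1 - ?z) * cmod (dirichlet_poly q h k)"
    by (simp add: D norm_mult)
  moreover have "cmod (1 - ?z ^ h) = 2 * \<bar>sin (pi * real_of_int (int h * k) / real q)\<bar>"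
    unfolding pw[symmetric] by (rule cmod_unity_minus_1)
  ultimately show ?thesis by (simp add: cmod_unity_minus_1 mult_ac)
qed

lemma dirichlet_poly_reflect:
  assumes "q > 0"
  shows "cmod (dirichlet_poly q h (int q - k)) = cmod (dirichlet_poly q h k)"
proof -
  have "unity q (int j * (int q - k)) = cnj (unity q (int j * k))" for j
  proof -
    have "int j * (int q - k) = int q * int j + - (int j * k)" by (simp add: algebra_simps)
    then show ?thesis using unity_multiple[OF assms, of "int j"] by (simp only: unity_add unity_cnj) simp
  qed
  then have "dirichlet_poly q h (int q - k) = cnj (dirichlet_poly q h k)"
    by (simp add: dirichlet_poly_def)
  then show ?thesis by simp
qed

text \<open>\<open>-1\<close> is a square modulo \<open>q\<close>, so the character is even. For an
  odd character the Fejer average would vanish by symmetry.\<close>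

lemma legendre_char_reflect:
  assumes q: "prime q" "q mod 8 = 1"
  shows "legendre_char q (int q - k) = legendre_char q k"
proof -
  have "q \<noteq> 2" using q(2) by auto
  then have q2: "q > 2" using prime_ge_2_nat[OF q(1)] by simp
  have "even ((q - 1) div 2)" using q(2) by presburger
  then have "[Legendre (- 1) (int q) = 1] (mod int q)"
    using euler_criterion[OF q(1) q2, of "- 1"] by simp
  then have "int q dvd Legendre (- 1) (int q) - 1" by (simp add: cong_iff_dvd_diff)
  moreover have "\<not> int q dvd - 2" "\<not> int q dvd - 1" using q2 by (auto dest: zdvd_imp_le)
  ultimately have "Legendre (- 1) (int q) = 1" using Legendre_cases[of "- 1" "int q"] by auto
  then have m1: "legendre_char q (- 1) = 1" by (simp add: legendre_char_def)
  have "legendre_char q (int q - k) = legendre_char q ((- k + int q) mod int q)"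
    by (simp only: legendre_char_mod) simp
  also have "\<dots> = legendre_char q (- 1 * k)" by (simp only: mod_add_self2 legendre_char_mod) simp
  also have "\<dots> = legendre_char q k" using m1 by (simp only: legendre_char_mult[OF q(1) q2] mult_1)
  finally show ?thesis .
qed

lemma sum_residues_even:
  fixes f :: "int \<Rightarrow> real"
  assumes "odd q" and f0: "f 0 = 0" and refl: "\<And>k. f (int q - k) = f k"
  shows "(\<Sum>k\<in>residues_of q. f k) = 2 * (\<Sum>k=1..(q - 1) div 2. f (int k))"
proof -
  define m where "m = (q - 1) div 2"
  have q: "q = 2 * m + 1" using assms(1) by (auto simp: m_def elim!: oddE)
  have "{..<q} = insert 0 {1..2 * m}" by (auto simp: q)
  then have "(\<Sum>n<q. f (int n)) = (\<Sum>n\<in>insert 0 {1..2 * m}. f (int n))" by (rule arg_cong)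
  also have "\<dots> = (\<Sum>n=1..2 * m. f (int n))" by (simp add: f0)
  also have "{1..2 * m} = {1..m} \<union> {m<..2 * m}" by auto
  also have "(\<Sum>n\<in>{1..m} \<union> {m<..2 * m}. f (int n)) = (\<Sum>k=1..m. f (int k)) + (\<Sum>k\<in>{m<..2 * m}. f (int k))"
    by (rule sum.union_disjoint) auto
  also have "(\<Sum>k\<in>{m<..2 * m}. f (int k)) = (\<Sum>k=1..m. f (int q - int k))"
    by (rule sum.reindex_bij_witness[where i = "\<lambda>k. q - k" and j = "\<lambda>k. q - k"])
      (auto simp: q refl of_nat_diff)
  finally show ?thesis unfolding sum_residues_nat m_def[symmetric] by (simp add: refl)
qed

text \<open>The Fejer weight is \<open>(sin y / y)^2 * (z / sin z)^2\<close> with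
  \<open>z = \<pi> * k / q\<close> and \<open>y = h * z\<close>. Moving \<open>y\<close> by at most
  \<open>8 * T * r\<close> to \<open>\<pi> * k / K\<close> costs \<open>16 * T * r\<close>, and
  \<open>(z / sin z)^2 \<le> 1 + 3 * z^2\<close> costs another \<open>12 * T * r\<close>.\<close>

lemma dirichlet_poly_near:
  assumes q: "q > 0" and k: "1 \<le> k" "k \<le> N" and N: "4 * real N \<le> real q" "real N \<le> r * real q"
    and h: "h \<ge> 1" and K: "K > 0" "real N \<le> T * K" and T: "T \<ge> 1"
    and close: "\<bar>real h / real q - 1 / K\<bar> \<le> 1 / real q + r / K"
  shows "\<bar>(cmod (dirichlet_poly q h (int k)))\<^sup>2 / (real h)\<^sup>2 - sinc2 (real k / K)\<bar> \<le> 28 * T * r"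
proof -
  define z where "z = pi * real k / real q"
  define x where "x = pi * (real k / K)"
  define y where "y = real h * z"
  have kN: "real k \<le> real N" "real k > 0" using k by auto
  have r0: "r \<ge> 0"
  proof -
    have "0 < r * real q" using N kN by linarith
    then show ?thesis using q by (simp add: zero_less_mult_iff)
  qed
  have z0: "z > 0" using q kN by (simp add: z_def)
  have zle: "z \<le> 4 * (real k / real q)"
    using pi_less_4 kN q unfolding z_def by (simp add: divide_le_eq mult_right_mono)
  have kq: "4 * (real k / real q) \<le> 1" "real k / real q \<le> r"
    using N kN q by (simp_all add: divide_le_eq)
  have z1: "z \<le> 1" "z \<le> 4 * r" using zle kq by linarith+
  have x0: "x > 0" using kN K by (simp add: x_def)
  have y0: "y > 0" using z0 h by (simp add: y_def)
  have s0: "sin z > 0" using z0 z1 pi_gt3 by (intro sin_gt_zero) auto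
  define sy where "sy = sin y / y"
  define sx where "sx = sin x / x"
  have s1: "\<bar>sy\<bar> \<le> 1" "\<bar>sx\<bar> \<le> 1"
    using abs_sin_x_le_abs_x[of y] abs_sin_x_le_abs_x[of x] x0 y0 by (simp_all add: sy_def sx_def abs_divide divide_le_eq_1)
  have "cmod (dirichlet_poly q h (int k)) * sin z = \<bar>sin y\<bar>"
    using cmod_dirichlet_poly_sin[of q h "int k"] s0 by (simp add: y_def z_def)
  then have "cmod (dirichlet_poly q h (int k)) = \<bar>sin y\<bar> / sin z" using s0 by (simp add: field_simps)
  then have v: "(cmod (dirichlet_poly q h (int k)))\<^sup>2 / (real h)\<^sup>2 = sy\<^sup>2 * (z / sin z)\<^sup>2"
    using z0 h by (simp add: sy_def y_def power_divide power_mult_distrib)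
  have "\<bar>y - x\<bar> = pi * real k * \<bar>real h / real q - 1 / K\<bar>"
  proof -
    have "y - x = (pi * real k) * (real h / real q - 1 / K)"
      by (simp add: y_def x_def z_def field_simps)
    then show ?thesis using kN by (simp add: abs_mult)
  qed
  also have "\<dots> \<le> pi * real k * (1 / real q + r / K)"
    using close kN by (intro mult_left_mono) auto
  also have "\<dots> = pi * (real k / real q + r * (real k / K))" by (simp add: field_simps)
  also have "\<dots> \<le> 4 * (r + r * T)"
  proof (rule mult_mono)
    have "real k / K \<le> T" using kN K by (simp add: divide_le_eq)
    then have "r * (real k / K) \<le> r * T" using r0 by (rule mult_left_mono)
    then show "real k / real q + r * (real k / K) \<le> r + r * T" using kq by linarith
  qed (use pi_less_4 r0 K in auto)
  also have "r + r * T \<le> 2 * (T * r)" using T r0 mult_right_mono[of 1 T r] by (simp add: mult.commute)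
  finally have yx: "\<bar>y - x\<bar> \<le> 8 * (T * r)" by simp
  have "\<bar>sy\<^sup>2 - sx\<^sup>2\<bar> = \<bar>sy - sx\<bar> * \<bar>sy + sx\<bar>"
    by (simp add: power2_eq_square algebra_simps flip: abs_mult)
  also have "\<dots> \<le> (8 * (T * r)) * 2"
    using s1 yx sinc_lipschitz[OF y0 x0] r0 T unfolding sy_def[symmetric] sx_def[symmetric]
    by (intro mult_mono) auto
  finally have A: "\<bar>sy\<^sup>2 - sx\<^sup>2\<bar> \<le> 16 * (T * r)" by simp
  have "sy\<^sup>2 \<le> 1" using s1 by (simp add: abs_square_le_1)
  have zz: "1 \<le> (z / sin z)\<^sup>2" "(z / sin z)\<^sup>2 \<le> 1 + 3 * z\<^sup>2" by (rule x_over_sin_squared_le[OF z0 z1(1)])+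
  have "z\<^sup>2 \<le> z" using z0 z1 by (simp add: power2_eq_square mult_le_cancel_right1)
  also have "\<dots> \<le> 4 * (T * r)" using z1 T r0 mult_right_mono[of 1 T r] by simp
  finally have z2: "z\<^sup>2 \<le> 4 * (T * r)" .
  have "sy\<^sup>2 * ((z / sin z)\<^sup>2 - 1) \<le> 1 * (12 * (T * r))"
    using zz z2 \<open>sy\<^sup>2 \<le> 1\<close> by (intro mult_mono) auto
  moreover have "0 \<le> sy\<^sup>2 * ((z / sin z)\<^sup>2 - 1)" using zz by simp
  moreover have "sy\<^sup>2 * (z / sin z)\<^sup>2 - sx\<^sup>2 = sy\<^sup>2 * ((z / sin z)\<^sup>2 - 1) + (sy\<^sup>2 - sx\<^sup>2)"
    by (simp add: algebra_simps)
  ultimately have "\<bar>sy\<^sup>2 * (z / sin z)\<^sup>2 - sx\<^sup>2\<bar> \<le> 28 * (T * r)" using A by linarith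
  moreover have "sinc2 (real k / K) = sx\<^sup>2" by (simp add: sinc2_def sx_def x_def)
  ultimately show ?thesis using v by simp
qed

text \<open>On the half period the sine is at least \<open>k / (2 * q)\<close>, so the weights decay
  like \<open>(q / (h * k))^2\<close>.\<close>

lemma dirichlet_poly_tail:
  assumes h: "h \<ge> 1" and N: "N \<ge> 1" and M: "2 * M \<le> q"
  shows "(\<Sum>k\<in>{N<..M}. (cmod (dirichlet_poly q h (int k)))\<^sup>2 / (real h)\<^sup>2) \<le> 4 * (real q / real h)\<^sup>2 / real N"
proof -
  have "(cmod (dirichlet_poly q h (int k)))\<^sup>2 / (real h)\<^sup>2 \<le> 4 * (real q / real h)\<^sup>2 * (1 / (real k)\<^sup>2)"
    if k: "N < k" "k \<le> M" for k
  proof -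
    have q0: "real q > 0" "real k > 0" and kq: "2 * real k \<le> real q" using k M by auto
    define z where "z = pi * real k / real q"
    define D where "D = cmod (dirichlet_poly q h (int k))"
    have z0: "0 \<le> z" using q0 by (simp add: z_def)
    have "pi * (2 * real k) \<le> pi * real q" using kq by (intro mult_left_mono) auto
    then have "z \<le> pi / 2" using q0 by (simp add: z_def field_simps)
    then have s: "z / 4 \<le> sin z" using z0 by (intro sin_ge_quarter)
    have "real k / real q / 2 \<le> z / 4"
      using q0 pi_ge_two mult_right_mono[of 2 pi "real k"] by (simp add: z_def field_simps)
    then have s2: "real k / (2 * real q) \<le> sin z" using s by simp
    have "D * (real k / (2 * real q)) \<le> D * \<bar>sin z\<bar>"
      using s2 by (intro mult_left_mono) (auto simp: D_def)
    also have "\<dots> = \<bar>sin (real h * z)\<bar>"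
      using cmod_dirichlet_poly_sin[of q h "int k"] by (simp add: D_def z_def)
    also have "\<dots> \<le> 1" by simp
    finally have "D \<le> 2 * real q / real k" using q0 by (simp add: field_simps)
    then have "D\<^sup>2 \<le> (2 * real q / real k)\<^sup>2" by (intro power_mono) (auto simp: D_def)
    then have "D\<^sup>2 / (real h)\<^sup>2 \<le> (2 * real q / real k)\<^sup>2 / (real h)\<^sup>2" by (rule divide_right_mono) simp
    then show ?thesis unfolding D_def[symmetric] by (simp add: power_divide power_mult_distrib field_simps)
  qed
  then have "(\<Sum>k\<in>{N<..M}. (cmod (dirichlet_poly q h (int k)))\<^sup>2 / (real h)\<^sup>2)
    \<le> (\<Sum>k\<in>{N<..M}. 4 * (real q / real h)\<^sup>2 * (1 / (real k)\<^sup>2))" by (intro sum_mono) auto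
  also have "\<dots> = 4 * (real q / real h)\<^sup>2 * (\<Sum>k\<in>{N<..M}. 1 / (real k)\<^sup>2)"
    by (simp only: sum_distrib_left)
  also have "\<dots> \<le> 4 * (real q / real h)\<^sup>2 * (1 / real N)"
    by (intro mult_left_mono sum_inverse_squares_le N) auto
  finally show ?thesis by simp
qed

text \<open>Evenness folds the sum to \<open>1 \<le> k \<le> (q - 1) / 2\<close>, whence the factor
  \<open>2\<close> in the denominator. In both errors the character is estimated trivially: beyond
  \<open>N\<close> the weights decay, and up to \<open>N\<close> they are exchanged for
  \<open>sinc2\<close>.\<close>

lemma biased_sum_le_fejer_sum:
  assumes q: "prime q" "q mod 8 = 1" and N: "1 \<le> N" "4 * real N \<le> real q" "real N \<le> r * real q"
    and h: "h \<ge> 1" and K: "K > 0" "real N \<le> T * K" and T: "T \<ge> 1"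
    and close: "\<bar>real h / real q - 1 / K\<bar> \<le> 1 / real q + r / K"
  shows "(\<Sum>k=1..N. sinc2 (real k / K) * legendre_char q (int k))
    \<le> \<bar>\<Sum>k\<in>residues_of q. legendre_char q k * (cmod (dirichlet_poly q h k))\<^sup>2\<bar> / (2 * (real h)\<^sup>2)
      + 4 * (real q / real h)\<^sup>2 / real N + 28 * T * r * real N"
proof -
  define M where "M = (q - 1) div 2"
  define v where "v = (\<lambda>k. (cmod (dirichlet_poly q h k))\<^sup>2 / (real h)\<^sup>2)"
  define c where "c = legendre_char q"
  have c1: "\<bar>c k\<bar> \<le> 1" for k by (simp add: c_def legendre_char_abs)
  have q0: "q > 0" and oq: "odd q" using q by (auto simp: prime_gt_0_nat) presburger
  have NM: "N \<le> M" using N(1,2) by (simp add: M_def)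
  have half: "(\<Sum>k\<in>residues_of q. c k * (cmod (dirichlet_poly q h k))\<^sup>2)
    = 2 * (\<Sum>k=1..M. c (int k) * (cmod (dirichlet_poly q h (int k)))\<^sup>2)"
    unfolding M_def c_def using oq
    by (rule sum_residues_even) (simp_all add: legendre_char_dvd legendre_char_reflect[OF q] dirichlet_poly_reflect[OF q0])
  have "(\<Sum>k=1..M. c (int k) * v (int k)) = (\<Sum>k=1..M. c (int k) * (cmod (dirichlet_poly q h (int k)))\<^sup>2) / (real h)\<^sup>2"
    by (simp add: v_def sum_divide_distrib)
  also have "\<dots> = (\<Sum>k\<in>residues_of q. c k * (cmod (dirichlet_poly q h k))\<^sup>2) / (2 * (real h)\<^sup>2)"
    using half by simp
  also have "\<dots> \<le> \<bar>\<Sum>k\<in>residues_of q. c k * (cmod (dirichlet_poly q h k))\<^sup>2\<bar> / (2 * (real h)\<^sup>2)"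
    by (intro divide_right_mono) auto
  finally have 1: "(\<Sum>k=1..M. c (int k) * v (int k))
    \<le> \<bar>\<Sum>k\<in>residues_of q. c k * (cmod (dirichlet_poly q h k))\<^sup>2\<bar> / (2 * (real h)\<^sup>2)" .
  have disj: "{1..N} \<inter> {N<..M} = {}" by auto
  have "{1..M} = {1..N} \<union> {N<..M}" using NM N(1) by auto
  then have 2: "(\<Sum>k=1..M. c (int k) * v (int k)) = (\<Sum>k=1..N. c (int k) * v (int k)) + (\<Sum>k\<in>{N<..M}. c (int k) * v (int k))"
    by (simp only: sum.union_disjoint[OF finite_atLeastAtMost finite_greaterThanAtMost disj])
  have "- v (int k) \<le> c (int k) * v (int k)" for k
    using mult_right_mono[of "- 1" "c (int k)" "v (int k)"] c1[of "int k"] by (simp add: v_def)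
  then have "(\<Sum>k\<in>{N<..M}. - v (int k)) \<le> (\<Sum>k\<in>{N<..M}. c (int k) * v (int k))" by (rule sum_mono)
  moreover have "(\<Sum>k\<in>{N<..M}. v (int k)) \<le> 4 * (real q / real h)\<^sup>2 / real N"
    unfolding v_def using h N(1) by (intro dirichlet_poly_tail) (auto simp: M_def)
  ultimately have 3: "- (4 * (real q / real h)\<^sup>2 / real N) \<le> (\<Sum>k\<in>{N<..M}. c (int k) * v (int k))"
    by (simp add: sum_negf)
  have "sinc2 (real k / K) * c (int k) - c (int k) * v (int k) \<le> 28 * T * r" if "k \<in> {1..N}" for k
  proof -
    have d: "\<bar>v (int k) - sinc2 (real k / K)\<bar> \<le> 28 * T * r"
      unfolding v_def using that by (intro dirichlet_poly_near[OF q0 _ _ N(2,3) h K T close]) auto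
    have "sinc2 (real k / K) * c (int k) - c (int k) * v (int k) \<le> \<bar>c (int k) * (sinc2 (real k / K) - v (int k))\<bar>"
      by (simp add: algebra_simps)
    also have "\<dots> \<le> 1 * \<bar>v (int k) - sinc2 (real k / K)\<bar>"
      unfolding abs_mult abs_minus_commute[of "sinc2 (real k / K)"] using c1 by (intro mult_right_mono) auto
    finally show ?thesis using d by simp
  qed
  then have "(\<Sum>k=1..N. sinc2 (real k / K) * c (int k) - c (int k) * v (int k)) \<le> (\<Sum>k=1..N. 28 * T * r)"
    by (rule sum_mono)
  then have 4: "(\<Sum>k=1..N. sinc2 (real k / K) * c (int k)) \<le> (\<Sum>k=1..N. c (int k) * v (int k)) + 28 * T * r * real N"
    by (simp add: sum_subtractf mult.commute)
  show ?thesis using 1 2 3 4 unfolding c_def by linarith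
qed

section \<open>The contradiction between large and small Fejer averages\<close>

theorem theorem1:
  fixes A :: real and H :: "nat \<Rightarrow> real"
  assumes "A > 0"
    and "\<And>q. H q = real q / ln (real q) powr A"
  shows "\<not> weak_conv_m
    (\<lambda>k. let q = nth_prime k in
      distr (uniform_residues q) borel
        (\<lambda>x. short_char_sum (legendre_char q) (H q) x / sqrt (H q)))
    std_normal_distribution"
proof
  assume "weak_conv_m
    (\<lambda>k. let q = nth_prime k in
      distr (uniform_residues q) borel
        (\<lambda>x. short_char_sum (legendre_char q) (H q) x / sqrt (H q)))
    std_normal_distribution"
  then have weak: "weak_conv_m (\<lambda>k. distr (uniform_residues (nth_prime k)) borel
      (\<lambda>x. short_char_sum (legendre_char (nth_prime k)) (H (nth_prime k)) x / sqrt (H (nth_prime k)))) std_normal_distribution"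
    by (simp only: Let_def)
  note A = assms(1) and H = assms(2)
  obtain c where c: "c > 0" and biased: "\<And>T d Q. T \<ge> 1 \<Longrightarrow> 0 < d \<Longrightarrow> d \<le> 1/2 \<Longrightarrow>
      (\<exists>q L. prime q \<and> q \<ge> Q \<and> q mod 8 = 1 \<and> L > 0 \<and> L \<ge> real Q \<and> \<bar>ln (real q) - L\<bar> \<le> d * L \<and>
        c * L powr A \<le> (\<Sum>k=1..nat \<lfloor>T * L powr A\<rfloor>. sinc2 (real k / L powr A) * legendre_char q (int k)))"
    using biased_prime_exists[OF A] by blast
  \<comment> \<open>\<open>a\<close> compares the powers \<open>A\<close> of \<open>ln q\<close> and
    \<open>L\<close>, which differ by a factor of at most \<open>2\<close>. Then \<open>e\<close>
    (Fejer average), \<open>T\<close> (tail beyond \<open>N\<close>) and \<open>r\<close> (exchange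
    of kernels) are chosen to make each of the three terms at most \<open>c * K / 4\<close>.\<close>
  define a where "a = 2 powr A"
  define e where "e = c / (4 * a)"
  define T where "T = max 1 (128 * a\<^sup>2 / c)"
  define r where "r = c / (128 * T\<^sup>2)"
  have a: "a > 0" by (simp add: a_def)
  have T: "T \<ge> 1" "128 * a\<^sup>2 \<le> T * c" using c by (auto simp: T_def max_def field_simps)
  have e: "e > 0" and r: "r > 0" using a c T by (simp_all add: e_def r_def)
  \<comment> \<open>Continuity fixes the relative width \<open>d\<close> of the window:
    \<open>(ln q / L) powr (- A)\<close> has to be within \<open>r\<close> of
    \<open>1\<close>.\<close>
  have "isCont (\<lambda>t::real. t powr (- A)) 1" by (intro continuous_intros) auto
  then have "\<forall>e>0. \<exists>s>0. \<forall>t. dist t 1 < s \<longrightarrow> dist (t powr (- A)) (1 powr (- A)) < e"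
    unfolding continuous_at_eps_delta .
  then obtain s where s: "s > 0" "\<And>t. \<bar>t - 1\<bar> < s \<Longrightarrow> \<bar>t powr (- A) - 1\<bar> < r"
    unfolding dist_real_def powr_one_eq_one using r by blast
  define d where "d = min (1 / 2) (s / 2)"
  have d: "0 < d" "d \<le> 1/2" "d < s" using s(1) by (auto simp: d_def min_def)
  obtain Q1 where Q1: "\<And>q. q \<ge> Q1 \<Longrightarrow> prime q \<Longrightarrow>
      \<bar>\<Sum>k\<in>residues_of q. legendre_char q k * (cmod (dirichlet_poly q (nat \<lfloor>H q\<rfloor>) k))\<^sup>2\<bar> \<le> e * (real q * real (nat \<lfloor>H q\<rfloor>))"
    using fejer_small_of_weak_conv[OF A e weak H] by blast
  \<comment> \<open>A single limit serves the conditions \<open>4 * N \<le> q\<close>,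
    \<open>N \<le> r * q\<close> and \<open>H q \<ge> 1\<close>.\<close>
  define m where "m = min (1 / 4) r"
  have m: "m > 0" "m \<le> 1 / 4" "m \<le> r" using r by (auto simp: m_def)
  have "((\<lambda>x. T * (a * ln x powr A) / x) \<longlongrightarrow> (0::real)) at_top" using A by real_asymp
  then have "\<forall>\<^sub>F x in at_top. T * (a * ln x powr A) / x < m" by (rule order_tendstoD) (use m in simp)
  from eventually_compose_filterlim[OF this filterlim_real_sequentially]
  obtain Q2 where Q2: "\<And>q. q \<ge> Q2 \<Longrightarrow> T * (a * ln (real q) powr A) / real q < m"
    unfolding eventually_sequentially by blast
  obtain q L where q: "prime q" "q \<ge> max 3 (max Q1 Q2)" "q mod 8 = 1" and L: "L > 0" "L \<ge> real (max 3 (max Q1 Q2))"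
    and qL: "\<bar>ln (real q) - L\<bar> \<le> d * L"
    and bias: "c * L powr A \<le> (\<Sum>k=1..nat \<lfloor>T * L powr A\<rfloor>. sinc2 (real k / L powr A) * legendre_char q (int k))"
    using biased[OF T(1) d(1,2), of "max 3 (max Q1 Q2)"] by blast
  define K where "K = L powr A"
  define K' where "K' = ln (real q) powr A"
  define N where "N = nat \<lfloor>T * K\<rfloor>"
  define h where "h = nat \<lfloor>H q\<rfloor>"
  have q0: "real q > 0" using q(2) by simp
  have L3: "L \<ge> 3" using L(2) by simp
  have "d * L \<le> (1 / 2) * L" using d L by (intro mult_right_mono) auto
  then have lq: "L / 2 \<le> ln (real q)" "ln (real q) \<le> 2 * L" "L \<le> 2 * ln (real q)" using qL L(1) by linarith+
  have lq1: "ln (real q) \<ge> 1" using lq L3 by linarith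
  have K1: "K \<ge> 1" using L3 A by (simp add: K_def ge_one_powr_ge_zero)
  have K'1: "K' \<ge> 1" using lq1 A by (simp add: K'_def ge_one_powr_ge_zero)
  have "K' \<le> (2 * L) powr A" unfolding K'_def using lq lq1 A by (intro powr_mono2) auto
  then have K'K: "K' \<le> a * K" using L by (simp add: powr_mult a_def K_def)
  have "K \<le> (2 * ln (real q)) powr A" unfolding K_def using lq L A by (intro powr_mono2) auto
  then have KK': "K \<le> a * K'" using lq1 by (simp add: powr_mult a_def K'_def)
  have TK: "T * K \<ge> 1" using mult_mono[of 1 T 1 K] T K1 by simp
  have nat_floor: "nat \<lfloor>x\<rfloor> \<ge> 1" "real (nat \<lfloor>x\<rfloor>) \<le> x" "x < real (nat \<lfloor>x\<rfloor>) + 1" "x \<le> 2 * real (nat \<lfloor>x\<rfloor>)"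
    if "x \<ge> 1" for x :: real
  proof -
    show 1: "nat \<lfloor>x\<rfloor> \<ge> 1" "real (nat \<lfloor>x\<rfloor>) \<le> x" and 2: "x < real (nat \<lfloor>x\<rfloor>) + 1" using that by linarith+
    have "real (nat \<lfloor>x\<rfloor>) \<ge> 1" using 1(1) by simp
    with 2 show "x \<le> 2 * real (nat \<lfloor>x\<rfloor>)" by linarith
  qed
  have N1: "N \<ge> 1" and N: "real N \<le> T * K" "T * K \<le> 2 * real N" using nat_floor[OF TK] unfolding N_def by simp_all
  have "T * K \<le> T * (a * K')" using KK' T by (intro mult_left_mono) auto
  also have "\<dots> \<le> m * real q" using Q2[of q] q(2) q0 by (simp add: K'_def divide_less_eq)
  finally have Nm: "real N \<le> m * real q" using N by linarith
  have "m * real q \<le> (1 / 4) * real q" "m * real q \<le> r * real q" using m q0 by (auto intro!: mult_right_mono)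
  then have Nq: "4 * real N \<le> real q" "real N \<le> r * real q" using Nm by linarith+
  have Hq: "H q = real q / K'" by (simp add: H K'_def)
  have "1 \<le> a" using A by (simp add: a_def ge_one_powr_ge_zero)
  then have "1 * K' \<le> T * a * K'" using T K'1 mult_mono[of 1 T 1 a] by (intro mult_right_mono) auto
  also have "\<dots> \<le> m * real q" using Q2[of q] q(2) q0 by (simp add: K'_def divide_less_eq mult.assoc)
  also have "\<dots> \<le> real q" using m q0 by simp
  finally have Hq1: "H q \<ge> 1" using K'1 by (simp add: Hq)
  have h1: "h \<ge> 1" and h: "real h \<le> H q" "H q < real h + 1" "H q \<le> 2 * real h" using nat_floor[OF Hq1] unfolding h_def by simp_all
  have hq: "real q / real h \<le> 2 * K'" using h(3) h1 K'1 unfolding Hq by (simp add: field_simps)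
  have close: "\<bar>real h / real q - 1 / K\<bar> \<le> 1 / real q + r / K"
  proof -
    have "\<bar>real h - H q\<bar> / real q \<le> 1 / real q" using h q0 by (intro divide_right_mono) auto
    moreover have "\<bar>real h - H q\<bar> / real q = \<bar>real h / real q - 1 / K'\<bar>"
    proof -
      have "real h / real q - 1 / K' = (real h - H q) / real q" using q0 by (simp add: Hq diff_divide_distrib)
      then show ?thesis using q0 by (simp add: abs_divide)
    qed
    ultimately have 1: "\<bar>real h / real q - 1 / K'\<bar> \<le> 1 / real q" by simp
    have "ln (real q) / L - 1 = (ln (real q) - L) / L" using L by (simp add: diff_divide_distrib)
    then have "\<bar>ln (real q) / L - 1\<bar> = \<bar>ln (real q) - L\<bar> / L" using L by (simp add: abs_divide)
    also have "\<dots> \<le> d" using qL L by (simp add: divide_le_eq)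
    also have "\<dots> < s" by (rule d)
    finally have "\<bar>(ln (real q) / L) powr (- A) - 1\<bar> < r" by (rule s)
    moreover have "(ln (real q) / L) powr (- A) = K / K'" using lq1 L by (simp add: powr_divide powr_minus K_def K'_def field_simps)
    ultimately have "\<bar>K / K' - 1\<bar> / K \<le> r / K" using K1 by (intro divide_right_mono) auto
    moreover have "\<bar>K / K' - 1\<bar> / K = \<bar>1 / K' - 1 / K\<bar>"
    proof -
      have "1 / K' - 1 / K = (K / K' - 1) / K" using K1 by (simp add: diff_divide_distrib)
      then show ?thesis using K1 by (simp add: abs_divide)
    qed
    ultimately show ?thesis using 1 by linarith
  qed
  let ?F = "\<bar>\<Sum>k\<in>residues_of q. legendre_char q k * (cmod (dirichlet_poly q h k))\<^sup>2\<bar>"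
  have "c * K \<le> ?F / (2 * (real h)\<^sup>2) + 4 * (real q / real h)\<^sup>2 / real N + 28 * T * r * real N"
    using bias biased_sum_le_fejer_sum[OF q(1,3) N1 Nq h1 _ N(1) T(1) close] K1 unfolding K_def[symmetric] N_def[symmetric] by simp
  moreover have "?F / (2 * (real h)\<^sup>2) \<le> c * K / 4"
  proof -
    have "?F \<le> e * (real q * real h)" using Q1[of q] q unfolding h_def by simp
    then have "?F / (2 * (real h)\<^sup>2) \<le> e * (real q * real h) / (2 * (real h)\<^sup>2)" by (rule divide_right_mono) simp
    also have "\<dots> = (e / 2) * (real q / real h)" using h1 by (simp add: power2_eq_square)
    also have "\<dots> \<le> (e / 2) * (2 * (a * K))" using hq K'K e by (intro mult_left_mono) auto
    also have "\<dots> = c * K / 4" using a by (simp add: e_def)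
    finally show ?thesis .
  qed
  moreover have "4 * (real q / real h)\<^sup>2 / real N \<le> c * K / 4"
  proof -
    have "(real q / real h)\<^sup>2 \<le> (2 * (a * K))\<^sup>2" using hq K'K by (intro power_mono) auto
    then have "4 * (real q / real h)\<^sup>2 \<le> 16 * a\<^sup>2 * K\<^sup>2" by (simp add: power_mult_distrib mult_ac)
    also have "\<dots> = (128 * a\<^sup>2) * K\<^sup>2 / 8" by simp
    also have "\<dots> \<le> (T * c) * K\<^sup>2 / 8" using T by (intro divide_right_mono mult_right_mono) auto
    also have "\<dots> = (c * K / 8) * (T * K)" by (simp add: power2_eq_square)
    also have "\<dots> \<le> (c * K / 8) * (2 * real N)" using N c K1 by (intro mult_left_mono) auto
    finally show ?thesis using N1 by (simp add: divide_le_eq mult_ac)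
  qed
  moreover have "28 * T * r * real N \<le> c * K / 4"
  proof -
    have "28 * T * r * real N \<le> 28 * T * r * (T * K)" using N T r by (intro mult_left_mono) auto
    also have "\<dots> = 28 / 128 * (c * K)" using T by (simp add: r_def power2_eq_square)
    also have "\<dots> \<le> c * K / 4" using c K1 by simp
    finally show ?thesis .
  qed
  moreover have "c * K > 0" using c K1 by simp
  ultimately show False by linarith
qed

end
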